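(* Let $\mathfrak p\subset A=\mathbb F_q[T]$ be a nonzero prime ideal, $\mathbb F_{\mathfrak p}=A/\mathfrak p$, $d=\deg_T(\mathfrak p)$. Let $\phi,\psi$ be supersingular Drinfeld modules of rank $r\ge 2$ over $\overline{\mathbb F}_{\mathfrak p}$. Let $f\in A$ be a monic irreducible polynomial of degree $m$ with $f\ne\mathfrak p$ (i.e. $f$ is not the monic generator of $\mathfrak p$). Put $c=\frac{r(r-1)(d-1)}{2}$, let $t$ be an integer with $1\le t<r$, put $s=tm-1$, and assume $tm-1\ge rc$. Let $$M_s=M_s(\phi,\psi)=\{0\}\cup\{u\in\operatorname{Hom}(\phi,\psi): u\ne 0,\ \deg_\tau(u)\le s\},$$ and let $\mathcal C_{s,f}=\rho_f(M_s)\subseteq \operatorname{Mat}_{r\times r}(\mathbb F_{q^m})$ be the additive rank-metric code obtained by restricting the elements of $M_s$ to $f$-torsion. Then $$\dim_{\mathbb F_q}\mathcal C_{s,f}=mrt-c\qquad\text{and}\qquad d_R(\mathcal C_{s,f})=r-t+1 .$$ In particular, $\mathcal C_{s,f}$ is exactly $c$ below the additive Singleton bound for its minimum rank distance, that is, $mr\bigl(r-d_R(\mathcal C_{s,f})+1\bigr)-\dim_{\mathbb F_q}\mathcal C_{s,f}=c$.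
   Context: $q$ is a prime power, $A=\mathbb F_q[T]$. The same symbol is used for a nonzero ideal of $A$ and its monic generator. The field $k=\overline{\mathbb F}_{\mathfrak p}$ is an $A$-field via $\gamma:A\to A/\mathfrak p\hookrightarrow k$; its $A$-characteristic is $\ker\gamma=\mathfrak p$. The twisted polynomial ring $k\{\tau\}$ consists of polynomials $\sum a_i\tau^i$ with $(a\tau^i)(b\tau^j)=ab^{q^i}\tau^{i+j}$; an element acts on $\overline k$ by $\sum a_i\tau^i: x\mapsto\sum a_i x^{q^i}$. A Drinfeld module of rank $r$ over $k$ is an $\mathbb F_q$-algebra homomorphism $\phi:A\to k\{\tau\}$, $a\mapsto\phi_a$, with $\phi_T=\gamma(T)+g_1\tau+\dots+g_r\tau^r$, $g_r\neq 0$. Its height $h$ ($1\le h\le r$) is defined by: the lowest nonzero term of $\phi_{\mathfrak p}$ has $\tau$-degree $hd$; $\phi$ is supersingular if $h=r$. $\operatorname{Hom}(\phi,\psi)=\{u\in\overline k\{\tau\}: u\phi_a=\psi_a u\ \forall a\in A\}$ (geometric morphisms). For $a\in A$ nonzero, $\phi[a]=\{\alpha\in\overline k:\phi_a(\alpha)=0\}$, an $A$-module via $b\cdot\alpha=\phi_b(\alpha)$. For $f$ monic irreducible of degree $m$ prime to the $A$-characteristic, $\phi[f]\cong(A/(f))^r\cong\mathbb F_{q^m}^r$ and likewise $\psi[f]$. Any $u\in\operatorname{Hom}(\phi,\psi)$ restricts to an $A/(f)$-linear map $\phi[f]\to\psi[f]$; after choosing bases and an identification $A/(f)\cong\mathbb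 F_{q^m}$ this gives $\rho_f:\operatorname{Hom}(\phi,\psi)\to\operatorname{Mat}_{r\times r}(\mathbb F_{q^m})$ (rank properties do not depend on the choices). An additive rank-metric code is an $\mathbb F_q$-linear subspace $\mathcal C\subseteq\operatorname{Mat}_{r\times r}(\mathbb F_{q^m})$; if nonzero, $d_R(\mathcal C)=\min\{\operatorname{rk}(X):0\ne X\in\mathcal C\}$ (rank over $\mathbb F_{q^m}$). The additive Singleton bound is $\dim_{\mathbb F_q}\mathcal C\le mr(r-d_R(\mathcal C)+1)$. *)

theory Defs
  imports "HOL-Analysis.Analysis" "HOL-Computational_Algebra.Computational_Algebra"
begin

text \<open>
  Throughout, \<open>'q\<close> is the finite field \<open>F\<^sub>q\<close> with \<open>q = CARD('q)\<close>, and \<open>A = 'q poly\<close>.  A nonzero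
  prime ideal of \<open>A\<close> is given by its monic generator.
\<close>

definition A_field_map :: "('q::field poly \<Rightarrow> 'e::field) \<Rightarrow> bool" where
  "A_field_map \<gamma> \<longleftrightarrow>
     \<gamma> 1 = 1 \<and> (\<forall>a b. \<gamma> (a + b) = \<gamma> a + \<gamma> b) \<and> (\<forall>a b. \<gamma> (a * b) = \<gamma> a * \<gamma> b)"

text \<open>
  \<open>\<epsilon>\<close> identifies \<open>A / (f)\<close> with the field \<open>'l\<close>.  In particular \<open>\<lambda>c. \<epsilon> [:c:]\<close> makes \<open>'l\<close>
  an \<open>F\<^sub>q\<close>-algebra.
\<close>

definition residue_field_map :: "'q::field poly \<Rightarrow> ('q poly \<Rightarrow> 'l::field) \<Rightarrow> bool" where
  "residue_field_map f \<epsilon> \<longleftrightarrow>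
     A_field_map \<epsilon> \<and> (\<forall>a. \<epsilon> a = 0 \<longleftrightarrow> f dvd a) \<and> surj \<epsilon>"

text \<open>
  \<open>'k\<close> is an algebraic closure of \<open>A/\<pp>\<close>, with \<open>\<gamma>\<close> the composite
  \<open>A \<rightarrow> A/\<pp> \<rightarrow> 'k\<close>; the copy of \<open>A/\<pp>\<close> inside \<open>'k\<close> is \<open>range \<gamma>\<close>, and \<open>'k\<close> is
  algebraically closed by its sort.
\<close>

definition residue_closure_map ::
    "'q::field poly \<Rightarrow> ('q poly \<Rightarrow> 'k::alg_closed_field) \<Rightarrow> bool" where
  "residue_closure_map \<pp> \<gamma> \<longleftrightarrow>
     A_field_map \<gamma> \<and> (\<forall>a. \<gamma> a = 0 \<longleftrightarrow> \<pp> dvd a) \<and>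
     (\<forall>x. \<exists>P. P \<noteq> 0 \<and> (\<forall>i. coeff P i \<in> range \<gamma>) \<and> poly P x = 0)"

text \<open>
  Elements of \<open>k{\<tau>}\<close> are represented by their coefficient sequences, i.e. by values of type
  \<open>'k poly\<close> with \<open>\<tau>\<close> as indeterminate.  Addition and \<open>\<tau>\<close>-degree are those of \<open>'k poly\<close>, but
  multiplication is \<open>twisted_mult\<close>, not \<open>*\<close>.
\<close>

definition twisted_mult :: "nat \<Rightarrow> 'k::field poly \<Rightarrow> 'k poly \<Rightarrow> 'k poly" where
  "twisted_mult q u v =
     (\<Sum>i\<le>degree u. \<Sum>j\<le>degree v.
        monom (coeff u i * coeff v j ^ (q ^ i)) (i + j))"

definition twisted_eval :: "nat \<Rightarrow> 'k::field poly \<Rightarrow> 'k \<Rightarrow> 'k" where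
  "twisted_eval q u x = (\<Sum>i\<le>degree u. coeff u i * x ^ (q ^ i))"

text \<open>The fourth conjunct (with additivity and multiplicativity) says that \<open>\<phi>\<close> is a unital
  \<open>F\<^sub>q\<close>-algebra homomorphism; \<open>[:0, 1:]\<close> is \<open>T\<close>.\<close>

definition drinfeld_module ::
    "('q::{field,finite} poly \<Rightarrow> 'k::field) \<Rightarrow> nat \<Rightarrow> ('q poly \<Rightarrow> 'k poly) \<Rightarrow> bool" where
  "drinfeld_module \<gamma> r \<phi> \<longleftrightarrow>
     r \<ge> 1 \<and>
     (\<forall>a b. \<phi> (a + b) = \<phi> a + \<phi> b) \<and>
     (\<forall>a b. \<phi> (a * b) = twisted_mult CARD('q) (\<phi> a) (\<phi> b)) \<and>
     (\<forall>c. \<phi> [:c:] = [:\<gamma> [:c:]:]) \<and>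
     coeff (\<phi> [:0, 1:]) 0 = \<gamma> [:0, 1:] \<and>
     degree (\<phi> [:0, 1:]) = r"

definition has_height ::
    "'q::field poly \<Rightarrow> ('q poly \<Rightarrow> 'k::field poly) \<Rightarrow> nat \<Rightarrow> bool" where
  "has_height \<pp> \<phi> h \<longleftrightarrow>
     coeff (\<phi> \<pp>) (h * degree \<pp>) \<noteq> 0 \<and>
     (\<forall>i < h * degree \<pp>. coeff (\<phi> \<pp>) i = 0)"

definition supersingular ::
    "('q::{field,finite} poly \<Rightarrow> 'k::field) \<Rightarrow> 'q poly \<Rightarrow> nat \<Rightarrow> ('q poly \<Rightarrow> 'k poly) \<Rightarrow> bool" where
  "supersingular \<gamma> \<pp> r \<phi> \<longleftrightarrow> drinfeld_module \<gamma> r \<phi> \<and> has_height \<pp> \<phi> r"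

text \<open>For algebraically closed \<open>k\<close> these are the geometric morphisms.\<close>

definition drinfeld_Hom ::
    "('q::{field,finite} poly \<Rightarrow> 'k::field poly) \<Rightarrow> ('q poly \<Rightarrow> 'k poly) \<Rightarrow> 'k poly set" where
  "drinfeld_Hom \<phi> \<psi> =
     {u. \<forall>a. twisted_mult CARD('q) u (\<phi> a) = twisted_mult CARD('q) (\<psi> a) u}"

definition bounded_Hom ::
    "('q::{field,finite} poly \<Rightarrow> 'k::field poly) \<Rightarrow> ('q poly \<Rightarrow> 'k poly) \<Rightarrow> nat \<Rightarrow> 'k poly set" where
  "bounded_Hom \<phi> \<psi> s = {0} \<union> {u \<in> drinfeld_Hom \<phi> \<psi>. u \<noteq> 0 \<and> degree u \<le> s}"

definition torsion ::
    "('q::{field,finite} poly \<Rightarrow> 'k::field poly) \<Rightarrow> 'q poly \<Rightarrow> 'k set" where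
  "torsion \<phi> f = {\<alpha>. twisted_eval CARD('q) (\<phi> f) \<alpha> = 0}"

text \<open>
  Let \<open>\<epsilon>\<close> identify \<open>A/(f)\<close> with the finite field \<open>'l\<close>.  An element \<open>x\<close> of \<open>'l\<close> acts on
  \<open>\<phi>[f]\<close> as \<open>\<phi>\<^sub>a\<close> for any \<open>a\<close> with \<open>\<epsilon> a = x\<close>; the choice of \<open>a\<close> does not matter on \<open>\<phi>[f]\<close>.
\<close>

definition torsion_scale ::
    "('q::{field,finite} poly \<Rightarrow> 'k::field poly) \<Rightarrow> ('q poly \<Rightarrow> 'l::field) \<Rightarrow> 'l \<Rightarrow> 'k \<Rightarrow> 'k" where
  "torsion_scale \<phi> \<epsilon> x \<alpha> = twisted_eval CARD('q) (\<phi> (inv_into UNIV \<epsilon> x)) \<alpha>"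

definition torsion_comb ::
    "('q::{field,finite} poly \<Rightarrow> 'k::field poly) \<Rightarrow> ('q poly \<Rightarrow> 'l::field) \<Rightarrow>
     ('n::finite \<Rightarrow> 'k) \<Rightarrow> 'l ^ 'n \<Rightarrow> 'k" where
  "torsion_comb \<phi> \<epsilon> b v = (\<Sum>i\<in>UNIV. torsion_scale \<phi> \<epsilon> (v $ i) (b i))"

text \<open>\<open>b\<close> is an \<open>A/(f)\<close>-basis of \<open>\<phi>[f]\<close>: every element of \<open>\<phi>[f]\<close> is a unique linear
  combination of \<open>b\<close>.\<close>

definition torsion_basis ::
    "('q::{field,finite} poly \<Rightarrow> 'k::field poly) \<Rightarrow> 'q poly \<Rightarrow> ('q poly \<Rightarrow> 'l::field) \<Rightarrow>
     ('n::finite \<Rightarrow> 'k) \<Rightarrow> bool" where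
  "torsion_basis \<phi> f \<epsilon> b \<longleftrightarrow>
     (\<forall>i. b i \<in> torsion \<phi> f) \<and> bij_betw (torsion_comb \<phi> \<epsilon> b) UNIV (torsion \<phi> f)"

text \<open>The matrix of \<open>u : \<phi>[f] \<rightarrow> \<psi>[f]\<close> in the bases \<open>b\<close> and \<open>b'\<close>; its \<open>j\<close>-th column holds the
  coordinates of \<open>u (b j)\<close>.\<close>

definition torsion_matrix ::
    "('q::{field,finite} poly \<Rightarrow> 'k::field poly) \<Rightarrow> ('q poly \<Rightarrow> 'l::field) \<Rightarrow>
     ('n::finite \<Rightarrow> 'k) \<Rightarrow> ('n \<Rightarrow> 'k) \<Rightarrow> 'k poly \<Rightarrow> 'l ^ 'n ^ 'n" where
  "torsion_matrix \<psi> \<epsilon> b b' u =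
     (THE X. \<forall>j. twisted_eval CARD('q) u (b j) = torsion_comb \<psi> \<epsilon> b' (column j X))"

definition matrix_scale ::
    "('q::field poly \<Rightarrow> 'l::field) \<Rightarrow> 'q \<Rightarrow> 'l ^ 'n ^ 'm \<Rightarrow> 'l ^ 'n ^ 'm" where
  "matrix_scale \<epsilon> c X = (\<chi> i j. \<epsilon> [:c:] * X $ i $ j)"

text \<open>The dimension over \<open>F\<^sub>q\<close>, not over \<open>'l\<close>.\<close>

definition code_dim :: "('q::field poly \<Rightarrow> 'l::field) \<Rightarrow> ('l ^ 'n ^ 'm) set \<Rightarrow> nat" where
  "code_dim \<epsilon> C = vector_space.dim (matrix_scale \<epsilon>) C"

text \<open>Only meaningful for \<open>C\<close> not contained in \<open>{0}\<close>.\<close>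

definition min_rank_dist :: "('l::field ^ 'n::finite ^ 'm::finite) set \<Rightarrow> nat" where
  "min_rank_dist C = Min (rank ` (C - {0}))"

end

theory Submission
  imports Defs "HOL-Library.Function_Algebras"
begin

text \<open>
  Right multiplication by \<open>\<phi>\<^sub>T\<close> and \<open>\<psi>\<^sub>T\<close> makes \<open>k{\<tau>}\<close> into two free \<open>k[T]\<close>-modules \<open>M\<^sub>\<phi>\<close>, \<open>M\<^sub>\<psi>\<close> of
  rank \<open>r\<close>, and a morphism \<open>u : \<phi> \<rightarrow> \<psi>\<close> amounts to a \<open>k[T]\<close>-linear map \<open>x \<mapsto> x u\<close> from \<open>M\<^sub>\<psi>\<close> to \<open>M\<^sub>\<phi>\<close>
  that commutes with \<open>\<tau>\<close>.  Let \<open>X\<^sub>s\<close> be the \<open>k\<close>-space of all \<open>k[T]\<close>-linear maps \<open>f : M\<^sub>\<psi> \<rightarrow> M\<^sub>\<phi>\<close> that raise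
  the degree by at most \<open>s\<close> and do not lower the order of vanishing in \<open>\<tau>\<close>.  It is stable under the
  injective semilinear map \<open>f \<mapsto> \<tau>\<inverse> f \<tau>\<close>, whose fixed points are \<open>M\<^sub>s\<close>, so by Lang's theorem
  \<open>dim M\<^sub>s = dim\<^sub>k X\<^sub>s\<close>.

  Without the condition on orders the dimension is \<open>\<Sum>\<^sub>j\<^sub><\<^sub>r (s + j + 1)\<close>, since \<open>f\<close> is given by the images of
  \<open>1, \<tau>, \<dots>, \<tau>\<^bsup>r-1\<^esup>\<close>.  By supersingularity \<open>\<phi>\<^sub>\<pp>\<close> and \<open>\<psi>\<^sub>\<pp>\<close> are monomials of degree \<open>rd\<close>, so the order
  filtration is periodic under \<open>\<pp>\<close>, and modulo \<open>\<pp>\<close> each module splits into \<open>d\<close> eigenspaces of \<open>T\<close> on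
  which it induces full flags of length \<open>r\<close>.  Preserving the flags costs \<open>d r (r - 1) / 2\<close> linear
  conditions, independent as soon as \<open>s \<ge> r (d - 1)\<close>; hence \<open>dim M\<^sub>s = r (s + 1) - c\<close>.

  A nonzero \<open>u\<close> has at most \<open>q\<^bsup>deg u\<^esup>\<close> zeros, which bounds its kernel on \<open>\<phi>[f]\<close>: restriction to \<open>\<phi>[f]\<close> is
  injective on \<open>M\<^sub>s\<close> and the ranks are at least \<open>r - t + 1\<close>.  If all of them were larger, the Singleton bound
  would give \<open>mr \<le> c\<close>, contradicting \<open>r c < t m\<close>.
\<close>

section \<open>Dimension counting\<close>

text \<open>A relation rather than \<open>dim\<close>, because the finite-dimensional spaces of maps
  counted below lie in an infinite-dimensional one, and a value of \<open>dim\<close> does not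
  assert finiteness.\<close>

definition (in vector_space) has_dim :: "'b set \<Rightarrow> nat \<Rightarrow> bool" where
  "has_dim V d \<longleftrightarrow> (\<exists>B. finite B \<and> independent B \<and> span B = V \<and> card B = d)"

context vector_space
begin

lemma has_dim_unique: "has_dim V d \<Longrightarrow> has_dim V e \<Longrightarrow> d = e"
  unfolding has_dim_def by (metis dim_span_eq_card_independent)

lemma has_dim_zero: "has_dim {0} 0"
  unfolding has_dim_def by (intro exI[of _ "{}"]) (auto simp: independent_empty)

lemma has_dim_subspace:
  assumes V: "has_dim V d" and K: "subspace K" "K \<subseteq> V"
  obtains e where "has_dim K e"
proof -
  obtain B where B: "finite B" "span B = V"
    using V unfolding has_dim_def by auto
  obtain C where C: "C \<subseteq> K" "independent C" "K \<subseteq> span C"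
    using basis_exists by metis
  have "finite C"
    using independent_span_bound[OF B(1) C(2)] C(1) K(2) B(2) by auto
  moreover have "span C = K"
    using C K(1) span_minimal[of C K] by blast
  ultimately show ?thesis
    using C(2) that unfolding has_dim_def by blast
qed

text \<open>The vector \<open>f\<close> spans a complement of the kernel of \<open>l\<close> in
  \<open>V\<close>, so a basis of the kernel together with \<open>f\<close> is a basis of
  \<open>V\<close>.\<close>

lemma has_dim_kernel:
  fixes l :: "'b \<Rightarrow> 'a"
  assumes V: "subspace V" and f: "f \<in> V" "l f \<noteq> 0"
    and l: "\<And>x y. l (x + y) = l x + l y" "\<And>c x. l (c *s x) = c * l x"
  shows "has_dim {v \<in> V. l v = 0} d \<longleftrightarrow> has_dim V (Suc d)"
proof -
  let ?K = "{v \<in> V. l v = 0}"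
  have up: "has_dim V (Suc e)" if K: "has_dim ?K e" for e
  proof -
    obtain B where B: "finite B" "independent B" "span B = ?K" "card B = e"
      using K unfolding has_dim_def by auto
    have fB: "f \<notin> span B"
      using f B(3) by auto
    then have "f \<notin> B"
      using span_base by blast
    moreover have "span (insert f B) = V"
    proof
      show "span (insert f B) \<subseteq> V"
        using f(1) B(3) span_base[of _ B] by (intro span_minimal V) auto
      show "V \<subseteq> span (insert f B)"
      proof
        fix v assume v: "v \<in> V"
        define c where "c = l v / l f"
        have "v - c *s f \<in> V"
          using v f(1) V by (intro subspace_diff subspace_scale)
        moreover have "l (v - c *s f) = 0"
        proof -
          have "l v = l ((v - c *s f) + c *s f)"
            by simp
          also have "\<dots> = l (v - c *s f) + l v"
            unfolding l using f(2) by (simp add: c_def)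
          finally show ?thesis
            by simp
        qed
        ultimately have "v - c *s f \<in> span B"
          using B(3) by auto
        then show "v \<in> span (insert f B)"
          unfolding span_insert by auto
      qed
    qed
    moreover have "independent (insert f B)"
      using fB B(2) by (rule independent_insertI)
    ultimately show ?thesis
      unfolding has_dim_def using B(1,4) by (intro exI[of _ "insert f B"]) auto
  qed
  show ?thesis
  proof
    assume V1: "has_dim V (Suc d)"
    have l0: "l 0 = 0"
      using l(2)[of 0 0] by simp
    have "subspace ?K"
      using V by (auto simp: subspace_def l l0)
    then obtain e where e: "has_dim ?K e"
      using has_dim_subspace[OF V1] by blast
    then show "has_dim ?K d"
      using has_dim_unique[OF V1 up[OF e]] by simp
  qed (rule up)
qed

text \<open>Triangularity with respect to \<open>key\<close> makes the functionals independent. The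
  one with the largest key is imposed first: all remaining test vectors lie in its kernel, so the
  induction continues with that kernel in place of \<open>V\<close>.\<close>

lemma has_dim_kernels:
  fixes l :: "'i \<Rightarrow> 'b \<Rightarrow> 'a" and key :: "'i \<Rightarrow> nat"
  assumes "finite I" and "subspace V"
    and "\<And>p x y. l p (x + y) = l p x + l p y" and "\<And>p c x. l p (c *s x) = c * l p x"
    and "\<And>p. p \<in> I \<Longrightarrow> f p \<in> V \<and> l p (f p) \<noteq> 0"
    and "\<And>p p'. p \<in> I \<Longrightarrow> p' \<in> I \<Longrightarrow> p \<noteq> p' \<Longrightarrow> key p' \<le> key p \<Longrightarrow> l p (f p') = 0"
  shows "has_dim {v \<in> V. \<forall>p\<in>I. l p v = 0} d \<longleftrightarrow> has_dim V (d + card I)"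
  using assms(1,2,5,6)
proof (induction I arbitrary: V rule: finite_ranking_induct[where f = key])
  case (insert x I)
  note l = assms(3,4)
  show ?case
  proof (cases "x \<in> I")
    case True
    then have "insert x I = I"
      by auto
    then show ?thesis
      using insert.IH[OF insert.prems(1)] insert.prems by simp
  next
    case False
    let ?V = "{v \<in> V. l x v = 0}"
    have l0: "l p 0 = 0" for p
      using l(2)[of p 0 0] by simp
    have sub: "subspace ?V"
      using insert.prems(1) by (auto simp: subspace_def l l0)
    have "has_dim {v \<in> ?V. \<forall>p\<in>I. l p v = 0} d \<longleftrightarrow> has_dim ?V (d + card I)"
    proof (rule insert.IH[OF sub])
      fix p assume "p \<in> I"
      moreover from this have "l x (f p) = 0"
        using insert.prems(3)[of x p] insert.hyps(2)[of p] False by auto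
      ultimately show "f p \<in> ?V \<and> l p (f p) \<noteq> 0"
        using insert.prems(2) by auto
    qed (use insert.prems(3) in auto)
    also have "\<dots> \<longleftrightarrow> has_dim V (Suc (d + card I))"
      using insert.prems(2)[of x] by (intro has_dim_kernel insert.prems l) auto
    also have "{v \<in> ?V. \<forall>p\<in>I. l p v = 0} = {v \<in> V. \<forall>p\<in>insert x I. l p v = 0}"
      by auto
    finally show ?thesis
      using insert.hyps(1) False by simp
  qed
qed simp

end

section \<open>Fixed vectors of semilinear maps\<close>

lemma alg_closed_root_exists:
  fixes x :: "'a::alg_closed_field"
  assumes "q > 0"
  obtains y where "y ^ q = x"
proof -
  have "degree (monom 1 q - [:x:]) = q"
    using assms by (subst diff_conv_add_uminus, subst degree_add_eq_left) (auto simp: degree_monom_eq)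
  then obtain y where "poly (monom 1 q - [:x:]) y = 0"
    using alg_closed_imp_poly_has_root assms by metis
  then show ?thesis
    using that by (auto simp: poly_monom)
qed

text \<open>The equation is given by a polynomial with two nonzero terms of different degrees.
  Dividing out the largest power of the variable therefore leaves a polynomial of positive degree
  that does not vanish at 0, and any root of it will do.\<close>

lemma alg_closed_additive_root:
  fixes \<alpha> :: "nat \<Rightarrow> 'a::alg_closed_field"
  assumes q: "q > 1" and i: "i < m" "\<alpha> i \<noteq> 0"
  obtains y where "y \<noteq> 0" "y ^ (q ^ m) = (\<Sum>i<m. \<alpha> i * y ^ (q ^ i))"
proof -
  define p where "p = monom 1 (q ^ m) - (\<Sum>i<m. monom (\<alpha> i) (q ^ i))"
  have c: "coeff p k = (if k = q ^ m then 1 else 0) - (\<Sum>i<m. if q ^ i = k then \<alpha> i else 0)" for k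
    by (auto simp: p_def coeff_sum)
  have pm: "coeff p (q ^ m) = 1"
    using q by (auto simp: c intro!: sum.neutral)
  have "coeff p (q ^ i) = - (\<Sum>j<m. if j = i then \<alpha> j else 0)"
    using q i by (auto simp: c)
  then have pi: "coeff p (q ^ i) \<noteq> 0"
    using i by simp
  have ne: "q ^ i \<noteq> q ^ m"
    using q i by auto
  have "p \<noteq> 0"
    using pm by auto
  then obtain p' where p': "p = [:- 0, 1:] ^ order 0 p * p'" "\<not> [:- 0, 1:] dvd p'"
    using order_decomp by blast
  have p'': "p = monom 1 (order 0 p) * p'"
    using p'(1) by (simp add: monom_altdef)
  have "degree p' > 0"
  proof (rule ccontr)
    assume "\<not> degree p' > 0"
    then obtain a where "p' = [:a:]"
      by (auto elim: degree_eq_zeroE)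
    then have "p = monom a (order 0 p)"
      using p'' by (simp add: smult_monom)
    then have "coeff p k = (if k = order 0 p then a else 0)" for k
      by (metis coeff_monom)
    then show False
      using pm pi ne by (metis zero_neq_one)
  qed
  then obtain y where y: "poly p' y = 0"
    using alg_closed_imp_poly_has_root by blast
  have "y \<noteq> 0"
    using p'(2) y by (auto simp: poly_eq_0_iff_dvd)
  moreover have "poly p y = 0"
    using y p'' by (metis mult_zero_right poly_mult)
  then have "y ^ (q ^ m) = (\<Sum>i<m. \<alpha> i * y ^ (q ^ i))"
    by (simp add: p_def poly_monom poly_sum)
  ultimately show ?thesis
    using that by blast
qed

lemma power_frobenius_pow:
  fixes x y :: "'a::comm_semiring_1"
  assumes "\<And>x y :: 'a. (x + y) ^ q = x ^ q + y ^ q"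
  shows "(x + y) ^ (q ^ i) = x ^ (q ^ i) + y ^ (q ^ i)"
  by (induction i) (simp_all add: power_mult assms mult.commute[of q])

lemma power_frobenius_sum:
  fixes f :: "'i \<Rightarrow> 'a::comm_semiring_1"
  assumes "\<And>x y :: 'a. (x + y) ^ q = x ^ q + y ^ q" and "q > 0"
  shows "(\<Sum>i\<in>A. f i) ^ q = (\<Sum>i\<in>A. f i ^ q)"
  by (induction A rule: infinite_finite_induct) (simp_all add: assms zero_power)

text \<open>The recursion expresses that \<open>w = \<Sum>\<^sub>i\<^sub>\<le>\<^sub>m b\<^sub>i G\<^sup>i v\<close> is fixed by \<open>G\<close>, up to a multiple of
  \<open>G\<^bsup>m+1\<^esup> v - \<Sum>\<^sub>i\<^sub>\<le>\<^sub>m a\<^sub>i G\<^sup>i v\<close>.  With \<open>b\<^sub>m\<close> the \<open>q\<^bsup>m+1\<^esup>\<close>-th power of \<open>y\<close>, it closes up to a single additive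
  equation for \<open>y\<close>.\<close>

lemma semilinear_recursion:
  fixes a :: "nat \<Rightarrow> 'a::alg_closed_field"
  assumes q: "q > 1" and add: "\<And>x y :: 'a. (x + y) ^ q = x ^ q + y ^ q"
    and a: "i0 \<le> m" "a i0 \<noteq> 0"
  obtains b :: "nat \<Rightarrow> 'a" where "b m \<noteq> 0" "(b 0) ^ q = b m * a 0 ^ q"
    "\<And>i. i < m \<Longrightarrow> b (Suc i) ^ q = b i + b m * a (Suc i) ^ q"
proof -
  define \<rho> where "\<rho> x = (SOME y. y ^ q = x)" for x :: 'a
  have \<rho>: "\<rho> x ^ q = x" for x
  proof -
    have "\<exists>y. y ^ q = x"
      using alg_closed_root_exists[of q x] q by auto
    then show ?thesis
      unfolding \<rho>_def by (rule someI_ex)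
  qed
  have \<rho>_nz: "(\<rho> ^^ j) x \<noteq> 0" if "x \<noteq> 0" for x j
    by (induction j) (use that \<rho> q in \<open>auto, metis power_eq_0_iff\<close>)
  obtain y where y: "y \<noteq> 0" "y ^ (q ^ Suc m) = (\<Sum>l<Suc m. (\<rho> ^^ (m - l)) (a l) * y ^ (q ^ l))"
    using alg_closed_additive_root[OF q, of i0 "Suc m" "\<lambda>l. (\<rho> ^^ (m - l)) (a l)"] a \<rho>_nz by auto
  \<comment> \<open>This solves the recursion upwards from \<open>i = 0\<close> by taking
    \<open>q\<close>-th roots, with \<open>y ^ (q ^ Suc m)\<close> in the place of
    \<open>b m\<close>. The equation chosen for \<open>y\<close> says that the last term really is
    this power.\<close>
  define b where "b i = (\<Sum>l\<le>i. (\<rho> ^^ (i - l)) (a l) * y ^ (q ^ (m - i + l)))" for i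
  have bm: "b m = y ^ (q ^ Suc m)"
    unfolding b_def y(2) by (simp add: lessThan_Suc_atMost)
  have bq: "b i ^ q = (\<Sum>l\<le>i. (\<rho> ^^ (i - l)) (a l) ^ q * y ^ (q ^ (Suc m - i + l)))" if "i \<le> m" for i
  proof -
    have "b i ^ q = (\<Sum>l\<le>i. ((\<rho> ^^ (i - l)) (a l) * y ^ (q ^ (m - i + l))) ^ q)"
      unfolding b_def using q by (intro power_frobenius_sum add) auto
    also have "\<dots> = (\<Sum>l\<le>i. (\<rho> ^^ (i - l)) (a l) ^ q * y ^ (q ^ (Suc m - i + l)))"
      using that by (intro sum.cong) (auto simp: power_mult_distrib Suc_diff_le mult.commute simp flip: power_mult)
    finally show ?thesis .
  qed
  show ?thesis
  proof (rule that[of b])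
    show "b m \<noteq> 0"
      using y(1) bm by simp
    show "b 0 ^ q = b m * a 0 ^ q"
      using bq[of 0] bm by simp
    fix i assume i: "i < m"
    have "b (Suc i) ^ q = (\<Sum>l\<le>Suc i. (\<rho> ^^ (Suc i - l)) (a l) ^ q * y ^ (q ^ (Suc m - Suc i + l)))"
      using i by (intro bq) auto
    also have "\<dots> = (\<Sum>l\<le>i. (\<rho> ^^ (Suc i - l)) (a l) ^ q * y ^ (q ^ (Suc m - Suc i + l)))
        + a (Suc i) ^ q * y ^ (q ^ Suc m)"
      using i by simp
    also have "(\<Sum>l\<le>i. (\<rho> ^^ (Suc i - l)) (a l) ^ q * y ^ (q ^ (Suc m - Suc i + l))) = b i"
      unfolding b_def using i by (intro sum.cong) (auto simp: Suc_diff_le \<rho>)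
    finally show "b (Suc i) ^ q = b i + b m * a (Suc i) ^ q"
      using bm by simp
  qed
qed

lemma (in vector_space) span_family_expansion:
  fixes e :: "nat \<Rightarrow> 'b"
  assumes "subspace U" and "x \<in> span (U \<union> e ` {..<m})"
  shows "\<exists>a. \<exists>z\<in>U. x = (\<Sum>i<m. a i *s e i) + z"
  using assms(2)
proof (induction m arbitrary: x)
  case 0
  then show ?case
    using assms(1) span_minimal[of U U] by auto
next
  case (Suc m)
  have "U \<union> e ` {..<Suc m} = insert (e m) (U \<union> e ` {..<m})"
    by (auto simp: lessThan_Suc)
  then obtain k where "x - k *s e m \<in> span (U \<union> e ` {..<m})"
    using Suc.prems by (auto simp: span_insert)
  then obtain a z where z: "z \<in> U" "x - k *s e m = (\<Sum>i<m. a i *s e i) + z"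
    using Suc.IH by blast
  have "x = (\<Sum>i<Suc m. (a(m := k)) i *s e i) + z"
    using z(2) by (simp add: algebra_simps)
  then show ?case
    using z(1) by blast
qed

lemma (in vector_space) independent_chain:
  fixes e :: "nat \<Rightarrow> 'b"
  assumes "\<And>i. e i \<notin> span (U \<union> e ` {..<i})"
  shows "independent (e ` {..<m}) \<and> card (e ` {..<m}) = m"
proof (induction m)
  case (Suc m)
  have eq: "e ` {..<Suc m} = insert (e m) (e ` {..<m})"
    by (auto simp: lessThan_Suc)
  have n: "e m \<notin> span (e ` {..<m})"
    using assms[of m] subsetD[OF span_mono[OF Un_upper2[of "e ` {..<m}" U]]] by (rule contrapos_nn)
  then have "e m \<notin> e ` {..<m}"
    by (rule contrapos_nn) (rule span_base)
  then show ?case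
    unfolding eq using Suc independent_insertI[OF n] by simp
qed (simp add: independent_empty)

text \<open>\<open>G\<close> is semilinear for the inverse of the Frobenius; \<open>G_scale\<close>
  says so without \<open>q\<close>-th roots.\<close>

locale semilinear_endo = vector_space scale
  for scale :: "'a::alg_closed_field \<Rightarrow> 'b::ab_group_add \<Rightarrow> 'b" (infixr "*s" 75) +
  fixes V :: "'b set" and D q :: nat and G :: "'b \<Rightarrow> 'b"
  assumes q: "q > 1" and frob: "(x + y :: 'a) ^ q = x ^ q + y ^ q"
    and dim_V: "has_dim V D"
    and G_add: "G (v + w) = G v + G w" and G_scale: "G (c ^ q *s v) = c *s G v"
    and G_V: "v \<in> V \<Longrightarrow> G v \<in> V" and G_inj: "v \<in> V \<Longrightarrow> G v = 0 \<Longrightarrow> v = 0"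
begin

abbreviation Fix :: "'b set" where
  "Fix \<equiv> {v \<in> V. G v = v}"

lemma subspace_V: "subspace V"
  using dim_V unfolding has_dim_def by auto

lemma G_0: "G 0 = 0"
  using G_add[of 0 0] by simp

lemma G_diff: "G (v - w) = G v - G w"
  using G_add[of "v - w" w] by simp

lemma G_sum: "G (\<Sum>i\<in>A. f i) = (\<Sum>i\<in>A. G (f i))"
  by (induction A rule: infinite_finite_induct) (simp_all add: G_0 G_add)

lemma span_Fix_subset: "span Fix \<subseteq> V"
  using span_minimal[of Fix V] subspace_V by auto

text \<open>On combinations of fixed vectors \<open>G\<close> takes \<open>q\<close>-th roots of the
  coefficients, so raising the coefficients to the power \<open>q\<close> gives preimages.\<close>

lemma span_Fix_surj: "z \<in> span Fix \<Longrightarrow> \<exists>y\<in>span Fix. G y = z"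
proof (induction rule: span_induct_alt)
  case (step c x y)
  then obtain y' where "y' \<in> span Fix" "G y' = y"
    by auto
  then show ?case
    using step.hyps(1)
    by (intro bexI[of _ "c ^ q *s x + y'"]) (auto simp: G_add G_scale intro: span_add span_scale span_base)
qed (use G_0 span_zero in auto)

lemma span_Fix_reflect:
  assumes v: "v \<in> V" and "G v \<in> span Fix"
  shows "v \<in> span Fix"
proof -
  obtain y where y: "y \<in> span Fix" "G y = G v"
    using span_Fix_surj assms(2) by blast
  then have "v - y = 0"
    using v span_Fix_subset by - (rule G_inj, auto simp: G_diff intro: subspace_diff[OF subspace_V])
  then show ?thesis
    using y(1) by simp
qed

text \<open>For a multiple of a single fixed vector this is the Artin-Schreier equation
  \<open>e - e ^ q = c\<close>, which has a solution in an algebraically closed field.\<close>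

lemma Artin_Schreier_span_Fix: "z \<in> span Fix \<Longrightarrow> \<exists>y\<in>span Fix. G y - y = z"
proof (induction rule: span_induct_alt)
  case (step c x y)
  then obtain y' where y': "y' \<in> span Fix" "G y' - y' = y"
    by auto
  obtain e where e: "e ^ q = e - c"
  proof -
    define p where "p = monom 1 q - [:- c, 1:]"
    have "degree p = q"
      unfolding p_def using q
      by (subst diff_conv_add_uminus, subst degree_add_eq_left) (auto simp: degree_monom_eq)
    then obtain e where "poly p e = 0"
      using alg_closed_imp_poly_has_root[of p] q by auto
    then show ?thesis
      using that[of e] by (simp add: p_def poly_monom algebra_simps)
  qed
  have "G (e ^ q *s x + y') - (e ^ q *s x + y') = c *s x + y"
    using step.hyps(1) y'(2) by (simp add: G_add G_scale) (simp add: e algebra_simps)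
  then show ?case
    using step.hyps(1) y'(1)
    by (intro bexI[of _ "e ^ q *s x + y'"]) (auto intro: span_add span_scale span_base)
qed (use G_0 span_zero in auto)

text \<open>Lang's theorem for \<open>G\<close>. For \<open>v\<close> outside
  \<open>span Fix\<close>, the first linear relation among the iterates of \<open>v\<close> modulo
  \<open>span Fix\<close> yields, by \<open>semilinear_recursion\<close>, a combination
  \<open>w\<close> that is fixed modulo \<open>span Fix\<close>. An Artin-Schreier correction makes
  it fixed, and as its top coefficient \<open>b m\<close> is nonzero, this is a relation shorter
  than the first one.\<close>

lemma span_Fix: "span Fix = V"
proof (rule ccontr)
  assume "span Fix \<noteq> V"
  then obtain v where v: "v \<in> V" "v \<notin> span Fix"
    using span_Fix_subset by auto
  define e where "e i = (G ^^ i) v" for i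
  define U where "U m = span (span Fix \<union> e ` {..<m})" for m
  have e_Suc: "e (Suc i) = G (e i)" for i
    by (simp add: e_def)
  have e_V: "e i \<in> V" for i
    by (induction i) (simp_all add: e_def v(1) G_V)
  have "\<exists>m. e m \<in> U m"
  proof (rule ccontr)
    assume "\<not> ?thesis"
    then have "independent (e ` {..<Suc D}) \<and> card (e ` {..<Suc D}) = Suc D"
      by (intro independent_chain[of _ "span Fix"]) (auto simp: U_def)
    moreover obtain B where "finite B" "span B = V" "card B = D"
      using dim_V unfolding has_dim_def by auto
    ultimately show False
      using independent_span_bound[of B "e ` {..<Suc D}"] e_V by auto
  qed
  then obtain m' where m': "e m' \<in> U m'" "\<And>j. j < m' \<Longrightarrow> e j \<notin> U j"
    using exists_least_iff[of "\<lambda>m. e m \<in> U m"] by blast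
  have "m' \<noteq> 0"
    using v(2) m'(1) by (intro notI) (simp add: U_def e_def span_span)
  then obtain m where m: "m' = Suc m"
    using not0_implies_Suc by blast
  obtain a z where z: "z \<in> span Fix" "e (Suc m) = (\<Sum>i<Suc m. a i *s e i) + z"
    using span_family_expansion[of "span Fix" "e (Suc m)" e "Suc m"] m'(1) m by (auto simp: U_def)
  \<comment> \<open>Otherwise \<open>e (Suc m)\<close> would lie in \<open>span Fix\<close>, and by
    \<open>span_Fix_reflect\<close> so would \<open>e m\<close>, which contradicts the minimality of
    the relation.\<close>
  have "\<exists>i\<le>m. a i \<noteq> 0"
  proof (rule ccontr)
    assume "\<not> ?thesis"
    then have "e (Suc m) \<in> span Fix"
      using z by (simp add: less_Suc_eq_le)
    then have "e m \<in> span Fix"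
      unfolding e_Suc by (rule span_Fix_reflect[OF e_V])
    then have "e m \<in> U m"
      unfolding U_def by (intro span_base) auto
    then show False
      using m'(2) m by simp
  qed
  then obtain i0 where "i0 \<le> m" "a i0 \<noteq> 0"
    by blast
  then obtain b where b: "b m \<noteq> 0" "(b 0) ^ q = b m * a 0 ^ q"
    "\<And>i. i < m \<Longrightarrow> b (Suc i) ^ q = b i + b m * a (Suc i) ^ q"
    by (rule semilinear_recursion[OF q frob, of i0 m a]) (rule that)
  define \<rho> where "\<rho> x = (SOME y. y ^ q = x)" for x :: 'a
  have \<rho>: "\<rho> x ^ q = x" for x
  proof -
    have "\<exists>y. y ^ q = x"
      using alg_closed_root_exists[of q x] q by auto
    then show ?thesis
      unfolding \<rho>_def by (rule someI_ex)
  qed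
  have q_inj: "x = y" if "x ^ q = y ^ q" for x y :: 'a
  proof -
    have "((x - y) + y) ^ q = (x - y) ^ q + y ^ q"
      by (rule frob)
    then show ?thesis
      using that q by simp
  qed
  have b0: "b 0 = \<rho> (b m) * a 0"
    by (rule q_inj) (simp only: b(2) power_mult_distrib \<rho>)
  have bS: "b (Suc i) = \<rho> (b i) + \<rho> (b m) * a (Suc i)" if "i < m" for i
    by (rule q_inj) (simp only: b(3)[OF that] frob power_mult_distrib \<rho>)
  define w where "w = (\<Sum>i<Suc m. b i *s e i)"
  have "G (b i *s e i) = \<rho> (b i) *s e (Suc i)" for i
    using G_scale[of "\<rho> (b i)" "e i"] by (simp add: \<rho> e_Suc)
  \<comment> \<open>Once \<open>e (Suc m)\<close> is replaced by the relation, the recursion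
    restores every coefficient of \<open>w\<close>, and only a multiple of \<open>z\<close>
    remains.\<close>
  then have "G w = (\<Sum>i<m. \<rho> (b i) *s e (Suc i)) + \<rho> (b m) *s e (Suc m)"
    by (simp add: w_def G_add G_sum)
  also have "\<rho> (b m) *s e (Suc m) =
      (\<rho> (b m) * a 0) *s e 0 + (\<Sum>i<m. (\<rho> (b m) * a (Suc i)) *s e (Suc i)) + \<rho> (b m) *s z"
    unfolding z(2) by (simp only: sum.lessThan_Suc_shift scale_right_distrib scale_sum_right scale_scale)
  also have "(\<Sum>i<m. \<rho> (b i) *s e (Suc i)) + ((\<rho> (b m) * a 0) *s e 0
      + (\<Sum>i<m. (\<rho> (b m) * a (Suc i)) *s e (Suc i)) + \<rho> (b m) *s z)
    = (b 0 *s e 0 + (\<Sum>i<m. (\<rho> (b i) + \<rho> (b m) * a (Suc i)) *s e (Suc i))) + \<rho> (b m) *s z"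
    by (simp add: b0 scale_left_distrib sum.distrib algebra_simps)
  also have "(\<Sum>i<m. (\<rho> (b i) + \<rho> (b m) * a (Suc i)) *s e (Suc i)) = (\<Sum>i<m. b (Suc i) *s e (Suc i))"
    by (intro sum.cong) (auto simp: bS)
  also have "b 0 *s e 0 + \<dots> = w"
    by (simp only: w_def sum.lessThan_Suc_shift)
  finally have Gw: "G w - w \<in> span Fix"
    using z(1) by (simp add: span_scale)
  then obtain y where y: "y \<in> span Fix" "G y - y = G w - w"
    using Artin_Schreier_span_Fix by blast
  have "w \<in> V"
    unfolding w_def using e_V by (intro subspace_sum subspace_scale subspace_V) auto
  then have "w - y \<in> Fix"
    using y span_Fix_subset by (auto simp: G_diff algebra_simps intro!: subspace_diff[OF subspace_V])
  then have "(w - y) + y \<in> span Fix"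
    by (rule span_add[OF span_base y(1)])
  then have w: "w \<in> span Fix"
    by simp
  have "b m *s e m = w - (\<Sum>i<m. b i *s e i)"
    by (simp add: w_def)
  also have "\<dots> \<in> U m"
    unfolding U_def using w by (intro span_diff span_sum span_scale) (auto intro: span_base)
  finally have "inverse (b m) *s (b m *s e m) \<in> U m"
    unfolding U_def by (rule span_scale)
  then have "e m \<in> U m"
    using b(1) by simp
  then show False
    using m'(2) m by simp
qed

text \<open>\<open>V\<close> has a basis of fixed vectors, and in such a basis the fixed vectors are
  those whose coefficients satisfy \<open>c ^ q = c\<close>.\<close>

theorem card_Fix: "card Fix = card {c :: 'a. c ^ q = c} ^ D"
proof -
  obtain B where B: "B \<subseteq> Fix" "independent B" "Fix \<subseteq> span B"
    by (rule basis_exists[of Fix]) (rule that)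
  have spB: "span B = V"
  proof
    show "span B \<subseteq> V"
      using B(1) by (intro span_minimal subspace_V) auto
    show "V \<subseteq> span B"
      using span_minimal[OF B(3) subspace_span] by (simp only: span_Fix)
  qed
  obtain C where C: "finite C" "span C = V" "independent C" "card C = D"
    using dim_V unfolding has_dim_def by auto
  have fin: "finite B"
    using independent_span_bound[OF C(1) B(2)] B(1) C(2) by auto
  have cB: "card B = D"
    using has_dim_unique[of V "card B" D] dim_V fin B(2) spB unfolding has_dim_def by blast
  let ?F = "{c :: 'a. c ^ q = c}"
  let ?h = "\<lambda>c. \<Sum>b\<in>B. c b *s b"
  have Gh: "G (?h (\<lambda>b. c b ^ q)) = ?h c" for c
    unfolding G_sum G_scale using B(1) by (intro sum.cong) auto
  have uniq: "\<forall>b\<in>B. c b = c' b" if "?h c = ?h c'" for c c'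
  proof -
    have "?h (\<lambda>b. c b - c' b) = 0"
      using that by (simp add: scale_left_diff_distrib sum_subtractf)
    then show ?thesis
      using B(2) fin independentD[of B B "\<lambda>b. c b - c' b"] by auto
  qed
  have "bij_betw ?h (Pi\<^sub>E B (\<lambda>_. ?F)) Fix"
    unfolding bij_betw_def
  proof (intro conjI subset_antisym subsetI)
    show "inj_on ?h (Pi\<^sub>E B (\<lambda>_. ?F))"
    proof (rule inj_onI)
      fix c c' assume c: "c \<in> Pi\<^sub>E B (\<lambda>_. ?F)" "c' \<in> Pi\<^sub>E B (\<lambda>_. ?F)" "?h c = ?h c'"
      then show "c = c'"
        using uniq[OF c(3)] by (intro PiE_ext) auto
    qed
  next
    fix v assume "v \<in> ?h ` (Pi\<^sub>E B (\<lambda>_. ?F))"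
    then obtain c where c: "c \<in> Pi\<^sub>E B (\<lambda>_. ?F)" "v = ?h c"
      by blast
    have "c b ^ q = c b" if "b \<in> B" for b
      using c(1) that by (auto simp: PiE_def Pi_def)
    then have "?h (\<lambda>b. c b ^ q) = ?h c"
      by (intro sum.cong) simp_all
    then have "G v = v"
      using Gh[of c] unfolding c(2) by simp
    moreover have "v \<in> V"
      unfolding c(2) using B(1) by (intro subspace_sum subspace_scale subspace_V) auto
    ultimately show "v \<in> Fix"
      by simp
  next
    fix v assume v: "v \<in> Fix"
    then have "v \<in> span B"
      unfolding spB by simp
    then obtain c where c: "v = ?h c"
      unfolding span_finite[OF fin] by blast
    have hV: "?h (\<lambda>b. c b ^ q) \<in> V"
      using B(1) by (intro subspace_sum subspace_scale subspace_V) auto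
    \<comment> \<open>\<open>G\<close> maps both vectors to \<open>v\<close>, so injectivity makes
      them equal, and uniqueness of coordinates then gives \<open>c b ^ q = c b\<close>.\<close>
    have "?h (\<lambda>b. c b ^ q) - v = 0"
    proof (rule G_inj)
      show "?h (\<lambda>b. c b ^ q) - v \<in> V"
        using v by (intro subspace_diff[OF subspace_V] hV) simp
      show "G (?h (\<lambda>b. c b ^ q) - v) = 0"
        using v c unfolding G_diff Gh by simp
    qed
    then have "?h (\<lambda>b. c b ^ q) = ?h c"
      unfolding c by (simp only: right_minus_eq)
    then have "\<forall>b\<in>B. c b ^ q = c b"
      by (rule uniq)
    then have r: "restrict c B \<in> Pi\<^sub>E B (\<lambda>_. ?F)"
      by simp
    have "v = ?h (restrict c B)"
      unfolding c by (intro sum.cong) simp_all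
    then show "v \<in> ?h ` (Pi\<^sub>E B (\<lambda>_. ?F))"
      using r by (rule image_eqI[where x = "restrict c B"])
  qed
  then have "card Fix = card (Pi\<^sub>E B (\<lambda>_. ?F))"
    by (rule bij_betw_same_card[symmetric])
  also have "\<dots> = card ?F ^ D"
    using fin cB by (simp add: card_PiE)
  finally show ?thesis .
qed

end

section \<open>Linear operators on coefficient sequences\<close>

definition LO :: "nat \<Rightarrow> 'k::zero poly set" where
  "LO N = {x. \<forall>i<N. coeff x i = 0}"

text \<open>Phrased by coefficients rather than by \<open>degree x < N\<close>, so that it is a
  subspace for \<open>N = 0\<close> too. \<open>LO\<close> filters by order of vanishing in \<tau>,
  \<open>HI\<close> by degree.\<close>

definition HI :: "nat \<Rightarrow> 'k::zero poly set" where
  "HI N = {x. \<forall>i\<ge>N. coeff x i = 0}"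

lemma LO_0 [simp]: "0 \<in> LO N" and HI_0 [simp]: "0 \<in> HI N"
  by (auto simp: LO_def HI_def)

lemma LO_zero [simp]: "x \<in> LO 0"
  by (auto simp: LO_def)

lemma LO_add: "x \<in> LO N \<Longrightarrow> y \<in> LO N \<Longrightarrow> x + y \<in> LO N"
  and HI_add: "x \<in> HI N \<Longrightarrow> y \<in> HI N \<Longrightarrow> x + y \<in> HI N"
  by (auto simp: LO_def HI_def)

lemma LO_diff: "x \<in> LO N \<Longrightarrow> y \<in> LO N \<Longrightarrow> x - y \<in> LO N"
  and HI_diff: "x \<in> HI N \<Longrightarrow> y \<in> HI N \<Longrightarrow> x - y \<in> HI N"
  for x y :: "'k::ab_group_add poly"
  by (auto simp: LO_def HI_def)

lemma LO_smult: "x \<in> LO N \<Longrightarrow> smult c x \<in> LO N"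
  and HI_smult: "x \<in> HI N \<Longrightarrow> smult c x \<in> HI N"
  by (auto simp: LO_def HI_def)

lemma LO_sum: "(\<And>i. i \<in> A \<Longrightarrow> f i \<in> LO N) \<Longrightarrow> (\<Sum>i\<in>A. f i) \<in> LO N"
  and HI_sum: "(\<And>i. i \<in> A \<Longrightarrow> f i \<in> HI N) \<Longrightarrow> (\<Sum>i\<in>A. f i) \<in> HI N"
  by (auto simp: LO_def HI_def coeff_sum)

lemma LO_mono: "x \<in> LO N \<Longrightarrow> M \<le> N \<Longrightarrow> x \<in> LO M"
  and HI_mono: "x \<in> HI N \<Longrightarrow> N \<le> M \<Longrightarrow> x \<in> HI M"
  by (auto simp: LO_def HI_def)

lemma LO_monom: "N \<le> i \<Longrightarrow> monom c i \<in> LO N"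
  and HI_monom: "i < N \<Longrightarrow> monom c i \<in> HI N"
  by (auto simp: LO_def HI_def)

lemma HI_degree: "x \<in> HI (Suc (degree x))"
  by (auto simp: HI_def coeff_eq_0)

lemma HI_degree_iff: "x \<noteq> 0 \<Longrightarrow> x \<in> HI (Suc N) \<longleftrightarrow> degree x \<le> N"
  by (auto simp: HI_def coeff_eq_0 Suc_le_eq intro: degree_le)

lemma LO_Suc: "x \<in> LO (Suc N) \<longleftrightarrow> x \<in> LO N \<and> coeff x N = 0"
  by (auto simp: LO_def less_Suc_eq)

lemma HI_expand:
  fixes x :: "'k::comm_monoid_add poly"
  assumes "x \<in> HI N"
  shows "x = (\<Sum>i<N. monom (coeff x i) i)"
  using assms by (intro poly_eqI) (auto simp: coeff_sum HI_def)

definition klinear :: "('k::field poly \<Rightarrow> 'k poly) \<Rightarrow> bool" where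
  "klinear f \<longleftrightarrow> (\<forall>x y. f (x + y) = f x + f y) \<and> (\<forall>c x. f (smult c x) = smult c (f x))"

lemma klinear_add: "klinear f \<Longrightarrow> f (x + y) = f x + f y"
  and klinear_smult: "klinear f \<Longrightarrow> f (smult c x) = smult c (f x)"
  by (auto simp: klinear_def)

lemma klinear_0: "klinear f \<Longrightarrow> f 0 = 0"
  using klinear_smult[of f 0 0] by simp

lemma klinear_diff: "klinear f \<Longrightarrow> f (x - y) = f x - f y"
  using klinear_add[of f "x - y" y] by simp

lemma klinear_sum: "klinear f \<Longrightarrow> f (\<Sum>i\<in>A. g i) = (\<Sum>i\<in>A. f (g i))"
  by (induction A rule: infinite_finite_induct) (simp_all add: klinear_0 klinear_add)

lemma klinear_expand:
  assumes f: "klinear f" and x: "x \<in> HI N"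
  shows "f x = (\<Sum>i<N. smult (coeff x i) (f (monom 1 i)))"
proof -
  have "f x = f (\<Sum>i<N. smult (coeff x i) (monom 1 i))"
    using HI_expand[OF x] by (simp add: smult_monom)
  then show ?thesis
    by (simp add: klinear_sum[OF f] klinear_smult[OF f])
qed

lemma klinear_eqI:
  assumes "klinear f" "klinear g" "\<And>i. f (monom 1 i) = g (monom 1 i)"
  shows "f x = g x"
  unfolding klinear_expand[OF assms(1) HI_degree[of x]] klinear_expand[OF assms(2) HI_degree[of x]]
  by (simp only: assms(3))

lemma klinear_pow: "klinear S \<Longrightarrow> klinear (S ^^ l)"
  by (induction l) (auto simp: klinear_def)

lemma klinear_comp: "klinear f \<Longrightarrow> klinear g \<Longrightarrow> klinear (\<lambda>x. f (g x))"
  by (auto simp: klinear_def)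

lemma klinear_scale: "klinear (smult c)"
  by (auto simp: klinear_def smult_add_right mult.commute)

lemma klinear_ident: "klinear (\<lambda>x. x)"
  by (auto simp: klinear_def)

lemma smult_sum_right: "smult c (\<Sum>i\<in>A. f i) = (\<Sum>i\<in>A. smult c (f i))"
  by (induction A rule: infinite_finite_induct) (auto simp: smult_add_right)

definition lin :: "(nat \<Rightarrow> 'k::field poly) \<Rightarrow> 'k poly \<Rightarrow> 'k poly" where
  "lin K x = (\<Sum>i\<le>degree x. smult (coeff x i) (K i))"

lemma lin_eq:
  assumes "x \<in> HI N"
  shows "lin K x = (\<Sum>i<N. smult (coeff x i) (K i))"
proof -
  have "(\<Sum>i<Suc (degree x). smult (coeff x i) (K i)) = (\<Sum>i<max N (Suc (degree x)). smult (coeff x i) (K i))"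
    by (rule sum.mono_neutral_left) (auto simp: coeff_eq_0)
  also have "\<dots> = (\<Sum>i<N. smult (coeff x i) (K i))"
    using assms by (intro sum.mono_neutral_right) (auto simp: HI_def)
  finally show ?thesis
    by (simp add: lin_def lessThan_Suc_atMost)
qed

lemma klinear_lin: "klinear (lin K)"
  unfolding klinear_def
proof (intro conjI allI)
  fix x y :: "'a poly" and c
  let ?N = "max (Suc (degree x)) (Suc (degree y))"
  have xy: "x \<in> HI ?N" "y \<in> HI ?N"
    using HI_degree HI_mono max.cobounded1 max.cobounded2 by metis+
  show "lin K (x + y) = lin K x + lin K y"
    using xy by (simp add: lin_eq[OF HI_add[OF xy]] lin_eq[OF xy(1)] lin_eq[OF xy(2)] smult_add_left sum.distrib)
  show "lin K (smult c x) = smult c (lin K x)"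
    using xy(1) by (simp add: lin_eq[OF HI_smult[OF xy(1)]] lin_eq[OF xy(1)] smult_sum_right smult_add_right)
qed

lemma lin_monom: "lin K (monom c i) = smult c (K i)"
proof -
  have "lin K (monom c i) = (\<Sum>l<Suc i. smult (coeff (monom c i) l) (K l))"
    by (intro lin_eq HI_monom) simp
  also have "\<dots> = (\<Sum>l\<in>{i}. smult (coeff (monom c i) l) (K l))"
    by (intro sum.mono_neutral_right) auto
  finally show ?thesis
    by simp
qed

text \<open>The value of \<open>P\<close> at the operator \<open>S\<close>. Here \<open>P\<close> is
  an ordinary polynomial, whereas \<open>x\<close>, of the same type, stands for an element of
  \<open>k{\<tau>}\<close>.\<close>

definition papp :: "'k::field poly \<Rightarrow> ('k poly \<Rightarrow> 'k poly) \<Rightarrow> 'k poly \<Rightarrow> 'k poly" where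
  "papp P S x = (\<Sum>l\<le>degree P. smult (coeff P l) ((S ^^ l) x))"

lemma papp_smult: "papp P (smult c) x = smult (poly P c) x"
proof -
  have "((smult c) ^^ l) x = smult (c ^ l) x" for l
    by (induction l) auto
  then show ?thesis
    by (simp add: papp_def poly_altdef smult_sum)
qed

lemma papp_commute:
  assumes f: "klinear f" and fS: "\<And>x. f (S x) = S' (f x)"
  shows "f (papp P S x) = papp P S' (f x)"
proof -
  have "f ((S ^^ l) x) = (S' ^^ l) (f x)" for l
    by (induction l) (auto simp: fS)
  then show ?thesis
    by (simp add: papp_def klinear_sum[OF f] klinear_smult[OF f])
qed

text \<open>\<open>Bez P S g R\<close> applies \<open>(P(X) - P(Y)) / (X - Y) = \<Sum>\<^sub>l p\<^sub>l \<Sum>\<^sub>a\<^sub><\<^sub>l X\<^sup>a Y\<^bsup>l-1-a\<^esup>\<close> to \<open>g\<close>, with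
  \<open>X\<close> acting by \<open>S\<close> on the left and \<open>Y\<close> by \<open>R\<close> on the right.  It turns a map commuting with
  \<open>P(\<cdot>)\<close> into one that intertwines \<open>R\<close> and \<open>S\<close>.\<close>

primrec bez :: "('k::field poly \<Rightarrow> 'k poly) \<Rightarrow> ('k poly \<Rightarrow> 'k poly) \<Rightarrow> ('k poly \<Rightarrow> 'k poly) \<Rightarrow> nat \<Rightarrow> 'k poly \<Rightarrow> 'k poly" where
  "bez S g R 0 x = 0"
| "bez S g R (Suc l) x = S (bez S g R l x) + g ((R ^^ l) x)"

definition Bez :: "'k::field poly \<Rightarrow> ('k poly \<Rightarrow> 'k poly) \<Rightarrow> ('k poly \<Rightarrow> 'k poly) \<Rightarrow> ('k poly \<Rightarrow> 'k poly) \<Rightarrow> 'k poly \<Rightarrow> 'k poly" where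
  "Bez P S g R x = (\<Sum>l\<le>degree P. smult (coeff P l) (bez S g R l x))"

lemma klinear_Bez:
  assumes "klinear S" "klinear g" "klinear R"
  shows "klinear (Bez P S g R)"
proof -
  have "klinear (bez S g R l)" for l
    by (induction l)
      (use assms klinear_pow[OF assms(3)] in \<open>auto simp: klinear_def smult_add_right add_ac\<close>)
  then show ?thesis
    by (auto simp: klinear_def Bez_def smult_add_right sum.distrib smult_sum_right mult.commute)
qed

text \<open>Multiplying the divided difference by \<open>X - Y\<close> telescopes to
  \<open>P(X) - P(Y)\<close>.\<close>

lemma Bez_commute:
  assumes S: "klinear S" and g: "klinear g"
  shows "S (Bez P S g R x) - Bez P S g R (R x) = papp P S (g x) - g (papp P R x)"
proof -
  have "S (bez S g R l x) - bez S g R l (R x) = (S ^^ l) (g x) - g ((R ^^ l) x)" for l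
  proof (induction l)
    case (Suc l)
    have "S (bez S g R (Suc l) x) - bez S g R (Suc l) (R x)
        = S (S (bez S g R l x) - bez S g R l (R x)) + S (g ((R ^^ l) x)) - g ((R ^^ Suc l) x)"
      by (simp add: klinear_add[OF S] klinear_diff[OF S] funpow_swap1)
    also have "\<dots> = (S ^^ Suc l) (g x) - g ((R ^^ Suc l) x)"
      unfolding Suc.IH by (simp add: klinear_diff[OF S])
    finally show ?case .
  qed (simp add: klinear_0[OF S])
  note * = this
  have "S (Bez P S g R x) - Bez P S g R (R x)
      = (\<Sum>l\<le>degree P. smult (coeff P l) (S (bez S g R l x) - bez S g R l (R x)))"
    by (simp add: Bez_def klinear_sum[OF S] klinear_smult[OF S] smult_diff_right sum_subtractf)
  then show ?thesis
    unfolding * by (simp add: papp_def smult_diff_right sum_subtractf klinear_sum[OF g] klinear_smult[OF g])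
qed

lemma Bez_LO:
  assumes S: "klinear S" "\<And>x. x \<in> LO j \<Longrightarrow> S x \<in> LO j"
    and x: "\<And>l. g ((R ^^ l) x) \<in> LO j"
  shows "Bez P S g R x \<in> LO j"
proof -
  have "bez S g R l x \<in> LO j" for l
    by (induction l) (auto intro!: LO_add S x)
  then show ?thesis
    unfolding Bez_def by (intro LO_sum LO_smult)
qed

text \<open>On the coefficient in position \<open>j\<close> both variables of the divided difference
  act by the same scalar \<mu>, and on the diagonal the divided difference is the
  derivative.\<close>

lemma Bez_coeff:
  assumes S: "klinear S" "\<And>x. x \<in> LO j \<Longrightarrow> S x \<in> LO j"
    "\<And>x. x \<in> LO j \<Longrightarrow> coeff (S x) j = \<mu> * coeff x j"
    and x: "\<And>l. g ((R ^^ l) x) \<in> LO j" "\<And>l. coeff (g ((R ^^ l) x)) j = \<mu> ^ l * c"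
  shows "coeff (Bez P S g R x) j = poly (pderiv P) \<mu> * c"
proof -
  have lo: "bez S g R l x \<in> LO j" for l
    by (induction l) (auto intro!: LO_add S x)
  have co: "coeff (bez S g R l x) j = of_nat l * \<mu> ^ (l - 1) * c" for l
  proof (induction l)
    case (Suc l)
    have "coeff (bez S g R (Suc l) x) j = \<mu> * (of_nat l * \<mu> ^ (l - 1) * c) + \<mu> ^ l * c"
      by (simp only: bez.simps coeff_add S(3)[OF lo] Suc.IH x(2))
    then show ?case
      by (cases l) (simp_all add: algebra_simps)
  qed simp
  have "coeff (Bez P S g R x) j = (\<Sum>l\<le>degree P. coeff P l * (of_nat l * \<mu> ^ (l - 1))) * c"
    by (simp add: Bez_def coeff_sum co sum_distrib_right mult.assoc)
  also have "(\<Sum>l\<le>degree P. coeff P l * (of_nat l * \<mu> ^ (l - 1))) = poly (pderiv P) \<mu>"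
  proof -
    have "P = (\<Sum>l\<le>degree P. monom (coeff P l) l)"
      by (simp add: poly_as_sum_of_monoms)
    then have "pderiv P = (\<Sum>l\<le>degree P. pderiv (monom (coeff P l) l))"
      using higher_pderiv_sum[of 1 "\<lambda>l. monom (coeff P l) l" "{..degree P}"] by simp
    then show ?thesis
      by (simp add: pderiv_monom poly_sum poly_monom mult_ac)
  qed
  finally show ?thesis .
qed

section \<open>The Frobenius on coefficient sequences\<close>

text \<open>Left multiplication by \<tau> in \<open>k{\<tau>}\<close>, where
  \<open>\<tau> a = a\<^sup>q \<tau>\<close>.\<close>

definition ftau :: "nat \<Rightarrow> 'k::field poly \<Rightarrow> 'k poly" where
  "ftau q x = pCons 0 (map_poly (\<lambda>a. a ^ q) x)"

lemma coeff_ftau: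
  assumes "q > 0"
  shows "coeff (ftau q x) i = (case i of 0 \<Rightarrow> 0 | Suc j \<Rightarrow> coeff x j ^ q)"
  using assms by (simp add: ftau_def coeff_pCons coeff_map_poly split: nat.split)

locale frobenius =
  fixes q :: nat and k :: "'k::alg_closed_field itself"
  assumes q: "q > 1" and frob: "(x + y :: 'k) ^ q = x ^ q + y ^ q"
begin

lemma q_pos: "q > 0"
  using q by simp

lemma ftau_add: "ftau q (x + y :: 'k poly) = ftau q x + ftau q y"
  by (rule poly_eqI) (simp add: coeff_ftau[OF q_pos] frob split: nat.split)

lemma ftau_smult: "ftau q (smult c x :: 'k poly) = smult (c ^ q) (ftau q x)"
  by (rule poly_eqI) (simp add: coeff_ftau[OF q_pos] power_mult_distrib split: nat.split)

lemma ftau_LO: "x \<in> LO N \<Longrightarrow> ftau q x \<in> LO (Suc N)"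
  by (auto simp: LO_def coeff_ftau[OF q_pos] q_pos split: nat.split)

lemma ftau_HI: "x \<in> HI N \<Longrightarrow> ftau q x \<in> HI (Suc N)"
  by (auto simp: HI_def coeff_ftau[OF q_pos] q_pos split: nat.split)

lemma frob_inj: "x ^ q = y ^ q \<Longrightarrow> x = y" for x y :: 'k
  using frob[of "x - y" y] q by simp

definition frob_root :: "'k \<Rightarrow> 'k" where
  "frob_root x = (SOME y. y ^ q = x)"

lemma frob_root_power [simp]: "frob_root x ^ q = x"
proof -
  obtain y where "y ^ q = x"
    using alg_closed_root_exists[of q x] q_pos by blast
  then show ?thesis
    unfolding frob_root_def by (rule someI)
qed

lemma frob_root_of_power [simp]: "frob_root (x ^ q) = x"
  by (rule frob_inj) simp

lemma frob_root_0 [simp]: "frob_root 0 = 0"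
  by (rule frob_inj) (simp add: q_pos zero_power)

lemma frob_root_add: "frob_root (x + y) = frob_root x + frob_root y"
  by (rule frob_inj) (simp add: frob)

lemma frob_root_mult: "frob_root (x * y) = frob_root x * frob_root y"
  by (rule frob_inj) (simp add: power_mult_distrib)

text \<open>Division by \<tau> on the left. It is total because the constant coefficient is dropped,
  so it is a right inverse of \<open>ftau\<close> on \<open>LO (Suc 0)\<close> only.\<close>

definition ftau_inv :: "'k poly \<Rightarrow> 'k poly" where
  "ftau_inv y = map_poly frob_root (poly_shift 1 y)"

lemma coeff_ftau_inv: "coeff (ftau_inv y) i = frob_root (coeff y (Suc i))"
  by (simp add: ftau_inv_def coeff_map_poly coeff_poly_shift)

lemma ftau_inv_ftau [simp]: "ftau_inv (ftau q x) = x"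
  by (rule poly_eqI) (simp add: coeff_ftau_inv coeff_ftau[OF q_pos])

lemma ftau_ftau_inv: "y \<in> LO (Suc 0) \<Longrightarrow> ftau q (ftau_inv y) = y"
  by (rule poly_eqI) (auto simp: coeff_ftau_inv coeff_ftau[OF q_pos] LO_def split: nat.split)

lemma ftau_inv_add: "ftau_inv (x + y) = ftau_inv x + ftau_inv y"
  by (rule poly_eqI) (simp add: coeff_ftau_inv frob_root_add)

lemma ftau_inv_smult: "ftau_inv (smult (c ^ q) y) = smult c (ftau_inv y)"
  by (rule poly_eqI) (simp add: coeff_ftau_inv frob_root_mult)

lemma ftau_inv_LO: "x \<in> LO (Suc N) \<Longrightarrow> ftau_inv x \<in> LO N"
  by (auto simp: LO_def coeff_ftau_inv)

lemma ftau_inv_HI: "x \<in> HI (Suc N) \<Longrightarrow> ftau_inv x \<in> HI N"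
  by (auto simp: HI_def coeff_ftau_inv)

end

section \<open>The lattice of order-preserving intertwiners\<close>

text \<open>In the application, \<open>S\<close> is right multiplication by \<open>\<phi>\<^sub>T\<close> on \<open>k{\<tau>}\<close>, \<open>\<theta> = \<gamma>(T)\<close> and \<open>P\<close> is the
  image of \<open>\<pp>\<close> in \<open>k[X]\<close>; supersingularity makes \<open>P(S)\<close> right multiplication by \<open>\<beta>\<tau>\<^sup>n\<close>.\<close>

locale supersingular_operator = frobenius q k
  for q :: nat and k :: "'k::alg_closed_field itself" +
  fixes r :: nat and \<theta> :: 'k and P :: "'k poly" and S :: "'k poly \<Rightarrow> 'k poly" and \<beta> :: 'k
  assumes S_lin: "klinear S"
    and S_ftau: "S (ftau q x) = ftau q (S x)"
    and S_LO: "x \<in> LO i \<Longrightarrow> S x \<in> LO i"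
    and S_coeff: "x \<in> LO i \<Longrightarrow> coeff (S x) i = \<theta> ^ (q ^ i) * coeff x i"
    and S_HI: "x \<in> HI N \<Longrightarrow> S x \<in> HI (N + r)"
    and S_lead: "coeff (S (monom 1 i)) (i + r) \<noteq> 0"
    and \<beta>: "\<beta> \<noteq> 0"
    and PS: "papp P S (monom 1 i) = monom (\<beta> ^ (q ^ i)) (i + r * degree P)"
begin

abbreviation "n \<equiv> r * degree P"

lemma klinear_papp: "klinear (papp P S)"
  using S_lin klinear_pow[OF S_lin]
  by (auto simp: klinear_def papp_def smult_add_right sum.distrib smult_sum_right mult.commute)

lemma papp_eq: "papp P S = lin (\<lambda>i. monom (\<beta> ^ (q ^ i)) (i + n))"
  by (rule ext, rule klinear_eqI[OF klinear_papp klinear_lin]) (simp add: PS lin_monom)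

lemma coeff_papp: "coeff (papp P S x) i = (if i < n then 0 else \<beta> ^ (q ^ (i - n)) * coeff x (i - n))"
proof -
  have "coeff (papp P S x) i
      = (\<Sum>l<Suc (degree x). if l + n = i then coeff x l * \<beta> ^ (q ^ l) else 0)"
    by (simp add: papp_eq lin_eq[OF HI_degree] coeff_sum if_distrib cong: if_cong)
  also have "\<dots> = (if i < n then 0 else \<beta> ^ (q ^ (i - n)) * coeff x (i - n))"
  proof (cases "i < n \<or> degree x < i - n")
    case True
    then show ?thesis
      by (auto intro!: sum.neutral simp: coeff_eq_0)
  next
    case False
    have "(\<Sum>l<Suc (degree x). if l + n = i then coeff x l * \<beta> ^ (q ^ l) else 0)
        = (\<Sum>l\<in>{i - n}. if l + n = i then coeff x l * \<beta> ^ (q ^ l) else 0)"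
      using False by (intro sum.mono_neutral_right) auto
    then show ?thesis
      using False by simp
  qed
  finally show ?thesis .
qed

lemma papp_LO: "x \<in> LO N \<Longrightarrow> papp P S x \<in> LO (N + n)"
  by (auto simp: LO_def coeff_papp)

lemma papp_LO_n: "papp P S x \<in> LO n"
  using papp_LO[of x 0] by simp

text \<open>\<open>P(S)\<close> shifts positions by \<open>n\<close> and multiplies by nonzero
  constants. This is the periodicity of the order filtration.\<close>

lemma papp_surj:
  assumes x: "x \<in> LO (N + n)"
  obtains y where "y \<in> LO N" "papp P S y = x"
proof -
  define y where "y = (\<Sum>i\<le>degree x. monom (coeff x (i + n) / \<beta> ^ (q ^ i)) i)"
  have cy: "coeff y i = coeff x (i + n) / \<beta> ^ (q ^ i)" for i
  proof (cases "i \<le> degree x")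
    case True
    then show ?thesis
      by (simp add: y_def coeff_sum)
  next
    case False
    then show ?thesis
      by (auto simp: y_def coeff_sum coeff_eq_0 intro!: sum.neutral)
  qed
  show ?thesis
  proof
    show "y \<in> LO N"
      using x by (auto simp: LO_def cy)
    show "papp P S y = x"
      using x \<beta> by (intro poly_eqI) (auto simp: coeff_papp cy LO_def)
  qed
qed

text \<open>Since the last coefficient is nonzero, the equation can be solved for
  \<open>f (monom 1 (i + r))\<close>. This expresses that \<open>k{\<tau>}\<close> is free over
  \<open>k[S]\<close> on the first \<open>r\<close> powers of \<tau>.\<close>

lemma S_monom_expand:
  assumes f: "klinear f"
  shows "f (S (monom 1 i)) = (\<Sum>l<i + r. smult (coeff (S (monom 1 i)) l) (f (monom 1 l)))
    + smult (coeff (S (monom 1 i)) (i + r)) (f (monom 1 (i + r)))"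
proof -
  have "S (monom 1 i) \<in> HI (Suc i + r)"
    by (intro S_HI HI_monom) simp
  then show ?thesis
    using klinear_expand[OF f, of "S (monom 1 i)" "Suc i + r"] by simp
qed

end

section \<open>Bounded intertwiners and their dimension\<close>

definition fscale :: "'k::field \<Rightarrow> ('b \<Rightarrow> 'k poly) \<Rightarrow> 'b \<Rightarrow> 'k poly" where
  "fscale c f = (\<lambda>x. smult c (f x))"

global_interpretation fs: vector_space fscale
  by unfold_locales (auto simp: fscale_def fun_eq_iff smult_add_right smult_add_left)

locale supersingular_pair =
  A: supersingular_operator q k r \<theta> P S \<beta> + B: supersingular_operator q k r \<theta> P S' \<alpha>
  for q :: nat and k :: "'k::alg_closed_field itself" and r \<theta> P S \<beta> S' \<alpha> +
  assumes r_pos: "r > 0" and P_pos: "degree P > 0"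
    and P_root: "poly P (\<theta> ^ (q ^ i)) = 0"
    and P_simple: "poly (pderiv P) (\<theta> ^ (q ^ i)) \<noteq> 0"
    and period: "\<theta> ^ (q ^ i) = \<theta> ^ (q ^ j) \<longleftrightarrow> i mod degree P = j mod degree P"
begin

abbreviation "n \<equiv> r * degree P"
abbreviation "d \<equiv> degree P"

definition intertwiner :: "('k poly \<Rightarrow> 'k poly) \<Rightarrow> bool" where
  "intertwiner f \<longleftrightarrow> klinear f \<and> (\<forall>x. f (S x) = S' (f x))"

definition bounded :: "nat \<Rightarrow> ('k poly \<Rightarrow> 'k poly) \<Rightarrow> bool" where
  "bounded s f \<longleftrightarrow> (\<forall>N x. x \<in> HI N \<longrightarrow> f x \<in> HI (N + s))"

definition order_preserving :: "('k poly \<Rightarrow> 'k poly) \<Rightarrow> bool" where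
  "order_preserving f \<longleftrightarrow> (\<forall>N x. x \<in> LO N \<longrightarrow> f x \<in> LO N)"

definition H :: "nat \<Rightarrow> ('k poly \<Rightarrow> 'k poly) set" where
  "H s = {f. intertwiner f \<and> bounded s f}"

definition X :: "nat \<Rightarrow> ('k poly \<Rightarrow> 'k poly) set" where
  "X s = {f \<in> H s. order_preserving f}"

lemma subspace_H: "fs.subspace (H s)"
  unfolding fs.subspace_def H_def intertwiner_def bounded_def klinear_def fscale_def
  using klinear_add[OF B.S_lin] klinear_smult[OF B.S_lin] klinear_0[OF B.S_lin]
  by (auto simp: smult_add_right mult.commute intro: HI_add HI_smult)

lemma subspace_X: "fs.subspace (X s)"
  using subspace_H[of s] unfolding fs.subspace_def X_def order_preserving_def fscale_def
  by (auto intro: LO_add LO_smult)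

text \<open>Extends values \<open>y\<close> prescribed at the first \<open>r\<close> powers of
  \<tau> to all powers, by solving \<open>S_monom_expand\<close> for its top term.\<close>

function extK :: "(nat \<Rightarrow> 'k poly) \<Rightarrow> nat \<Rightarrow> 'k poly" where
  "extK y i = (if i < r then y i
     else smult (inverse (coeff (S (monom 1 (i - r))) i))
       (S' (extK y (i - r)) - (\<Sum>l<i. smult (coeff (S (monom 1 (i - r))) l) (extK y l))))"
  by auto
termination
  by (relation "Wellfounded.measure snd") (use r_pos in auto)

declare extK.simps [simp del]

lemma extK_low: "i < r \<Longrightarrow> extK y i = y i"
  by (simp add: extK.simps)

lemma extK_intertwiner: "intertwiner (lin (extK y))"
  unfolding intertwiner_def
proof (intro conjI allI klinear_lin)
  fix x
  show "lin (extK y) (S x) = S' (lin (extK y) x)"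
  proof (rule klinear_eqI[where f = "\<lambda>x. lin (extK y) (S x)" and g = "\<lambda>x. S' (lin (extK y) x)"])
    fix i
    let ?c = "coeff (S (monom 1 i))"
    have "smult (?c (i + r)) (extK y (i + r)) = S' (extK y i) - (\<Sum>l<i + r. smult (?c l) (extK y l))"
      using A.S_lead[of i] by (subst extK.simps) simp
    then show "lin (extK y) (S (monom 1 i)) = S' (lin (extK y) (monom 1 i))"
      unfolding A.S_monom_expand[OF klinear_lin] by (simp add: lin_monom)
  qed (rule klinear_comp[OF klinear_lin A.S_lin], rule klinear_comp[OF B.S_lin klinear_lin])
qed

text \<open>The recursion passes from \<open>i - r\<close> to \<open>i\<close> by one application of
  \<open>S'\<close>, which raises the degree by at most \<open>r\<close>; hence the bound
  \<open>i + s\<close> propagates.\<close>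

lemma extK_bounded:
  assumes "\<And>j. j < r \<Longrightarrow> y j \<in> HI (Suc (j + s))"
  shows "bounded s (lin (extK y))"
proof -
  have K: "extK y i \<in> HI (Suc (i + s))" for i
  proof (induction i rule: less_induct)
    case (less i)
    show ?case
    proof (cases "i < r")
      case True
      then show ?thesis
        using assms by (simp add: extK_low)
    next
      case False
      have "extK y (i - r) \<in> HI (Suc (i - r + s))"
        using False r_pos by (intro less) auto
      then have "S' (extK y (i - r)) \<in> HI (Suc (i - r + s) + r)"
        by (rule B.S_HI)
      moreover have "Suc (i - r + s) + r = Suc (i + s)"
        using False by simp
      ultimately have "S' (extK y (i - r)) \<in> HI (Suc (i + s))"
        by (simp only:)
      moreover have "extK y l \<in> HI (Suc (i + s))" if "l < i" for l
        using less[OF that] that by (elim HI_mono) auto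
      ultimately have "smult (inverse (coeff (S (monom 1 (i - r))) i))
       (S' (extK y (i - r)) - (\<Sum>l<i. smult (coeff (S (monom 1 (i - r))) l) (extK y l))) \<in> HI (Suc (i + s))"
        by (intro HI_smult HI_diff HI_sum) auto
      then show ?thesis
        using False by (subst extK.simps) simp
    qed
  qed
  show ?thesis
    unfolding bounded_def
  proof (intro allI impI)
    fix N x assume x: "x \<in> (HI N :: 'k poly set)"
    have "extK y l \<in> HI (N + s)" if "l < N" for l
      using K[of l] that by (elim HI_mono) auto
    then show "lin (extK y) x \<in> HI (N + s)"
      unfolding lin_eq[OF x] by (intro HI_sum HI_smult) auto
  qed
qed

lemma intertwiner_eq_0:
  assumes f: "intertwiner f" and "\<And>j. j < r \<Longrightarrow> f (monom 1 j) = 0"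
  shows "f = 0"
proof -
  have lin: "klinear f"
    using f by (simp add: intertwiner_def)
  have "f (monom 1 i) = 0" for i
  proof (induction i rule: less_induct)
    case (less i)
    show ?case
    proof (cases "i < r")
      case False
      then have "f (S (monom 1 (i - r))) = 0"
        using f less[of "i - r"] r_pos klinear_0[OF B.S_lin] by (auto simp: intertwiner_def)
      then have "smult (coeff (S (monom 1 (i - r))) (i - r + r)) (f (monom 1 (i - r + r))) = 0"
        unfolding A.S_monom_expand[OF lin] using less False by simp
      then show ?thesis
        using A.S_lead[of "i - r"] False by simp
    qed (rule assms(2))
  qed
  then have "f x = 0" for x
    using klinear_expand[OF lin HI_degree[of x]] by simp
  then show ?thesis
    by (simp add: fun_eq_iff)
qed

text \<open>A bounded intertwiner amounts to a free choice of its values at \<open>monom 1 j\<close>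
  for \<open>j < r\<close>, the \<open>j\<close>-th one of degree at most
  \<open>s + j\<close>.\<close>

lemma has_dim_H: "fs.has_dim (H s) (\<Sum>j<r. Suc (s + j))"
proof -
  define I where "I = Sigma {..<r} (\<lambda>j. {..s + j})"
  define l where "l = (\<lambda>(j, l) (f :: 'k poly \<Rightarrow> 'k poly). coeff (f (monom 1 j)) l)"
  define e where "e = (\<lambda>(j :: nat, l). lin (extK (\<lambda>j'. if j' = j then monom 1 l else 0)))"
  have e_mon: "e (j, l) (monom 1 j') = (if j' = j then monom 1 l else 0)" if "j' < r" for j j' l
    using that by (simp add: e_def lin_monom extK_low)
  \<comment> \<open>The maps \<open>e p\<close> are dual to the coefficient functionals
    \<open>l p\<close>, so a constant key suffices.\<close>
  have "fs.has_dim {f \<in> H s. \<forall>p\<in>I. l p f = 0} 0 \<longleftrightarrow> fs.has_dim (H s) (0 + card I)"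
  proof (rule fs.has_dim_kernels[where f = e and key = "\<lambda>_. 0"])
    show "finite I"
      by (simp add: I_def)
    fix p assume p: "p \<in> I"
    show "e p \<in> H s \<and> l p (e p) \<noteq> 0"
    proof
      obtain j m where p': "p = (j, m)" "j < r" "m \<le> s + j"
        using p by (auto simp: I_def)
      have "bounded s (e p)"
        unfolding e_def p' prod.case using p'(3) by (intro extK_bounded) (auto intro: HI_monom)
      moreover have "intertwiner (e p)"
        by (simp add: e_def p' extK_intertwiner)
      ultimately show "e p \<in> H s"
        by (simp add: H_def)
      show "l p (e p) \<noteq> 0"
        using p'(2) by (simp add: l_def p' e_mon)
    qed
    fix p' assume "p' \<in> I" "p \<noteq> p'"
    then show "l p (e p') = 0"
      using p by (auto simp: I_def l_def e_mon split: if_splits)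
  qed (auto simp: subspace_H l_def fscale_def)
  moreover have "{f \<in> H s. \<forall>p\<in>I. l p f = 0} = {0}"
  proof (intro subset_antisym subsetI)
    fix f assume f: "f \<in> {f \<in> H s. \<forall>p\<in>I. l p f = 0}"
    have "f (monom 1 j) = 0" if j: "j < r" for j
    proof (rule poly_eqI)
      fix m
      have "monom 1 j \<in> (HI (Suc j) :: 'k poly set)"
        by (rule HI_monom) simp
      then have "f (monom 1 j) \<in> HI (Suc j + s)"
        using f unfolding H_def bounded_def by blast
      moreover have "coeff (f (monom 1 j)) m = 0" if "m \<le> s + j"
        using f that j by (auto simp: I_def l_def)
      ultimately show "coeff (f (monom 1 j)) m = coeff 0 m"
        by (cases "m \<le> s + j") (auto simp: HI_def)
    qed
    then show "f \<in> {0}"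
      using intertwiner_eq_0 f by (auto simp: H_def)
  qed (use fs.subspace_0[OF subspace_H] in \<open>auto simp: l_def\<close>)
  moreover have "fs.has_dim ({0} :: ('k poly \<Rightarrow> 'k poly) set) 0"
    by (rule fs.has_dim_zero)
  ultimately have "fs.has_dim (H s) (card I)"
    by simp
  moreover have "card I = (\<Sum>j<r. Suc (s + j))"
    by (simp add: I_def)
  ultimately show ?thesis
    by simp
qed

end

section \<open>Order preservation as a system of independent linear conditions\<close>

context supersingular_pair
begin

lemma n_pos: "n > 0"
  using r_pos P_pos by simp

text \<open>The \<open>v i\<close> diagonalise \<open>S\<close> modulo \<open>LO n\<close>, compatibly with the filtration by \<open>LO i\<close>.\<close>

definition v :: "nat \<Rightarrow> 'k poly" where
  "v i = Bez P S (\<lambda>x. x) (smult (\<theta> ^ (q ^ i))) (monom 1 i)"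

lemma smult_pow: "(smult c ^^ l) x = smult (c ^ l) x" for c :: 'k
  by (induction l) auto

lemma v_LO: "v i \<in> LO i"
  unfolding v_def by (rule Bez_LO[OF A.S_lin A.S_LO]) (auto simp: smult_pow intro: LO_smult LO_monom)

text \<open>The coefficient is the derivative of \<open>P\<close> at a simple root.\<close>

lemma v_coeff: "coeff (v i) i \<noteq> 0"
proof -
  have "coeff (v i) i = poly (pderiv P) (\<theta> ^ (q ^ i)) * 1"
    unfolding v_def
    by (rule Bez_coeff[OF A.S_lin A.S_LO A.S_coeff]) (auto simp: smult_pow intro: LO_smult LO_monom)
  then show ?thesis
    using P_simple by simp
qed

text \<open>By \<open>Bez_commute\<close> the left side is
  \<open>P(S) - P(\<theta> ^ (q ^ i))\<close> applied to \<open>monom 1 i\<close>, and the second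
  term vanishes at a root. What remains lies in \<open>LO n\<close>.\<close>

lemma v_eigen: "S (v i) - smult (\<theta> ^ (q ^ i)) (v i) = papp P S (monom 1 i)"
proof -
  let ?B = "Bez P S (\<lambda>x. x) (smult (\<theta> ^ (q ^ i)))"
  have "klinear ?B"
    by (intro klinear_Bez A.S_lin klinear_ident klinear_scale)
  then have "?B (smult (\<theta> ^ (q ^ i)) (monom 1 i)) = smult (\<theta> ^ (q ^ i)) (v i)"
    by (simp add: klinear_smult v_def del: smult_monom)
  then show ?thesis
    using Bez_commute[OF A.S_lin klinear_ident, of P "smult (\<theta> ^ (q ^ i))" "monom 1 i"]
    by (simp add: v_def papp_smult P_root del: smult_monom)
qed

lemma S_pow_LO: "x \<in> LO N \<Longrightarrow> (S ^^ l) x \<in> LO N"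
  by (induction l) (auto intro: A.S_LO)

lemma S_pow_HI: "x \<in> HI N \<Longrightarrow> (S ^^ l) x \<in> HI (N + r * l)"
proof (induction l)
  case (Suc l)
  then have "(S ^^ Suc l) x \<in> HI (N + r * l + r)"
    by (auto intro: A.S_HI)
  then show ?case
    by (simp add: algebra_simps)
qed simp

lemma v_eigen_pow: "(S ^^ l) (v i) - smult ((\<theta> ^ (q ^ i)) ^ l) (v i) \<in> LO n"
proof (induction l)
  case (Suc l)
  let ?t = "\<theta> ^ (q ^ i)"
  have "(S ^^ Suc l) (v i) - smult (?t ^ Suc l) (v i)
      = S ((S ^^ l) (v i) - smult (?t ^ l) (v i)) + smult (?t ^ l) (S (v i) - smult ?t (v i))"
    by (simp add: klinear_diff[OF A.S_lin] klinear_smult[OF A.S_lin] smult_diff_right mult.commute)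
  also have "\<dots> \<in> LO n"
    unfolding v_eigen by (intro LO_add LO_smult A.papp_LO_n A.S_LO Suc)
  finally show ?case .
qed simp

lemma intertwiner_papp: "intertwiner f \<Longrightarrow> f (papp P S x) = papp P S' (f x)"
  unfolding intertwiner_def by (rule papp_commute) auto

text \<open>Modulo \<open>LO n\<close> the vector \<open>f (v i)\<close> is an eigenvector of
  \<open>S'\<close> for \<open>\<theta> ^ (q ^ i)\<close>, while \<open>S'\<close> acts on the
  lowest term, in position \<open>m\<close>, by \<open>\<theta> ^ (q ^ m)\<close>. Below
  \<open>n\<close> this term can therefore only sit in a position congruent to \<open>i\<close>
  modulo \<open>d\<close>, and such positions below \<open>i\<close> are excluded by
  assumption.\<close>

lemma intertwiner_v:
  assumes f: "intertwiner f" and i: "i < n"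
    and 0: "\<And>j. j < i \<Longrightarrow> j mod d = i mod d \<Longrightarrow> coeff (f (v i)) j = 0"
  shows "f (v i) \<in> LO i"
proof -
  have lin: "klinear f"
    using f by (simp add: intertwiner_def)
  have "S' (f (v i)) - smult (\<theta> ^ (q ^ i)) (f (v i)) = f (S (v i) - smult (\<theta> ^ (q ^ i)) (v i))"
    using f by (simp add: klinear_diff[OF lin] klinear_smult[OF lin] intertwiner_def)
  also have "\<dots> = papp P S' (f (monom 1 i))"
    unfolding v_eigen by (rule intertwiner_papp[OF f])
  also have "\<dots> \<in> LO n"
    by (rule B.papp_LO_n)
  finally have eig: "S' (f (v i)) - smult (\<theta> ^ (q ^ i)) (f (v i)) \<in> LO n" .
  have "m \<le> i \<Longrightarrow> f (v i) \<in> LO m" for m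
  proof (induction m)
    case (Suc m)
    then have IH: "f (v i) \<in> LO m" and m: "m < i"
      by auto
    have "coeff (S' (f (v i)) - smult (\<theta> ^ (q ^ i)) (f (v i))) m = 0"
      using eig m i by (auto simp: LO_def)
    then have "(\<theta> ^ (q ^ m) - \<theta> ^ (q ^ i)) * coeff (f (v i)) m = 0"
      using B.S_coeff[OF IH] by (simp add: algebra_simps)
    then have "coeff (f (v i)) m = 0"
      using period[of m i] 0[OF m] by auto
    then show ?case
      using IH by (simp add: LO_Suc)
  qed simp
  then show ?thesis
    by simp
qed

lemma order_preserving_iff:
  assumes f: "intertwiner f"
  shows "order_preserving f \<longleftrightarrow> (\<forall>i<n. \<forall>j<i. j mod d = i mod d \<longrightarrow> coeff (f (v i)) j = 0)"
    (is "?L \<longleftrightarrow> ?R")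
proof
  assume ?L
  then have "f (v i) \<in> LO i" for i
    using v_LO by (auto simp: order_preserving_def)
  then show ?R
    by (auto simp: LO_def)
next
  assume R: ?R
  have lin: "klinear f"
    using f by (simp add: intertwiner_def)
  \<comment> \<open>Downward induction from \<open>n\<close>. \<open>LO n\<close> is the image of
    \<open>P(S)\<close>, which \<open>f\<close> carries into the image of \<open>P(S')\<close>; each
    step down adjoins only the vector \<open>v N\<close>.\<close>
  have le: "\<forall>x\<in>LO N. f x \<in> LO N" if "N \<le> n" for N
    using that
  proof (induction N rule: inc_induct)
    case base
    show ?case
    proof
      fix x :: "'k poly" assume "x \<in> LO n"
      then obtain y where "papp P S y = x"
        using A.papp_surj[of x 0] by auto
      then show "f x \<in> LO n"
        using intertwiner_papp[OF f, of y] B.papp_LO_n by simp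
    qed
  next
    case (step N)
    show ?case
    proof
      fix x :: "'k poly" assume x: "x \<in> LO N"
      define c where "c = coeff x N / coeff (v N) N"
      have "x - smult c (v N) \<in> LO (Suc N)"
        unfolding LO_Suc using v_coeff x v_LO by (auto simp: c_def intro!: LO_diff LO_smult)
      then have "f (x - smult c (v N)) \<in> LO (Suc N)"
        using step.IH by blast
      then have "f (x - smult c (v N)) \<in> LO N"
        by (rule LO_mono) simp
      moreover have "smult c (f (v N)) \<in> LO N"
        using step.hyps R by (intro LO_smult intertwiner_v[OF f]) auto
      ultimately have "f (x - smult c (v N)) + smult c (f (v N)) \<in> LO N"
        by (rule LO_add)
      then show "f x \<in> LO N"
        by (simp add: klinear_diff[OF lin] klinear_smult[OF lin])
    qed
  qed
  \<comment> \<open>Above \<open>n\<close>, a preimage under \<open>P(S)\<close> lowers the order by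
    \<open>n\<close>.\<close>
  have "\<forall>x\<in>LO N. f x \<in> LO N" for N
  proof (induction N rule: less_induct)
    case (less N)
    show ?case
    proof (cases "N \<le> n")
      case False
      show ?thesis
      proof
        fix x :: "'k poly" assume "x \<in> LO N"
        then have "x \<in> LO (N - n + n)"
          using False by simp
        then obtain y where y: "y \<in> LO (N - n)" "papp P S y = x"
          by (rule A.papp_surj)
        have "f y \<in> LO (N - n)"
          using less[of "N - n"] y(1) n_pos False by auto
        then have "papp P S' (f y) \<in> LO (N - n + n)"
          by (rule B.papp_LO)
        then show "f x \<in> LO N"
          using intertwiner_papp[OF f, of y] y(2) False by simp
      qed
    qed (rule le)
  qed
  then show ?L
    by (simp add: order_preserving_def)
qed

text \<open>\<open>g i j\<close> sends \<open>\<tau>\<^sup>i\<close> to \<open>\<tau>\<^sup>j\<close>, kills the other \<open>\<tau>\<^sup>m\<close> with \<open>m < n\<close>, and is extended so as to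
  commute with the action of \<open>P\<close>.\<close>

definition g :: "nat \<Rightarrow> nat \<Rightarrow> 'k poly \<Rightarrow> 'k poly" where
  "g i j = lin (\<lambda>m. if m mod n = i
     then monom (\<Prod>a<m div n. \<alpha> ^ (q ^ (j + n * a)) / \<beta> ^ (q ^ (i + n * a))) (m - i + j) else 0)"

lemma klinear_g: "klinear (g i j)"
  unfolding g_def by (rule klinear_lin)

lemma g_papp:
  assumes i: "i < n"
  shows "g i j (papp P S x) = papp P S' (g i j x)"
proof (rule klinear_eqI[where f = "\<lambda>x. g i j (papp P S x)" and g = "\<lambda>x. papp P S' (g i j x)"])
  fix m
  show "g i j (papp P S (monom 1 m)) = papp P S' (g i j (monom 1 m))"
  proof (cases "m mod n = i")
    case True
    \<comment> \<open>For \<open>m = i + n a\<close>, the \<open>a\<close>-th iterate of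
      \<open>P(S)\<close> maps \<open>monom 1 i\<close> to a product of powers of \<beta> times
      \<open>monom 1 m\<close>; the same holds for \<open>P(S')\<close> at \<open>j\<close> with
      \<alpha>. \<open>?h m\<close> is the quotient of the two products.\<close>
    let ?h = "\<lambda>m. \<Prod>a<m div n. \<alpha> ^ (q ^ (j + n * a)) / \<beta> ^ (q ^ (i + n * a))"
    have m: "i + n * (m div n) = m"
      using True mod_mult_div_eq[of m n] by simp
    then have m': "m - i = n * (m div n)"
      by simp
    have h: "?h (m + n) = ?h m * (\<alpha> ^ (q ^ (j + n * (m div n))) / \<beta> ^ (q ^ (i + n * (m div n))))"
      using n_pos by simp
    have "g i j (papp P S (monom 1 m)) = smult (\<beta> ^ (q ^ m)) (monom (?h (m + n)) (m + n - i + j))"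
      using True by (simp add: A.PS g_def lin_monom)
    also have "\<beta> ^ (q ^ m) * ?h (m + n) = ?h m * \<alpha> ^ (q ^ (j + (m - i)))"
      unfolding h m m' using A.\<beta> by simp
    then have "smult (\<beta> ^ (q ^ m)) (monom (?h (m + n)) (m + n - i + j))
        = smult (?h m) (monom (\<alpha> ^ (q ^ (m - i + j))) (m - i + j + n))"
      using m by (simp add: smult_monom ac_simps)
    also have "\<dots> = papp P S' (smult (?h m) (monom 1 (m - i + j)))"
      unfolding B.PS[symmetric] klinear_smult[OF B.klinear_papp] ..
    also have "\<dots> = papp P S' (g i j (monom 1 m))"
      using True by (simp add: g_def lin_monom smult_monom)
    finally show ?thesis .
  next
    case False
    then show ?thesis
      by (simp add: A.PS g_def lin_monom klinear_0[OF B.klinear_papp])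
  qed
qed (rule klinear_comp[OF klinear_g A.klinear_papp], rule klinear_comp[OF B.klinear_papp klinear_g])

lemma g_HI:
  assumes "j \<le> i" and x: "x \<in> HI N"
  shows "g i j x \<in> HI N"
proof -
  have "i \<le> m" if "m mod n = i" for m
    using that mod_less_eq_dividend by blast
  then show ?thesis
    unfolding g_def lin_eq[OF x] using assms(1)
    by (intro HI_sum HI_smult) (auto intro!: HI_monom)
qed

lemma coeff_g:
  assumes i: "i < n" and l: "l < n"
  shows "coeff (g i j x) l = (if l = j then coeff x i else 0)"
proof -
  have m: "m = i" if "m mod n = i" "m - i + j = l" for m
  proof -
    have "i + n * (m div n) = m"
      using that(1) mod_mult_div_eq[of m n] by simp
    moreover have "m - i < n"
      using that(2) l by simp
    ultimately show ?thesis
      by (cases "m div n") auto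
  qed
  let ?N = "max (Suc (degree x)) (Suc i)"
  have x: "x \<in> HI ?N"
    using HI_degree[of x] by (rule HI_mono) simp
  have "coeff (g i j x) l = (\<Sum>m<?N. if m = i then (if l = j then coeff x i else 0) else 0)"
    unfolding g_def lin_eq[OF x] coeff_sum
  proof (rule sum.cong[OF refl])
    fix m
    show "coeff (smult (coeff x m) (if m mod n = i then monom (\<Prod>a<m div n. \<alpha> ^ q ^ (j + n * a) /
        \<beta> ^ q ^ (i + n * a)) (m - i + j) else 0)) l = (if m = i then (if l = j then coeff x i else 0) else 0)"
      using m[of m] i by auto
  qed
  then show ?thesis
    by simp
qed

text \<open>\<open>X s\<close> is cut out in \<open>H s\<close> by the functionals \<open>f \<mapsto> coeff (f (v i)) j\<close> with \<open>j < i < n\<close> and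
  \<open>j \<equiv> i (mod d)\<close>, on which the \<open>F i j\<close> form a triangular system.\<close>

definition F :: "nat \<Rightarrow> nat \<Rightarrow> 'k poly \<Rightarrow> 'k poly" where
  "F i j = Bez P S' (g i j) S"

text \<open>The divided difference of \<open>P\<close> involves at most \<open>d - 1\<close>
  applications of \<open>S\<close> and \<open>S'\<close> together, each raising the degree by at
  most \<open>r\<close>, and \<open>g i j\<close> does not raise it since \<open>j < i\<close>.
  Hence the bound \<open>r * (d - 1)\<close>.\<close>

lemma F_H:
  assumes "j < i" "i < n" and s: "r * (d - 1) \<le> s"
  shows "F i j \<in> H s"
proof -
  have lin: "klinear (F i j)"
    unfolding F_def by (intro klinear_Bez B.S_lin A.S_lin klinear_g)
  have "S' (F i j x) - F i j (S x) = 0" for x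
    unfolding F_def Bez_commute[OF B.S_lin klinear_g] using g_papp[OF assms(2)] by simp
  then have "intertwiner (F i j)"
    using lin by (simp add: intertwiner_def)
  moreover have "bounded s (F i j)"
    unfolding bounded_def
  proof (intro allI impI)
    fix N x assume x: "x \<in> (HI N :: 'k poly set)"
    have b: "bez S' (g i j) S l x \<in> HI (N + r * (l - 1))" for l
    proof (induction l)
      case (Suc l)
      have "S' (bez S' (g i j) S l x) \<in> HI (N + r * l)"
      proof (cases l)
        case (Suc l')
        have "S' (bez S' (g i j) S l x) \<in> HI (N + r * (l - 1) + r)"
          by (rule B.S_HI[OF Suc.IH])
        then show ?thesis
          using Suc by (simp add: algebra_simps)
      qed (simp add: klinear_0[OF B.S_lin])
      moreover have "g i j ((S ^^ l) x) \<in> HI (N + r * l)"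
        using assms(1) by (intro g_HI S_pow_HI x) simp
      ultimately show ?case
        by (simp add: HI_add)
    qed simp
    have "r * (l - 1) \<le> s" if "l \<le> d" for l
    proof -
      have "l - 1 \<le> d - 1"
        using that by simp
      then show ?thesis
        by (rule order_trans[OF mult_le_mono2 s])
    qed
    then show "F i j x \<in> HI (N + s)"
      unfolding F_def Bez_def by (intro HI_sum HI_smult HI_mono[OF b]) auto
  qed
  ultimately show ?thesis
    by (simp add: H_def)
qed

text \<open>If \<open>i' < i\<close>, all \<open>S\<close>-iterates of \<open>v i\<close> have
  coefficient 0 at \<open>i'\<close>, the only one that \<open>g i' j'\<close> sees below
  \<open>n\<close>. If \<open>j < j'\<close>, the values of \<open>g i' j'\<close> begin only after
  position \<open>j\<close>.\<close>

lemma F_coeff_eq_0: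
  assumes "i < n" "j < n" "i' < n" and "i' < i \<or> j < j'"
  shows "coeff (F i' j' (v i)) j = 0"
proof -
  have "\<exists>N>j. \<forall>l. g i' j' ((S ^^ l) (v i)) \<in> LO N"
  proof (cases "i' < i")
    case True
    then have "coeff ((S ^^ l) (v i)) i' = 0" for l
      using S_pow_LO[OF v_LO, of l i] by (simp add: LO_def)
    then have "g i' j' ((S ^^ l) (v i)) \<in> LO n" for l
      using assms(3) by (auto simp: LO_def coeff_g)
    then show ?thesis
      using assms(2) by blast
  next
    case False
    then have "g i' j' ((S ^^ l) (v i)) \<in> LO (min n j')" for l
      using assms(3) by (auto simp: LO_def coeff_g)
    then show ?thesis
      using False assms(2,4) by (intro exI[of _ "min n j'"]) auto
  qed
  then obtain N where N: "j < N" "\<And>l. g i' j' ((S ^^ l) (v i)) \<in> LO N"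
    by blast
  have "F i' j' (v i) \<in> LO N"
    unfolding F_def by (rule Bez_LO[OF B.S_lin B.S_LO]) (use N(2) in auto)
  then show ?thesis
    using N(1) by (simp add: LO_def)
qed

text \<open>Each application of \<open>S\<close> multiplies the \<open>i\<close>-th coefficient of
  \<open>v i\<close> by \<open>\<theta> ^ (q ^ i)\<close>. As \<open>j\<close> is congruent to
  \<open>i\<close> modulo \<open>d\<close>, \<open>S'\<close> acts in position \<open>j\<close> by
  the same scalar, so \<open>Bez_coeff\<close> produces the derivative of \<open>P\<close> at a
  simple root.\<close>

lemma F_coeff_neq_0:
  assumes "i < n" "j < n" "j mod d = i mod d"
  shows "coeff (F i j (v i)) j \<noteq> 0"
proof -
  have t: "\<theta> ^ (q ^ j) = \<theta> ^ (q ^ i)"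
    using assms(3) period by blast
  have "coeff ((S ^^ l) (v i)) i = (\<theta> ^ (q ^ i)) ^ l * coeff (v i) i" for l
    using v_eigen_pow[of l i] assms(1) by (auto simp: LO_def)
  then have c: "coeff (g i j ((S ^^ l) (v i))) j = (\<theta> ^ (q ^ j)) ^ l * coeff (v i) i" for l
    using assms by (simp add: coeff_g t)
  have "g i j ((S ^^ l) (v i)) \<in> LO j" for l
    using assms by (auto simp: LO_def coeff_g)
  then have "coeff (F i j (v i)) j = poly (pderiv P) (\<theta> ^ (q ^ j)) * coeff (v i) i"
    unfolding F_def by (intro Bez_coeff[OF B.S_lin B.S_LO B.S_coeff]) (use c in auto)
  then show ?thesis
    using P_simple v_coeff by simp
qed

text \<open>The numbers below \<open>n\<close> fall into \<open>d\<close> residue classes of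
  \<open>r\<close> elements, and the pairs lie within one class.\<close>

lemma card_index:
  "card (Sigma {..<n} (\<lambda>i. {j. j < i \<and> j mod d = i mod d})) = d * (r * (r - 1) div 2)"
proof -
  have "card {j. j < i \<and> j mod d = i mod d} = i div d" for i
  proof -
    have "bij_betw (\<lambda>a. i mod d + d * a) {..<i div d} {j. j < i \<and> j mod d = i mod d}"
      unfolding bij_betw_def
    proof (intro conjI subset_antisym subsetI)
      show "inj_on (\<lambda>a. i mod d + d * a) {..<i div d}"
        using P_pos by (auto simp: inj_on_def)
      show "x \<in> {j. j < i \<and> j mod d = i mod d}" if x: "x \<in> (\<lambda>a. i mod d + d * a) ` {..<i div d}" for x
      proof -
        obtain a where a: "x = i mod d + d * a" "a < i div d"
          using x by auto
        have "d * a < d * (i div d)"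
          using a(2) P_pos by simp
        then have "x < i"
          using a(1) mod_mult_div_eq[of i d] by linarith
        then show ?thesis
          using a(1) by simp
      qed
      show "x \<in> (\<lambda>a. i mod d + d * a) ` {..<i div d}" if "x \<in> {j. j < i \<and> j mod d = i mod d}" for x
      proof (rule image_eqI)
        show x: "x = i mod d + d * (x div d)"
          using that mod_mult_div_eq[of x d] by simp
        have "d * (x div d) < d * (i div d)"
          using that x mod_mult_div_eq[of i d] unfolding mem_Collect_eq by linarith
        then show "x div d \<in> {..<i div d}"
          by simp
      qed
    qed
    then show ?thesis
      using bij_betw_same_card by fastforce
  qed
  then have "card (Sigma {..<n} (\<lambda>i. {j. j < i \<and> j mod d = i mod d})) = (\<Sum>i<r * d. i div d)"
    by simp
  also have "\<dots> = (\<Sum>a<r. \<Sum>i\<in>{a * d..<a * d + d}. i div d)"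
    by (simp add: sum.nat_group)
  also have "\<dots> = (\<Sum>a<r. d * a)"
  proof (rule sum.cong[OF refl])
    fix a
    have "(\<Sum>i\<in>{a * d..<a * d + d}. i div d) = (\<Sum>i\<in>{a * d..<a * d + d}. a)"
      using P_pos by (intro sum.cong refl) (auto intro: div_nat_eqI simp: mult.commute)
    then show "(\<Sum>i\<in>{a * d..<a * d + d}. i div d) = d * a"
      by simp
  qed
  also have "\<dots> = d * (r * (r - 1) div 2)"
    by (simp add: sum_distrib_left[symmetric] atLeast0LessThan[symmetric] Sum_Ico_nat)
  finally show ?thesis .
qed

theorem has_dim_X:
  assumes s: "r * (d - 1) \<le> s"
  obtains e where "fs.has_dim (X s) e" "e + d * (r * (r - 1) div 2) = (\<Sum>j<r. Suc (s + j))"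
proof -
  define I where "I = Sigma {..<n} (\<lambda>i. {j. j < i \<and> j mod d = i mod d})"
  define l where "l = (\<lambda>(i, j) (f :: 'k poly \<Rightarrow> 'k poly). coeff (f (v i)) j)"
  \<comment> \<open>Lexicographic: by \<open>i\<close> increasing, then by \<open>j\<close>
    decreasing. This is the order in which \<open>F_coeff_eq_0\<close> makes the system
    triangular.\<close>
  define key where "key = (\<lambda>(i :: nat, j). i * n + (n - 1 - j))"
  have fin: "finite I"
    unfolding I_def by (intro finite_SigmaI) auto
  have I: "\<exists>i j. p = (i, j) \<and> j < i \<and> i < n \<and> j mod d = i mod d" if "p \<in> I" for p
    using that by (auto simp: I_def)
  have K: "{f \<in> H s. \<forall>p\<in>I. l p f = 0} = X s"
    unfolding X_def by (auto simp: I_def l_def H_def order_preserving_iff)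
  have D: "fs.has_dim {f \<in> H s. \<forall>p\<in>I. l p f = 0} e \<longleftrightarrow> fs.has_dim (H s) (e + card I)" for e
  proof (rule fs.has_dim_kernels[where f = "\<lambda>(i, j). F i j" and key = key, OF fin])
    fix p assume "p \<in> I"
    then obtain i j where p: "p = (i, j)" "j < i" "i < n" "j mod d = i mod d"
      using I by blast
    show "(case p of (i, j) \<Rightarrow> F i j) \<in> H s \<and> l p (case p of (i, j) \<Rightarrow> F i j) \<noteq> 0"
      using p s F_coeff_neq_0[of i j] by (auto simp: l_def intro: F_H)
    fix p' assume "p' \<in> I" "p \<noteq> p'" and key: "key p' \<le> key p"
    then obtain i' j' where p': "p' = (i', j')" "j' < i'" "i' < n" "(i, j) \<noteq> (i', j')"
      using I p(1) by blast
    have "i' < i \<or> j < j'"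
    proof (rule ccontr)
      assume *: "\<not> ?thesis"
      then have "i \<le> i'" "j' \<le> j"
        by auto
      have le: "i' * n + (n - 1 - j') \<le> i * n + (n - 1 - j)"
        using key by (simp add: key_def p p')
      show False
      proof (cases "i = i'")
        case True
        then show ?thesis
          using le \<open>j' \<le> j\<close> p' p by auto
      next
        case False
        then have "Suc i * n \<le> i' * n"
          using \<open>i \<le> i'\<close> by (intro mult_le_mono1) simp
        moreover have "n - 1 - j < n"
          using n_pos by simp
        ultimately show ?thesis
          using le by simp
      qed
    qed
    then show "l p (case p' of (i, j) \<Rightarrow> F i j) = 0"
      using p p' by (simp add: l_def F_coeff_eq_0)
  qed (auto simp: subspace_H l_def fscale_def)
  obtain e where e: "fs.has_dim (X s) e"
    by (rule fs.has_dim_subspace[OF has_dim_H[of s] subspace_X]) (auto simp: X_def)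
  then have "fs.has_dim (H s) (e + card I)"
    using D K by simp
  then have "e + card I = (\<Sum>j<r. Suc (s + j))"
    by (rule fs.has_dim_unique[OF _ has_dim_H])
  then show ?thesis
    using that[OF e] card_index by (simp add: I_def)
qed

end

section \<open>Maps commuting with the Frobenius, counted by Lang's theorem\<close>

context supersingular_pair
begin

definition G :: "('k poly \<Rightarrow> 'k poly) \<Rightarrow> 'k poly \<Rightarrow> 'k poly" where
  "G f = (\<lambda>x. A.ftau_inv (f (ftau q x)))"

text \<open>Order preservation is what permits division by \<tau> after applying
  \<open>f\<close>.\<close>

lemma X_ftau_LO: "f \<in> X s \<Longrightarrow> f (ftau q x) \<in> LO (Suc 0)"
  using A.ftau_LO[of x 0] by (auto simp: X_def order_preserving_def)

lemma G_X:
  assumes f: "f \<in> X s"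
  shows "G f \<in> X s"
proof -
  have lin: "klinear f" and fS: "f (S x) = S' (f x)" for x
    using f by (auto simp: X_def H_def intertwiner_def)
  have "klinear (G f)"
    by (simp add: klinear_def G_def A.ftau_add A.ftau_smult klinear_add[OF lin] klinear_smult[OF lin]
        A.ftau_inv_add A.ftau_inv_smult)
  moreover have "G f (S x) = S' (G f x)" for x
  proof -
    have "f (ftau q (S x)) = S' (ftau q (G f x))"
      using X_ftau_LO[OF f] by (simp add: fS G_def A.ftau_ftau_inv flip: A.S_ftau)
    then have "A.ftau_inv (f (ftau q (S x))) = A.ftau_inv (ftau q (S' (G f x)))"
      by (simp only: B.S_ftau)
    then show ?thesis
      by (simp add: G_def)
  qed
  moreover have "bounded s (G f)"
    unfolding bounded_def
  proof (intro allI impI)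
    fix N x assume "x \<in> (HI N :: 'k poly set)"
    then have "f (ftau q x) \<in> HI (Suc N + s)"
      using f A.ftau_HI unfolding X_def H_def bounded_def by blast
    then show "G f x \<in> HI (N + s)"
      unfolding G_def by (intro A.ftau_inv_HI) simp
  qed
  moreover have "order_preserving (G f)"
    unfolding order_preserving_def
  proof (intro allI impI)
    fix N x assume "x \<in> (LO N :: 'k poly set)"
    then have "f (ftau q x) \<in> LO (Suc N)"
      using f A.ftau_LO unfolding X_def order_preserving_def by blast
    then show "G f x \<in> LO N"
      unfolding G_def by (rule A.ftau_inv_LO)
  qed
  ultimately show ?thesis
    by (simp add: X_def H_def intertwiner_def)
qed

text \<open>If \<open>G f\<close> vanishes, \<open>f\<close> kills all multiples of \<tau>, in
  particular the image of \<open>P(S)\<close>. Since \<open>f\<close> intertwines and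
  \<open>P(S')\<close> is injective, \<open>f\<close> vanishes everywhere.\<close>

lemma G_inj:
  assumes f: "f \<in> X s" and 0: "G f = 0"
  shows "f = 0"
proof -
  have int: "intertwiner f"
    using f by (simp add: X_def H_def)
  have "f x = 0" for x
  proof -
    have z: "f y = 0" if "y \<in> LO (Suc 0)" for y
    proof -
      have "A.ftau_inv (f y) = 0"
        using fun_cong[OF 0, of "A.ftau_inv y"] A.ftau_ftau_inv[OF that] by (simp add: G_def)
      moreover have "f y \<in> LO (Suc 0)"
        using f that by (auto simp: X_def order_preserving_def)
      ultimately show ?thesis
        using A.ftau_ftau_inv[of "f y"] by (simp add: ftau_def)
    qed
    have "papp P S x \<in> LO (Suc 0)"
      using A.papp_LO_n[of x] n_pos by (elim LO_mono) simp
    then have "papp P S' (f x) = 0"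
      using z intertwiner_papp[OF int] by metis
    then have "coeff (papp P S' (f x)) (i + n) = 0" for i
      by simp
    then show "f x = 0"
      using B.\<beta> by (intro poly_eqI) (simp add: B.coeff_papp)
  qed
  then show ?thesis
    by (simp add: fun_eq_iff)
qed

theorem card_ftau_fixed:
  assumes "r * (d - 1) \<le> s"
  obtains e where "card {f \<in> X s. \<forall>x. f (ftau q x) = ftau q (f x)} = card {c :: 'k. c ^ q = c} ^ e"
    "e + d * (r * (r - 1) div 2) = (\<Sum>j<r. Suc (s + j))"
proof -
  obtain e where e: "fs.has_dim (X s) e" "e + d * (r * (r - 1) div 2) = (\<Sum>j<r. Suc (s + j))"
    using has_dim_X[OF assms] .
  interpret semilinear_endo fscale "X s" e q G
  proof
    show "G (f + g) = G f + G g" for f g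
      by (auto simp: G_def A.ftau_inv_add)
    show "G (fscale (c ^ q) f) = fscale c (G f)" for c f
      by (auto simp: G_def fscale_def A.ftau_inv_smult)
  qed (use e A.q A.frob G_X G_inj in auto)
  have "{f \<in> X s. \<forall>x. f (ftau q x) = ftau q (f x)} = {f \<in> X s. G f = f}"
  proof (intro Collect_cong conj_cong refl)
    fix f assume f: "f \<in> X s"
    have "f (ftau q x) = ftau q (f x) \<longleftrightarrow> G f x = f x" for x
      using A.ftau_ftau_inv[OF X_ftau_LO[OF f, of x]] A.ftau_inv_ftau[of "f x"] by (auto simp: G_def)
    then show "(\<forall>x. f (ftau q x) = ftau q (f x)) \<longleftrightarrow> G f = f"
      by (auto simp: fun_eq_iff)
  qed
  then show ?thesis
    using card_Fix e(2) that by simp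
qed

end

section \<open>Twisted multiplication\<close>

context frobenius
begin

lemma ftau_0: "ftau q (0 :: 'k poly) = 0"
  by (simp add: ftau_def)

lemma ftau_sum: "ftau q (\<Sum>i\<in>A. f i :: 'k poly) = (\<Sum>i\<in>A. ftau q (f i))"
  by (induction A rule: infinite_finite_induct) (simp_all add: ftau_0 ftau_add)

lemma coeff_ftau_pow: "coeff ((ftau q ^^ i) u) j = (if j < i then 0 else coeff u (j - i) ^ (q ^ i))"
  for u :: "'k poly"
proof (induction i arbitrary: j)
  case (Suc i)
  then show ?case
    by (cases j) (auto simp: coeff_ftau[OF q_pos] zero_power[OF q_pos] mult.commute simp flip: power_mult)
qed simp

lemma ftau_pow_monom: "(ftau q ^^ i) (monom c j) = monom (c ^ (q ^ i)) (i + j)" for c :: 'k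
  using q_pos by (intro poly_eqI) (auto simp: coeff_ftau_pow)

text \<open>The product is \<open>k\<close>-linear in its left factor, so identities between
  products can be checked on powers of \<tau>.\<close>

lemma twisted_mult_eq_lin: "twisted_mult q u w = lin (\<lambda>i. (ftau q ^^ i) w) u" for u w :: "'k poly"
proof -
  have "(ftau q ^^ i) w = (\<Sum>j\<le>degree w. monom (coeff w j ^ (q ^ i)) (i + j))" for i
  proof (rule poly_eqI)
    fix m
    have "coeff (\<Sum>j\<le>degree w. monom (coeff w j ^ (q ^ i)) (i + j)) m
        = (\<Sum>j\<le>degree w. if i + j = m then coeff w j ^ (q ^ i) else 0)"
      by (simp add: coeff_sum)
    also have "\<dots> = (if m < i then 0 else coeff w (m - i) ^ (q ^ i))"
    proof (cases "m < i \<or> degree w < m - i")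
      case True
      then show ?thesis
        using q_pos by (auto intro!: sum.neutral simp: coeff_eq_0 zero_power)
    next
      case False
      have "(\<Sum>j\<le>degree w. if i + j = m then coeff w j ^ (q ^ i) else 0)
          = (\<Sum>j\<in>{m - i}. if i + j = m then coeff w j ^ (q ^ i) else 0)"
        using False by (intro sum.mono_neutral_right) auto
      then show ?thesis
        using False by simp
    qed
    finally show "coeff ((ftau q ^^ i) w) m = coeff (\<Sum>j\<le>degree w. monom (coeff w j ^ (q ^ i)) (i + j)) m"
      by (simp add: coeff_ftau_pow)
  qed
  then show ?thesis
    by (simp add: twisted_mult_def lin_def smult_sum_right smult_monom)
qed

lemma klinear_twisted_mult: "klinear (\<lambda>u. twisted_mult q u w)" for w :: "'k poly"
  unfolding twisted_mult_eq_lin by (rule klinear_lin)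

lemma twisted_mult_monom: "twisted_mult q (monom 1 i) w = (ftau q ^^ i) w" for w :: "'k poly"
  by (simp add: twisted_mult_eq_lin lin_monom)

lemma twisted_mult_1: "twisted_mult q 1 w = w" for w :: "'k poly"
  using twisted_mult_monom[of 0 w] by simp

lemma twisted_mult_0_right: "twisted_mult q u 0 = 0" for u :: "'k poly"
  using q_pos by (simp add: twisted_mult_def zero_power)

lemma twisted_mult_const: "twisted_mult q [:c:] w = smult c w" for w :: "'k poly"
  by (simp add: twisted_mult_eq_lin lin_def)

lemma twisted_mult_add_right: "twisted_mult q u (v + w) = twisted_mult q u v + twisted_mult q u w"
  for u v w :: "'k poly"
proof -
  have "(ftau q ^^ i) (v + w) = (ftau q ^^ i) v + (ftau q ^^ i) w" for i
    by (induction i) (simp_all add: ftau_add)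
  then show ?thesis
    by (simp add: twisted_mult_eq_lin lin_def smult_add_right sum.distrib)
qed

lemma twisted_mult_const_right:
  fixes u :: "'k poly"
  assumes "c ^ q = c"
  shows "twisted_mult q u [:c:] = smult c u"
proof (rule klinear_eqI[OF klinear_twisted_mult klinear_scale])
  fix i
  have "c ^ (q ^ i) = c"
    by (induction i) (simp_all add: power_mult assms mult.commute[of q])
  then show "twisted_mult q (monom 1 i) [:c:] = smult c (monom 1 i)"
    using ftau_pow_monom[of i c 0] by (simp add: twisted_mult_monom smult_monom monom_0)
qed

lemma twisted_mult_ftau: "twisted_mult q (ftau q u) w = ftau q (twisted_mult q u w)" for u w :: "'k poly"
proof -
  have u: "u \<in> HI (Suc (degree u))"
    by (rule HI_degree)
  show ?thesis
    unfolding twisted_mult_eq_lin lin_eq[OF u] lin_eq[OF ftau_HI[OF u]] sum.lessThan_Suc_shift[of _ "Suc (degree u)"]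
    by (simp add: coeff_ftau[OF q_pos] ftau_sum ftau_smult ftau_add del: sum.lessThan_Suc)
qed

lemma twisted_mult_ftau_pow:
  "twisted_mult q ((ftau q ^^ i) u) w = (ftau q ^^ i) (twisted_mult q u w)" for u w :: "'k poly"
  by (induction i) (simp_all add: twisted_mult_ftau)

lemma twisted_mult_assoc:
  "twisted_mult q (twisted_mult q u v) w = twisted_mult q u (twisted_mult q v w)" for u v w :: "'k poly"
proof (rule klinear_eqI[where f = "\<lambda>u. twisted_mult q (twisted_mult q u v) w"])
  show "klinear (\<lambda>u. twisted_mult q (twisted_mult q u v) w)"
    by (rule klinear_comp[OF klinear_twisted_mult klinear_twisted_mult])
qed (simp_all add: klinear_twisted_mult twisted_mult_monom twisted_mult_ftau_pow)

text \<open>For \<open>w\<close> equal to the image of \<open>T\<close> under a Drinfeld module, the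
  second claim gives the scalars \<open>\<theta> ^ (q ^ i)\<close> by which \<open>T\<close> acts on
  the order filtration.\<close>

lemma twisted_mult_LO:
  fixes u w :: "'k poly"
  assumes "u \<in> LO i"
  shows "twisted_mult q u w \<in> LO i" "coeff (twisted_mult q u w) i = coeff w 0 ^ (q ^ i) * coeff u i"
proof -
  have *: "coeff (twisted_mult q u w) m = (\<Sum>l\<in>{m}. coeff u l * coeff w (m - l) ^ (q ^ l))" if "m \<le> i" for m
  proof -
    have "coeff (twisted_mult q u w) m
        = (\<Sum>l<max (Suc (degree u)) (Suc m). coeff u l * coeff ((ftau q ^^ l) w) m)"
      unfolding twisted_mult_eq_lin lin_eq[OF HI_mono[OF HI_degree max.cobounded1[of _ "Suc m"]]]
      by (simp only: coeff_sum coeff_smult)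
    also have "\<dots> = (\<Sum>l\<in>{m}. coeff u l * coeff ((ftau q ^^ l) w) m)"
      using assms that
      by (intro sum.mono_neutral_right) (auto simp: coeff_ftau_pow LO_def not_less)
    finally show ?thesis
      by (simp add: coeff_ftau_pow)
  qed
  then show "twisted_mult q u w \<in> LO i"
    using assms by (auto simp: LO_def)
  show "coeff (twisted_mult q u w) i = coeff w 0 ^ (q ^ i) * coeff u i"
    using * by simp
qed

lemma ftau_pow_HI: "w \<in> HI N \<Longrightarrow> (ftau q ^^ i) w \<in> HI (i + N)"
  by (induction i) (auto intro: ftau_HI)

lemma twisted_mult_HI:
  fixes u w :: "'k poly"
  assumes u: "u \<in> HI N" and w: "w \<in> HI (Suc m)"
  shows "twisted_mult q u w \<in> HI (N + m)"
  unfolding twisted_mult_eq_lin lin_eq[OF u]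
  by (intro HI_sum HI_smult HI_mono[OF ftau_pow_HI[OF w]]) auto

end

section \<open>Finite fields\<close>

lemma finite_field_power_card:
  fixes x :: "'q::{field,finite}"
  shows "x ^ CARD('q) = x"
proof (cases "x = 0")
  case False
  let ?U = "UNIV - {0 :: 'q}"
  have "(\<Prod>y\<in>?U. y) = (\<Prod>y\<in>?U. x * y)"
    by (rule prod.reindex_bij_witness[where i = "\<lambda>y. x * y" and j = "\<lambda>y. y / x"]) (use False in auto)
  also have "\<dots> = x ^ card ?U * (\<Prod>y\<in>?U. y)"
    by (simp add: prod.distrib)
  finally have "x ^ card ?U = 1"
    by (simp add: prod_zero_iff)
  moreover have "CARD('q) = Suc (card ?U)"
    using card.remove[of UNIV "0 :: 'q"] by simp
  ultimately show ?thesis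
    by (simp only: power_Suc mult_1_right)
qed (simp add: zero_power)

lemma card_field_gt_1: "CARD('q::{field,finite}) > 1"
proof -
  have "card {0, 1 :: 'q} \<le> CARD('q)"
    by (intro card_mono) auto
  then show ?thesis
    by simp
qed

text \<open>The polynomial \<open>(X + 1) ^ q - X ^ q - 1\<close> has degree below \<open>q\<close>
  but vanishes at all \<open>q\<close> elements of the field, so its coefficients are zero.\<close>

lemma of_nat_choose_card_eq_0:
  assumes "0 < i" "i < CARD('q)"
  shows "(of_nat (CARD('q) choose i) :: 'q::{field,finite}) = 0"
proof -
  let ?q = "CARD('q)"
  define p where "p = (\<Sum>i\<in>{0<..<?q}. monom (of_nat (?q choose i) :: 'q) i)"
  have "poly p a = 0" for a
  proof -
    have "{..?q} = insert 0 (insert ?q {0<..<?q})"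
      using card_field_gt_1[where 'q = 'q] by auto
    then have "(a + 1) ^ ?q = 1 + (a ^ ?q + (\<Sum>i\<in>{0<..<?q}. of_nat (?q choose i) * a ^ i))"
      using card_field_gt_1[where 'q = 'q] unfolding binomial_ring by simp
    then show ?thesis
      by (simp add: p_def poly_sum poly_monom finite_field_power_card)
  qed
  then have roots: "{x. poly p x = 0} = UNIV"
    by auto
  have "p = 0"
  proof (rule ccontr)
    assume "p \<noteq> 0"
    moreover have "degree p < ?q"
      unfolding p_def by (rule degree_sum_less) (auto intro: le_less_trans[OF degree_monom_le])
    ultimately show False
      using card_poly_roots_bound[of p] roots by simp
  qed
  then have "coeff p i = 0"
    by simp
  then show ?thesis
    using assms by (simp add: p_def coeff_sum)
qed

lemma card_HI: "card (HI d :: 'q::{field,finite} poly set) = CARD('q) ^ d"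
proof -
  have "bij_betw (\<lambda>c. \<Sum>i<d. monom (c i) i) (Pi\<^sub>E {..<d} (\<lambda>_. UNIV)) (HI d :: 'q poly set)"
    unfolding bij_betw_def
  proof (intro conjI subset_antisym subsetI)
    show "inj_on (\<lambda>c. \<Sum>i<d. monom (c i) i) (Pi\<^sub>E {..<d} (\<lambda>_. UNIV :: 'q set))"
    proof (rule inj_onI)
      fix c c' :: "nat \<Rightarrow> 'q"
      assume c: "c \<in> Pi\<^sub>E {..<d} (\<lambda>_. UNIV)" "c' \<in> Pi\<^sub>E {..<d} (\<lambda>_. UNIV)"
        and eq: "(\<Sum>i<d. monom (c i) i) = (\<Sum>i<d. monom (c' i) i)"
      show "c = c'"
      proof (rule PiE_ext[OF c])
        fix i assume "i \<in> {..<d}"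
        then show "c i = c' i"
          using arg_cong[OF eq, of "\<lambda>p. coeff p i"] by (simp add: coeff_sum)
      qed
    qed
  next
    fix x assume "x \<in> (HI d :: 'q poly set)"
    then have "x = (\<Sum>i<d. monom (restrict (coeff x) {..<d} i) i)"
      by (subst HI_expand[of x d]) auto
    then show "x \<in> (\<lambda>c. \<Sum>i<d. monom (c i) i) ` (Pi\<^sub>E {..<d} (\<lambda>_. UNIV))"
      by (rule image_eqI[where x = "restrict (coeff x) {..<d}"]) simp
  qed (auto intro!: HI_sum HI_monom)
  then have "card (Pi\<^sub>E {..<d} (\<lambda>_. UNIV :: 'q set)) = card (HI d :: 'q poly set)"
    by (rule bij_betw_same_card)
  then show ?thesis
    by (simp add: card_PiE)
qed

section \<open>Fields of nonzero characteristic over \<open>F\<^sub>q[T]\<close>\<close>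

locale A_algebra =
  fixes \<gamma> :: "'q::{field,finite} poly \<Rightarrow> 'k::field" and q :: nat
  assumes \<gamma>: "A_field_map \<gamma>" and q_card: "q = CARD('q)"
begin

lemma q_gt_1: "q > 1"
  using card_field_gt_1[where 'q = 'q] by (simp add: q_card)

lemma \<gamma>_1: "\<gamma> 1 = 1" and \<gamma>_add: "\<gamma> (a + b) = \<gamma> a + \<gamma> b" and \<gamma>_mult: "\<gamma> (a * b) = \<gamma> a * \<gamma> b"
  using \<gamma> by (auto simp: A_field_map_def)

lemma \<gamma>_diff: "\<gamma> (a - b) = \<gamma> a - \<gamma> b"
  using \<gamma>_add[of "a - b" b] by simp

lemma \<gamma>_0: "\<gamma> 0 = 0"
  using \<gamma>_diff[of 0 0] by simp

lemma \<gamma>_pow: "\<gamma> (a ^ i) = \<gamma> a ^ i"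
  by (induction i) (simp_all add: \<gamma>_1 \<gamma>_mult)

lemma \<gamma>_const_pow: "\<gamma> [:c:] ^ q = \<gamma> [:c:]"
proof -
  have "[:c:] ^ i = [:c ^ i:]" for i
    by (induction i) (simp_all add: one_pCons)
  then show ?thesis
    by (simp add: q_card finite_field_power_card flip: \<gamma>_pow)
qed

lemma \<gamma>_const_eq_0: "\<gamma> [:c:] = 0 \<longleftrightarrow> c = 0"
proof -
  have "\<gamma> [:c:] * \<gamma> [:inverse c:] = 1" if "c \<noteq> 0"
    using that by (simp add: \<gamma>_1 flip: \<gamma>_mult one_pCons)
  then show ?thesis
    using \<gamma>_0 by (cases "c = 0") auto
qed

lemma \<gamma>_const_inj: "\<gamma> [:c:] = \<gamma> [:c':] \<longleftrightarrow> c = c'"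
  using \<gamma>_const_eq_0[of "c - c'"] \<gamma>_diff[of "[:c:]" "[:c':]"] by simp

lemma of_nat_\<gamma>: "\<gamma> [:of_nat m:] = of_nat m"
proof (induction m)
  case (Suc m)
  have "\<gamma> [:of_nat (Suc m):] = \<gamma> ([:of_nat m:] + 1)"
    by (simp add: one_pCons add.commute)
  then show ?case
    unfolding \<gamma>_add Suc \<gamma>_1 by simp
qed (simp add: \<gamma>_0)

lemma frobenius_add: "(x + y :: 'k) ^ q = x ^ q + y ^ q"
proof -
  have ins: "{..q} = insert 0 (insert q {0<..<q})"
    using q_gt_1 by auto
  have "(\<Sum>i\<in>{0<..<q}. of_nat (q choose i) * x ^ i * y ^ (q - i)) = 0"
  proof (rule sum.neutral, rule ballI)
    fix i assume "i \<in> {0<..<q}"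
    then have "(of_nat (q choose i) :: 'k) = 0"
      using of_nat_choose_card_eq_0[where 'q = 'q, of i, folded q_card] of_nat_\<gamma>[of "q choose i"] \<gamma>_0 by simp
    then show "of_nat (q choose i) * x ^ i * y ^ (q - i) = 0"
      by simp
  qed
  then show ?thesis
    using q_gt_1 unfolding binomial_ring ins by simp
qed

text \<open>Moves the coefficients into \<open>'k\<close> but keeps \<open>T\<close> as a variable,
  whereas \<gamma> also specialises \<open>T\<close> to its image.\<close>

definition base :: "'q poly \<Rightarrow> 'k poly" where
  "base a = map_poly (\<lambda>c. \<gamma> [:c:]) a"

lemma coeff_base: "coeff (base a) i = \<gamma> [:coeff a i:]"
  by (simp add: base_def coeff_map_poly \<gamma>_0)

lemma degree_base: "degree (base a) = degree a"
  unfolding base_def by (rule degree_map_poly) (simp add: \<gamma>_const_eq_0)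

lemma base_pCons: "base (pCons c a) = pCons (\<gamma> [:c:]) (base a)"
  by (rule poly_eqI) (simp add: coeff_base coeff_pCons split: nat.split)

lemma poly_base: "poly (base a) (\<gamma> [:0, 1:]) = \<gamma> a"
proof (induction a)
  case (pCons c a)
  have "\<gamma> (pCons c a) = \<gamma> ([:c:] + [:0, 1:] * a)"
    by simp
  then show ?case
    unfolding \<gamma>_add \<gamma>_mult base_pCons using pCons by simp
qed (simp add: base_def \<gamma>_0)

lemma poly_base_frob: "poly (base a) (x ^ (q ^ i)) = poly (base a) x ^ (q ^ i)"
proof (induction i)
  case (Suc i)
  have "poly (base a) (y ^ q) = poly (base a) y ^ q" for y
  proof (induction a)
    case (pCons c a)
    then show ?case
      by (simp add: base_pCons frobenius_add \<gamma>_const_pow power_mult_distrib)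
  qed (use q_gt_1 in \<open>simp add: base_def zero_power\<close>)
  from this[of "x ^ (q ^ i)"] show ?case
    by (simp add: Suc mult.commute[of q] power_mult)
qed simp

lemma card_frob_fixed_le:
  assumes "e > 0"
  shows "finite {x :: 'k. x ^ (q ^ e) = x} \<and> card {x :: 'k. x ^ (q ^ e) = x} \<le> q ^ e"
proof -
  have gt: "q ^ e > 1"
    using one_less_power[OF q_gt_1 assms] .
  define p where "p = monom 1 (q ^ e) - [:0, 1 :: 'k:]"
  have deg: "degree p = q ^ e"
    unfolding p_def using gt
    by (subst diff_conv_add_uminus, subst degree_add_eq_left) (auto simp: degree_monom_eq)
  have p0: "p \<noteq> 0"
    using deg gt by (metis degree_0 less_nat_zero_code)
  have "{x :: 'k. x ^ (q ^ e) = x} = {x. poly p x = 0}"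
    by (simp add: p_def poly_monom)
  then show ?thesis
    using card_poly_roots_bound[OF p0] poly_roots_finite[OF p0] deg by simp
qed

lemma card_frob_fixed: "card {x :: 'k. x ^ q = x} = q"
proof -
  have fin: "finite {x :: 'k. x ^ q = x}" and le: "card {x :: 'k. x ^ q = x} \<le> q"
    using card_frob_fixed_le[of 1] by auto
  have "inj (\<lambda>c. \<gamma> [:c:])"
    by (auto intro: injI simp: \<gamma>_const_inj)
  then have "q = card (range (\<lambda>c. \<gamma> [:c:]))"
    by (simp add: card_image q_card)
  also have "\<dots> \<le> card {x :: 'k. x ^ q = x}"
    by (rule card_mono[OF fin]) (auto simp: \<gamma>_const_pow)
  finally show ?thesis
    using le by simp
qed

end

locale A_characteristic = A_algebra \<gamma> q
  for \<gamma> :: "'q::{field,finite} poly \<Rightarrow> 'k::alg_closed_field" and q :: nat +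
  fixes \<pp> :: "'q poly"
  assumes ker: "\<gamma> a = 0 \<longleftrightarrow> \<pp> dvd a" and deg_pos: "degree \<pp> > 0"
begin

abbreviation "\<theta> \<equiv> \<gamma> [:0, 1:]"
abbreviation "d \<equiv> degree \<pp>"

sublocale frobenius q "TYPE('k)"
  by unfold_locales (use q_gt_1 frobenius_add in auto)

lemma frob_pow_inj: "x ^ (q ^ i) = y ^ (q ^ i) \<Longrightarrow> x = y" for x y :: 'k
proof (induction i)
  case (Suc i)
  then show ?case
    using frob_inj[of "x ^ (q ^ i)" "y ^ (q ^ i)"] by (simp add: power_mult mult.commute[of q])
qed simp

lemma base_root: "poly (base \<pp>) (\<theta> ^ (q ^ i)) = 0"
  using ker[of \<pp>] zero_power[of "q ^ i"] q_pos by (simp add: poly_base_frob poly_base)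

lemma \<gamma>_inj_HI: "inj_on \<gamma> (HI d)"
proof (rule inj_onI)
  fix a b assume ab: "a \<in> HI d" "b \<in> HI d" "\<gamma> a = \<gamma> b"
  then have "\<pp> dvd a - b"
    using ker[of "a - b"] by (simp add: \<gamma>_diff)
  moreover have "a - b \<in> HI d"
    using ab by (intro HI_diff)
  then have "degree (a - b) < d \<or> a - b = 0"
    using deg_pos HI_degree_iff[of "a - b" "d - 1"] by (cases "a - b = 0") auto
  ultimately show "a = b"
    using dvd_imp_degree_le[of \<pp> "a - b"] by (cases "a = b") auto
qed

text \<open>If \<theta> is fixed by the \<open>q ^ e\<close>-power map, so is every
  \<open>\<gamma> a\<close>. These include \<open>q ^ d\<close> distinct values, while the map has
  at most \<open>q ^ e\<close> fixed points.\<close>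

lemma period_ge:
  assumes "e > 0" "\<theta> ^ (q ^ e) = \<theta>"
  shows "d \<le> e"
proof -
  have "\<gamma> a ^ (q ^ e) = \<gamma> a" for a
    using poly_base_frob[of a \<theta> e] assms(2) by (simp add: poly_base)
  then have "card (\<gamma> ` HI d) \<le> card {x :: 'k. x ^ (q ^ e) = x}"
    using card_frob_fixed_le[OF assms(1)] by (intro card_mono) auto
  then have "q ^ d \<le> q ^ e"
    using card_frob_fixed_le[OF assms(1)] card_image[OF \<gamma>_inj_HI] card_HI[where 'q = 'q, of d, folded q_card] by simp
  then show ?thesis
    using q by (simp add: power_increasing_iff)
qed

lemma period_shift:
  assumes "i < j" "\<theta> ^ (q ^ i) = \<theta> ^ (q ^ j)"
  shows "\<theta> ^ (q ^ (j - i)) = \<theta>"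
proof (rule frob_pow_inj)
  have "q ^ (j - i) * q ^ i = q ^ j"
    using assms(1) by (simp flip: power_add)
  then show "(\<theta> ^ (q ^ (j - i))) ^ (q ^ i) = \<theta> ^ (q ^ i)"
    using assms(2) by (simp flip: power_mult)
qed

lemma base_nonzero: "base \<pp> \<noteq> 0"
  using degree_base[of \<pp>] deg_pos by auto

text \<open>Among the \<open>d + 1\<close> conjugates \<open>\<theta> ^ (q ^ i)\<close> with
  \<open>i \<le> d\<close> two coincide, being roots of a polynomial of degree \<open>d\<close>.
  Their distance is a period of at most \<open>d\<close>, hence equal to \<open>d\<close> by
  \<open>period_ge\<close>.\<close>

lemma period_d: "\<theta> ^ (q ^ d) = \<theta>"
proof -
  let ?f = "\<lambda>i. \<theta> ^ (q ^ i)"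
  have "card (?f ` {..d}) \<le> card {x. poly (base \<pp>) x = 0}"
    using base_root by (intro card_mono poly_roots_finite base_nonzero) auto
  also have "\<dots> \<le> d"
    using card_poly_roots_bound[OF base_nonzero] degree_base by simp
  finally have "\<not> inj_on ?f {..d}"
    using card_image[of ?f "{..d}"] by auto
  then obtain i j where ij: "i \<le> d" "j \<le> d" "i \<noteq> j" "?f i = ?f j"
    by (auto simp: inj_on_def)
  define a b where "a = min i j" and "b = max i j"
  have ab: "a < b" "b \<le> d" "?f a = ?f b"
    using ij by (auto simp: a_def b_def min_def max_def)
  have "?f (b - a) = \<theta>"
    using period_shift ab by blast
  moreover from this have "b - a = d"
    using period_ge[of "b - a"] ab by simp
  ultimately show ?thesis
    by simp
qed

lemma period_mod: "\<theta> ^ (q ^ i) = \<theta> ^ (q ^ (i mod d))"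
proof (induction i rule: less_induct)
  case (less i)
  show ?case
  proof (cases "i < d")
    case False
    have "q ^ i = q ^ d * q ^ (i - d)"
      using False by (simp flip: power_add)
    then have "\<theta> ^ (q ^ i) = (\<theta> ^ (q ^ d)) ^ (q ^ (i - d))"
      by (simp only: power_mult)
    then have "\<theta> ^ (q ^ i) = \<theta> ^ (q ^ (i - d))"
      by (simp only: period_d)
    also have "\<dots> = \<theta> ^ (q ^ (i mod d))"
      using less[of "i - d"] False deg_pos by (simp add: le_mod_geq)
    finally show ?thesis .
  qed simp
qed

lemma theta_distinct:
  assumes "i < d" "j < d" "\<theta> ^ (q ^ i) = \<theta> ^ (q ^ j)"
  shows "i = j"
proof -
  have "\<not> i < j" if "\<theta> ^ (q ^ i) = \<theta> ^ (q ^ j)" "i < d" "j < d" for i j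
    using period_ge[of "j - i"] period_shift[of i j] that by auto
  from this[of i j] this[of j i] show ?thesis
    using assms by simp
qed

lemma period: "\<theta> ^ (q ^ i) = \<theta> ^ (q ^ j) \<longleftrightarrow> i mod d = j mod d"
  using period_mod[of i] period_mod[of j] theta_distinct[of "i mod d" "j mod d"] deg_pos
  by (metis mod_less_divisor)

text \<open>At a multiple root the cofactor \<open>E\<close>, of degree \<open>d - 1\<close>, would
  still vanish at all \<open>d\<close> distinct conjugates of \<theta>.\<close>

lemma base_simple: "poly (pderiv (base \<pp>)) (\<theta> ^ (q ^ i)) \<noteq> 0"
proof
  let ?t = "\<theta> ^ (q ^ i)"
  assume 0: "poly (pderiv (base \<pp>)) ?t = 0"
  obtain E where E: "base \<pp> = [:- ?t, 1:] * E"
    using base_root[of i] by (auto simp: poly_eq_0_iff_dvd dvd_def)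
  have E0: "E \<noteq> 0"
    using E base_nonzero by auto
  have "poly E ?t = 0"
    using 0 unfolding E by (simp add: pderiv_mult pderiv_pCons del: mult_pCons_left)
  moreover have "poly E (\<theta> ^ (q ^ j)) = 0" if "\<theta> ^ (q ^ j) \<noteq> ?t" for j
    using base_root[of j] that unfolding E by auto
  ultimately have "poly E (\<theta> ^ (q ^ j)) = 0" for j
    by (cases "\<theta> ^ (q ^ j) = ?t") auto
  then have "(\<lambda>j. \<theta> ^ (q ^ j)) ` {..<d} \<subseteq> {x. poly E x = 0}"
    by auto
  then have "card ((\<lambda>j. \<theta> ^ (q ^ j)) ` {..<d}) \<le> degree E"
    using card_mono[OF poly_roots_finite[OF E0]] card_poly_roots_bound[OF E0] order_trans by blast
  moreover have "card ((\<lambda>j. \<theta> ^ (q ^ j)) ` {..<d}) = d"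
    using theta_distinct by (subst card_image) (auto simp: inj_on_def)
  moreover have "d = Suc (degree E)"
    using degree_base[of \<pp>] E0 unfolding E by (simp add: degree_mult_eq del: mult_pCons_left)
  ultimately show False
    by simp
qed

end

section \<open>Supersingular Drinfeld modules\<close>

lemma papp_eq_sum:
  assumes "degree P < N"
  shows "papp P S x = (\<Sum>l<N. smult (coeff P l) ((S ^^ l) x))"
  unfolding papp_def
  by (rule sum.mono_neutral_left) (use assms in \<open>auto simp: coeff_eq_0\<close>)

lemma papp_pCons: "papp (pCons c P) S x = smult c x + papp P S (S x)"
proof -
  have "papp (pCons c P) S x = (\<Sum>l<Suc (Suc (degree P)). smult (coeff (pCons c P) l) ((S ^^ l) x))"
    by (rule papp_eq_sum) (use degree_pCons_le[of c P] in simp)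
  also have "\<dots> = smult c x + (\<Sum>l<Suc (degree P). smult (coeff P l) ((S ^^ Suc l) x))"
    by (subst sum.lessThan_Suc_shift) simp
  also have "(\<Sum>l<Suc (degree P). smult (coeff P l) ((S ^^ Suc l) x)) = papp P S (S x)"
    by (subst papp_eq_sum[of P "Suc (degree P)"]) (simp_all add: funpow_swap1)
  finally show ?thesis .
qed

context A_characteristic
begin

abbreviation rmul :: "('q poly \<Rightarrow> 'k poly) \<Rightarrow> 'k poly \<Rightarrow> 'k poly" where
  "rmul \<phi> x \<equiv> twisted_mult q x (\<phi> [:0, 1:])"

lemma drinfeld_pCons:
  assumes "drinfeld_module \<gamma> r \<phi>"
  shows "\<phi> (pCons c a) = [:\<gamma> [:c:]:] + twisted_mult q (\<phi> [:0, 1:]) (\<phi> a)"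
proof -
  have "\<phi> (pCons c a) = \<phi> ([:c:] + [:0, 1:] * a)"
    by simp
  then show ?thesis
    using assms by (simp only: drinfeld_module_def q_card)
qed

lemma drinfeld_0: "drinfeld_module \<gamma> r \<phi> \<Longrightarrow> \<phi> 0 = 0"
  using \<gamma>_0 unfolding drinfeld_module_def by (metis pCons_0_0)

text \<open>Horner's scheme in \<open>a\<close>; constants from F_q commute with \<tau>, so
  multiplying by them on the right is scaling.\<close>

lemma twisted_mult_drinfeld:
  assumes "drinfeld_module \<gamma> r \<phi>"
  shows "twisted_mult q x (\<phi> a) = papp (base a) (rmul \<phi>) x"
proof (induction a arbitrary: x)
  case 0
  then show ?case
    using drinfeld_0[OF assms] by (simp add: papp_def base_def twisted_mult_0_right)
next
  case (pCons c a)
  have "twisted_mult q x (\<phi> (pCons c a)) = smult (\<gamma> [:c:]) x + twisted_mult q (rmul \<phi> x) (\<phi> a)"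
    unfolding drinfeld_pCons[OF assms, of c a]
    by (simp add: twisted_mult_add_right twisted_mult_const_right \<gamma>_const_pow twisted_mult_assoc)
  then show ?case
    by (simp add: pCons.IH base_pCons papp_pCons)
qed

text \<open>Height \<open>r\<close> leaves no terms of \<open>\<phi> \<pp>\<close> below degree
  \<open>r * d\<close>, and its degree is at most \<open>r * d\<close>, so it is a monomial.\<close>

lemma supersingular_operator_rmul:
  assumes "supersingular \<gamma> \<pp> r \<phi>"
  obtains \<beta> where "supersingular_operator q r \<theta> (base \<pp>) (rmul \<phi>) \<beta>"
proof -
  let ?n = "r * d"
  have dm: "drinfeld_module \<gamma> r \<phi>" and ht: "coeff (\<phi> \<pp>) ?n \<noteq> 0" "\<And>i. i < ?n \<Longrightarrow> coeff (\<phi> \<pp>) i = 0"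
    using assms by (auto simp: supersingular_def has_height_def)
  have T: "coeff (\<phi> [:0, 1:]) 0 = \<theta>" "degree (\<phi> [:0, 1:]) = r"
    and r: "r \<ge> 1"
    using dm by (auto simp: drinfeld_module_def)
  have T_HI: "\<phi> [:0, 1:] \<in> HI (Suc r)"
    using HI_degree[of "\<phi> [:0, 1:]"] by (simp add: T)
  have "\<phi> \<pp> = monom (coeff (\<phi> \<pp>) ?n) ?n"
  proof (rule poly_eqI)
    fix i
    have "(rmul \<phi> ^^ l) 1 \<in> HI (Suc (r * l))" for l
    proof (induction l)
      case (Suc l)
      then show ?case
        using twisted_mult_HI[OF Suc T_HI] by (simp add: algebra_simps)
    qed (auto simp: HI_def)
    note HI_mono[OF this, of _ "Suc ?n"]
    then have "papp (base \<pp>) (rmul \<phi>) 1 \<in> HI (Suc ?n)"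
      unfolding papp_def degree_base by (intro HI_sum HI_smult) auto
    then have "\<phi> \<pp> \<in> HI (Suc ?n)"
      using twisted_mult_drinfeld[OF dm, of 1 \<pp>] by (simp add: twisted_mult_1)
    then show "coeff (\<phi> \<pp>) i = coeff (monom (coeff (\<phi> \<pp>) ?n) ?n) i"
      using ht(2)[of i] by (cases i ?n rule: linorder_cases) (auto simp: HI_def)
  qed
  then have PS: "papp (base \<pp>) (rmul \<phi>) (monom 1 i) = monom (coeff (\<phi> \<pp>) ?n ^ (q ^ i)) (i + ?n)" for i
    using twisted_mult_drinfeld[OF dm, of "monom 1 i" \<pp>]
    by (metis twisted_mult_monom ftau_pow_monom)
  have "supersingular_operator q r \<theta> (base \<pp>) (rmul \<phi>) (coeff (\<phi> \<pp>) ?n)"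
  proof
    show "rmul \<phi> x \<in> LO i" "coeff (rmul \<phi> x) i = \<theta> ^ (q ^ i) * coeff x i" if "x \<in> LO i" for x i
      using twisted_mult_LO[OF that] T(1) by auto
    show "coeff (rmul \<phi> (monom 1 i)) (i + r) \<noteq> 0" for i
      using T r by (auto simp: twisted_mult_monom coeff_ftau_pow)
  qed (use ht PS in \<open>simp_all add: klinear_twisted_mult twisted_mult_ftau twisted_mult_HI[OF _ T_HI] degree_base\<close>)
  then show ?thesis
    by (rule that)
qed

lemma drinfeld_Hom_iff:
  assumes \<phi>: "drinfeld_module \<gamma> r \<phi>" and \<psi>: "drinfeld_module \<gamma> r' \<psi>"
  shows "u \<in> drinfeld_Hom \<phi> \<psi> \<longleftrightarrow>
    twisted_mult q u (\<phi> [:0, 1:]) = twisted_mult q (\<psi> [:0, 1:]) u"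
proof
  assume T: "twisted_mult q u (\<phi> [:0, 1:]) = twisted_mult q (\<psi> [:0, 1:]) u"
  have "twisted_mult q u (\<phi> a) = twisted_mult q (\<psi> a) u" for a
  proof (induction a)
    case 0
    then show ?case
      using drinfeld_0[OF \<phi>] drinfeld_0[OF \<psi>] klinear_0[OF klinear_twisted_mult] by (simp add: twisted_mult_0_right)
  next
    case (pCons c a)
    have "twisted_mult q u (\<phi> (pCons c a))
        = smult (\<gamma> [:c:]) u + twisted_mult q (twisted_mult q u (\<phi> [:0, 1:])) (\<phi> a)"
      unfolding drinfeld_pCons[OF \<phi>, of c a]
      by (simp add: twisted_mult_add_right twisted_mult_const_right \<gamma>_const_pow twisted_mult_assoc)
    also have "\<dots> = smult (\<gamma> [:c:]) u + twisted_mult q (twisted_mult q (\<psi> [:0, 1:]) (\<psi> a)) u"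
      unfolding T by (simp add: twisted_mult_assoc pCons.IH)
    also have "\<dots> = twisted_mult q (\<psi> (pCons c a)) u"
      unfolding drinfeld_pCons[OF \<psi>, of c a]
      by (simp only: klinear_add[OF klinear_twisted_mult] twisted_mult_const)
    finally show ?case .
  qed
  then show "u \<in> drinfeld_Hom \<phi> \<psi>"
    by (simp add: drinfeld_Hom_def flip: q_card)
qed (simp add: drinfeld_Hom_def flip: q_card)

lemma bounded_Hom_eq:
  assumes \<phi>: "drinfeld_module \<gamma> r \<phi>" and \<psi>: "drinfeld_module \<gamma> r' \<psi>"
  shows "bounded_Hom \<phi> \<psi> s = {u \<in> drinfeld_Hom \<phi> \<psi>. u \<in> HI (Suc s)}"
proof -
  have "0 \<in> drinfeld_Hom \<phi> \<psi>"
    unfolding drinfeld_Hom_iff[OF \<phi> \<psi>]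
    using klinear_0[OF klinear_twisted_mult] by (simp add: twisted_mult_0_right)
  then show ?thesis
    by (auto simp: bounded_Hom_def HI_degree_iff)
qed

theorem card_bounded_Hom:
  assumes \<phi>: "supersingular \<gamma> \<pp> r \<phi>" and \<psi>: "supersingular \<gamma> \<pp> r \<psi>"
    and s: "r * (d - 1) \<le> s"
  obtains e where "card (bounded_Hom \<phi> \<psi> s) = q ^ e"
    "e + d * (r * (r - 1) div 2) = (\<Sum>j<r. Suc (s + j))"
proof -
  have dm: "drinfeld_module \<gamma> r \<phi>" "drinfeld_module \<gamma> r \<psi>"
    using \<phi> \<psi> by (auto simp: supersingular_def)
  obtain \<beta> where \<beta>: "supersingular_operator q r \<theta> (base \<pp>) (rmul \<psi>) \<beta>"
    using supersingular_operator_rmul[OF \<psi>] .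
  obtain \<alpha> where \<alpha>: "supersingular_operator q r \<theta> (base \<pp>) (rmul \<phi>) \<alpha>"
    using supersingular_operator_rmul[OF \<phi>] .
  interpret P: supersingular_pair q "TYPE('k)" r \<theta> "base \<pp>" "rmul \<psi>" \<beta> "rmul \<phi>" \<alpha>
    by (intro supersingular_pair.intro \<alpha> \<beta> supersingular_pair_axioms.intro)
      (use dm(1) deg_pos base_root base_simple period in \<open>auto simp: degree_base drinfeld_module_def\<close>)
  let ?F = "{f \<in> P.X s. \<forall>x. f (ftau q x) = ftau q (f x)}"
  have "bij_betw (\<lambda>u x. twisted_mult q x u) (bounded_Hom \<phi> \<psi> s) ?F"
    unfolding bij_betw_def
  proof (intro conjI subset_antisym subsetI)
    show "inj_on (\<lambda>u x. twisted_mult q x u) (bounded_Hom \<phi> \<psi> s)"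
      by (rule inj_onI) (metis twisted_mult_1)
  next
    fix f assume "f \<in> (\<lambda>u x. twisted_mult q x u) ` bounded_Hom \<phi> \<psi> s"
    then obtain u where u: "u \<in> bounded_Hom \<phi> \<psi> s" and f: "f = (\<lambda>x. twisted_mult q x u)"
      by blast
    have T: "twisted_mult q u (\<phi> [:0, 1:]) = twisted_mult q (\<psi> [:0, 1:]) u" and "u \<in> HI (Suc s)"
      using u unfolding bounded_Hom_eq[OF dm] drinfeld_Hom_iff[OF dm] by auto
    then have "P.bounded s f"
      unfolding P.bounded_def f by (auto intro: twisted_mult_HI)
    moreover have "P.intertwiner f"
      unfolding P.intertwiner_def f by (simp add: klinear_twisted_mult twisted_mult_assoc T)
    moreover have "P.order_preserving f"
      unfolding P.order_preserving_def f by (auto intro: twisted_mult_LO)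
    ultimately show "f \<in> ?F"
      by (simp add: P.X_def P.H_def f twisted_mult_ftau)
  next
    fix f assume "f \<in> ?F"
    then have f: "P.intertwiner f" "P.bounded s f" and ft: "f (ftau q x) = ftau q (f x)" for x
      by (auto simp: P.X_def P.H_def)
    have lin: "klinear f"
      using f(1) by (simp add: P.intertwiner_def)
    \<comment> \<open>A \<open>k\<close>-linear map commuting with \<tau> is determined by its value
      at 1: it is right multiplication by \<open>f 1\<close>.\<close>
    have "f ((ftau q ^^ i) 1) = (ftau q ^^ i) (f 1)" for i
      by (induction i) (simp_all add: ft)
    moreover have "(ftau q ^^ i) 1 = (monom 1 i :: 'k poly)" for i
      using ftau_pow_monom[of i 1 0] by simp
    ultimately have "f (monom 1 i) = (ftau q ^^ i) (f 1)" for i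
      by metis
    then have f_eq: "f = (\<lambda>x. twisted_mult q x (f 1))"
      by - (rule ext, rule klinear_eqI[OF lin klinear_twisted_mult], simp add: twisted_mult_monom)
    have "(1 :: 'k poly) \<in> HI (Suc 0)"
      by (auto simp: HI_def)
    then have "f 1 \<in> HI (Suc 0 + s)"
      using f(2) unfolding P.bounded_def by blast
    moreover have "f 1 \<in> drinfeld_Hom \<phi> \<psi>"
      unfolding drinfeld_Hom_iff[OF dm]
      using f(1) fun_cong[OF f_eq, of "\<psi> [:0, 1:]"] unfolding P.intertwiner_def by (metis twisted_mult_1)
    ultimately show "f \<in> (\<lambda>u x. twisted_mult q x u) ` bounded_Hom \<phi> \<psi> s"
      unfolding bounded_Hom_eq[OF dm] by (intro image_eqI[where x = "f 1"] f_eq) simp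
  qed
  then have "card (bounded_Hom \<phi> \<psi> s) = card ?F"
    by (rule bij_betw_same_card)
  moreover obtain e where "card ?F = card {c :: 'k. c ^ q = c} ^ e"
    "e + degree (base \<pp>) * (r * (r - 1) div 2) = (\<Sum>j<r. Suc (s + j))"
    using P.card_ftau_fixed[of s] s by (auto simp: degree_base)
  ultimately show ?thesis
    using that card_frob_fixed by (simp add: degree_base)
qed

end

section \<open>Codes and their ranks\<close>

lemma (in vector_space) card_span_independent:
  assumes "finite B" "independent B"
  shows "card (span B) = card (UNIV :: 'a set) ^ card B"
proof -
  let ?h = "\<lambda>c. \<Sum>b\<in>B. c b *s b"
  have inj: "inj_on ?h (Pi\<^sub>E B (\<lambda>_. UNIV))"
  proof (rule inj_onI)
    fix c c' assume c: "c \<in> Pi\<^sub>E B (\<lambda>_. UNIV)" "c' \<in> Pi\<^sub>E B (\<lambda>_. UNIV)" "?h c = ?h c'"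
    then have "?h (\<lambda>b. c b - c' b) = 0"
      by (simp add: scale_left_diff_distrib sum_subtractf)
    then have "\<forall>b\<in>B. c b - c' b = 0"
      using independentD[OF assms(2,1) subset_refl, of "\<lambda>b. c b - c' b"] by blast
    then show "c = c'"
      by (intro PiE_ext[OF c(1,2)]) simp
  qed
  have im: "?h ` Pi\<^sub>E B (\<lambda>_. UNIV) = span B"
    unfolding span_finite[OF assms(1)]
  proof (intro subset_antisym subsetI)
    fix x assume "x \<in> range ?h"
    then obtain c where c: "x = ?h c"
      by blast
    have "x = ?h (restrict c B)"
      unfolding c by (intro sum.cong) simp_all
    then show "x \<in> ?h ` Pi\<^sub>E B (\<lambda>_. UNIV)"
      by (rule image_eqI[where x = "restrict c B"]) simp
  qed blast
  have "card (span B) = card (Pi\<^sub>E B (\<lambda>_. UNIV :: 'a set))"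
    using card_image[OF inj] unfolding im .
  then show ?thesis
    using assms(1) by (simp add: card_PiE)
qed

lemma (in vector_space) card_subspace:
  assumes "subspace V" "finite V"
  shows "card V = card (UNIV :: 'a set) ^ dim V"
proof -
  obtain B where B: "B \<subseteq> V" "independent B" "V \<subseteq> span B" "card B = dim V"
    by (rule basis_exists)
  have "span B = V"
    using B(3) span_minimal[OF B(1) assms(1)] by blast
  then show ?thesis
    using card_span_independent[of B] B finite_subset[OF B(1) assms(2)] by simp
qed

text \<open>Rank-nullity by counting. Pairing with a basis of the row space takes at most
  \<open>CARD('l) ^ rank A\<close> values, and vectors with equal values differ by an element of the
  kernel.\<close>

lemma card_kernel_rank:
  fixes A :: "'l::{field,finite} ^ 'n ^ 'm"
  shows "CARD('l) ^ CARD('n) \<le> card {x. A *v x = 0} * CARD('l) ^ rank A"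
proof -
  obtain B where B: "B \<subseteq> rows A" "vec.independent B" "rows A \<subseteq> vec.span B" "card B = vec.dim (rows A)"
    by (rule vec.basis_exists)
  define T where "T x = restrict (\<lambda>b. \<Sum>i\<in>UNIV. b $ i * x $ i) B" for x :: "'l ^ 'n"
  have T_PiE: "T ` UNIV \<subseteq> Pi\<^sub>E B (\<lambda>_. UNIV)"
    by (auto simp: T_def)
  have fin: "finite (Pi\<^sub>E B (\<lambda>_. UNIV :: 'l set))"
    by (intro finite_PiE) auto
  have fib: "card {x. T x = T y} \<le> card {x. A *v x = 0}" for y
  proof (rule card_inj_on_le[where f = "\<lambda>x. x - y"])
    show "(\<lambda>x. x - y) ` {x. T x = T y} \<subseteq> {x. A *v x = 0}"
    proof clarify
      fix x assume xy: "T x = T y"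
      let ?K = "{b. (\<Sum>i\<in>UNIV. b $ i * (x - y) $ i) = 0}"
      have "vec.subspace ?K"
        by (auto simp: vec.subspace_def distrib_right sum.distrib mult.assoc sum_distrib_left[symmetric])
      moreover have "B \<subseteq> ?K"
      proof
        fix b assume "b \<in> B"
        then show "b \<in> ?K"
          using fun_cong[OF xy, of b] by (simp add: T_def right_diff_distrib sum_subtractf)
      qed
      ultimately have "rows A \<subseteq> ?K"
        using B(3) vec.span_minimal by blast
      then have "row i A \<in> ?K" for i
        by (auto simp: rows_def)
      then show "A *v (x - y) = 0"
        by (simp add: vec_eq_iff matrix_vector_mult_def row_def)
    qed
  qed (auto simp: inj_on_def)
  have "UNIV = (\<Union>z\<in>T ` UNIV. {x. T x = z})"
    by auto
  then have "CARD('l ^ 'n) \<le> (\<Sum>z\<in>T ` UNIV. card {x. T x = z})"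
    by (metis card_UN_le finite)
  also have "\<dots> \<le> (\<Sum>z\<in>T ` UNIV. card {x. A *v x = 0})"
    by (rule sum_mono) (use fib in auto)
  also have "\<dots> = card (T ` UNIV) * card {x. A *v x = 0}"
    by simp
  also have "card (T ` UNIV) \<le> card (Pi\<^sub>E B (\<lambda>_. UNIV :: 'l set))"
    by (rule card_mono[OF fin T_PiE])
  also have "\<dots> = CARD('l) ^ rank A"
    using B(4) by (simp add: card_PiE row_rank_def_gen)
  finally show ?thesis
    by (simp add: CARD_vec mult.commute)
qed

lemma rank_le_nonzero_rows:
  fixes A :: "'l::field ^ 'n ^ 'm"
  assumes "\<And>i. i \<in> J \<Longrightarrow> row i A = 0"
  shows "rank A \<le> card (UNIV - J)"
proof -
  have "rows A \<subseteq> vec.span ((\<lambda>i. row i A) ` (UNIV - J))"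
  proof
    fix x assume "x \<in> rows A"
    then obtain i where i: "x = row i A"
      by (auto simp: rows_def)
    show "x \<in> vec.span ((\<lambda>i. row i A) ` (UNIV - J))"
      using assms[of i] i vec.span_zero by (cases "i \<in> J") (auto intro: vec.span_base)
  qed
  then have "rank A \<le> card ((\<lambda>i. row i A) ` (UNIV - J))"
    unfolding row_rank_def_gen by (intro vec.dim_le_card) auto
  also have "\<dots> \<le> card (UNIV - J)"
    by (intro card_image_le) auto
  finally show ?thesis .
qed

text \<open>Two codewords agreeing in \<open>j\<close> rows differ by a matrix with \<open>j\<close>
  zero rows, whose rank is too small unless they are equal. Hence \<open>j\<close> rows determine a
  codeword.\<close>

lemma singleton_bound:
  fixes C :: "('l::{field,finite} ^ 'n ^ 'm) set"
  assumes diff: "\<And>A B. A \<in> C \<Longrightarrow> B \<in> C \<Longrightarrow> A - B \<in> C"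
    and rk: "\<And>A. A \<in> C \<Longrightarrow> A \<noteq> 0 \<Longrightarrow> CARD('m) - j < rank A" and j: "j \<le> CARD('m)"
  shows "card C \<le> CARD('l) ^ (CARD('n) * j)"
proof -
  obtain J :: "'m set" where J: "card J = j" "finite J"
    using obtain_subset_with_card_n[OF j] by metis
  let ?f = "\<lambda>A. restrict (\<lambda>i. row i A) J"
  have "inj_on ?f C"
  proof (rule inj_onI)
    fix A B assume AB: "A \<in> C" "B \<in> C" "?f A = ?f B"
    have "row i (A - B) = 0" if "i \<in> J" for i
      using fun_cong[OF AB(3), of i] that by (simp add: row_def vec_eq_iff)
    then have "rank (A - B) \<le> card (UNIV - J)"
      by (rule rank_le_nonzero_rows)
    also have "\<dots> = CARD('m) - j"
      using J by (simp add: card_Diff_subset)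
    finally show "A = B"
      using rk[OF diff[OF AB(1,2)]] by fastforce
  qed
  then have "card C = card (?f ` C)"
    by (simp add: card_image)
  also have "\<dots> \<le> card (Pi\<^sub>E J (\<lambda>_. UNIV :: ('l ^ 'n) set))"
    by (intro card_mono finite_PiE) (auto simp: J)
  also have "\<dots> = CARD('l) ^ (CARD('n) * j)"
    using J by (simp add: card_PiE CARD_vec power_mult)
  finally show ?thesis .
qed

section \<open>Torsion\<close>

context frobenius
begin

lemma twisted_eval_HI:
  fixes x :: 'k
  assumes "u \<in> HI N"
  shows "twisted_eval q u x = (\<Sum>i<N. coeff u i * x ^ (q ^ i))"
proof -
  have "(\<Sum>i<Suc (degree u). coeff u i * x ^ (q ^ i)) = (\<Sum>i<max N (Suc (degree u)). coeff u i * x ^ (q ^ i))"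
    by (rule sum.mono_neutral_left) (auto simp: coeff_eq_0)
  also have "\<dots> = (\<Sum>i<N. coeff u i * x ^ (q ^ i))"
    using assms by (intro sum.mono_neutral_right) (auto simp: HI_def)
  finally show ?thesis
    by (simp add: twisted_eval_def lessThan_Suc_atMost)
qed

lemma twisted_eval_add_right: "twisted_eval q u (x + y) = twisted_eval q u x + twisted_eval q u y"
  for x y :: 'k
  by (simp add: twisted_eval_def power_frobenius_pow[OF frob] distrib_left sum.distrib)

lemma twisted_eval_0_right: "twisted_eval q u (0 :: 'k) = 0"
  using q_pos by (simp add: twisted_eval_def zero_power)

lemma twisted_eval_sum_right: "twisted_eval q u (\<Sum>i\<in>A. f i) = (\<Sum>i\<in>A. twisted_eval q u (f i :: 'k))"
  by (induction A rule: infinite_finite_induct) (simp_all add: twisted_eval_0_right twisted_eval_add_right)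

lemma twisted_eval_add: "twisted_eval q (u + w) x = twisted_eval q u x + twisted_eval q w x"
  for x :: 'k
proof -
  let ?N = "max (Suc (degree u)) (Suc (degree w))"
  have uw: "u \<in> HI ?N" "w \<in> HI ?N"
    using HI_degree HI_mono max.cobounded1 max.cobounded2 by metis+
  show ?thesis
    using uw by (simp add: twisted_eval_HI[OF HI_add[OF uw]] twisted_eval_HI[OF uw(1)]
        twisted_eval_HI[OF uw(2)] distrib_right sum.distrib)
qed

lemma twisted_eval_smult: "twisted_eval q (smult c u) x = c * twisted_eval q u x" for x :: 'k
  by (simp add: twisted_eval_HI[OF HI_smult[OF HI_degree]] twisted_eval_HI[OF HI_degree]
      sum_distrib_left mult.assoc del: sum.lessThan_Suc)

lemma twisted_eval_0: "twisted_eval q 0 (x :: 'k) = 0"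
  by (simp add: twisted_eval_def)

lemma twisted_eval_sum: "twisted_eval q (\<Sum>i\<in>A. f i) (x :: 'k) = (\<Sum>i\<in>A. twisted_eval q (f i) x)"
  by (induction A rule: infinite_finite_induct) (simp_all add: twisted_eval_0 twisted_eval_add)

lemma twisted_eval_ftau: "twisted_eval q (ftau q u) x = twisted_eval q u x ^ q" for x :: 'k
proof -
  have u: "u \<in> HI (Suc (degree u))"
    by (rule HI_degree)
  have "twisted_eval q (ftau q u) x = (\<Sum>i<Suc (degree u). coeff u i ^ q * x ^ (q ^ Suc i))"
    unfolding twisted_eval_HI[OF ftau_HI[OF u]] sum.lessThan_Suc_shift[of _ "Suc (degree u)"]
    by (simp add: coeff_ftau[OF q_pos] del: sum.lessThan_Suc)
  also have "\<dots> = (\<Sum>i<Suc (degree u). coeff u i * x ^ (q ^ i)) ^ q"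
    unfolding power_frobenius_sum[OF frob q_pos]
    by (simp add: power_mult_distrib mult.commute[of q] power_mult del: sum.lessThan_Suc)
  finally show ?thesis
    by (simp add: twisted_eval_HI[OF u])
qed

lemma twisted_eval_twisted_mult:
  "twisted_eval q (twisted_mult q u w) x = twisted_eval q u (twisted_eval q w x)" for x :: 'k
proof -
  have "twisted_eval q ((ftau q ^^ i) w) x = twisted_eval q w x ^ (q ^ i)" for i
    by (induction i) (simp_all add: twisted_eval_ftau mult.commute[of q] power_mult)
  then show ?thesis
    by (simp add: twisted_mult_eq_lin lin_def twisted_eval_sum twisted_eval_smult twisted_eval_def[of q u])
qed

lemma card_twisted_eval_roots:
  fixes u :: "'k poly"
  assumes "u \<noteq> 0"
  shows "finite {x. twisted_eval q u x = 0} \<and> card {x. twisted_eval q u x = 0} \<le> q ^ degree u"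
proof -
  define p where "p = (\<Sum>i\<le>degree u. monom (coeff u i) (q ^ i))"
  have "coeff p (q ^ degree u) = (\<Sum>i\<le>degree u. if i = degree u then coeff u i else 0)"
    unfolding p_def coeff_sum using q by (intro sum.cong) auto
  then have p0: "p \<noteq> 0"
    using assms by auto
  have "degree (monom (coeff u i) (q ^ i)) \<le> q ^ degree u" if "i \<le> degree u" for i
    using degree_monom_le[of "coeff u i" "q ^ i"] that q by (meson le_trans power_increasing less_imp_le)
  then have "degree p \<le> q ^ degree u"
    unfolding p_def by (intro degree_sum_le) auto
  moreover have "{x. twisted_eval q u x = 0} = {x. poly p x = 0}"
    by (simp add: p_def poly_sum poly_monom twisted_eval_def)
  ultimately show ?thesis
    using poly_roots_finite[OF p0] card_poly_roots_bound[OF p0] by simp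
qed

end

lemma (in A_algebra) \<gamma>_minus_1: "\<gamma> [:- 1:] = - 1"
proof -
  have "\<gamma> [:- 1:] = \<gamma> (0 - 1)"
    by (simp add: one_pCons)
  then show ?thesis
    unfolding \<gamma>_diff by (simp add: \<gamma>_0 \<gamma>_1)
qed

section \<open>The residue field and its action on torsion points\<close>

locale residue_field = A_algebra \<epsilon> q
  for \<epsilon> :: "'q::{field,finite} poly \<Rightarrow> 'l::{field,finite}" and q :: nat +
  fixes f :: "'q poly"
  assumes ker: "\<epsilon> a = 0 \<longleftrightarrow> f dvd a" and surj: "surj \<epsilon>" and deg_pos: "degree f > 0"
begin

lemma eq_iff: "\<epsilon> a = \<epsilon> b \<longleftrightarrow> f dvd a - b"
  using ker[of "a - b"] by (simp add: \<gamma>_diff)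

lemma card_residue_field: "CARD('l) = q ^ degree f"
proof -
  have "bij_betw \<epsilon> (HI (degree f)) UNIV"
    unfolding bij_betw_def
  proof
    show "inj_on \<epsilon> (HI (degree f))"
    proof (rule inj_onI)
      fix a b assume ab: "a \<in> HI (degree f)" "b \<in> HI (degree f)" "\<epsilon> a = \<epsilon> b"
      then have dvd: "f dvd a - b"
        by (simp add: eq_iff)
      have "a - b \<in> HI (degree f)"
        using ab by (intro HI_diff)
      then have "degree (a - b) < degree f \<or> a - b = 0"
        using deg_pos HI_degree_iff[of "a - b" "degree f - 1"] by (cases "a - b = 0") auto
      then show "a = b"
        using dvd_imp_degree_le[OF dvd] by (cases "a = b") auto
    qed
    show "\<epsilon> ` HI (degree f) = UNIV"
    proof (intro subset_antisym subsetI)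
      fix x
      obtain a where a: "x = \<epsilon> a"
        using surj by blast
      have "\<epsilon> a = \<epsilon> (a mod f)"
        by (simp add: eq_iff)
      moreover have "a mod f \<in> HI (degree f)"
        using degree_mod_less[of f a] deg_pos by (cases "f = 0") (auto simp: HI_def coeff_eq_0)
      ultimately show "x \<in> \<epsilon> ` HI (degree f)"
        using a by blast
    qed simp
  qed
  then have "card (HI (degree f) :: 'q poly set) = CARD('l)"
    by (rule bij_betw_same_card)
  then show ?thesis
    using card_HI[where 'q = 'q, of "degree f"] by (simp add: q_card)
qed

lemma vector_space_matrix_scale: "vector_space (matrix_scale \<epsilon> :: 'q \<Rightarrow> 'l ^ 'n ^ 'm \<Rightarrow> _)"
proof
  fix a b :: 'q and x y :: "'l ^ 'n ^ 'm"
  have "\<epsilon> [:a + b:] = \<epsilon> [:a:] + \<epsilon> [:b:]"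
    using \<gamma>_add[of "[:a:]" "[:b:]"] by simp
  then show "matrix_scale \<epsilon> (a + b) x = matrix_scale \<epsilon> a x + matrix_scale \<epsilon> b x"
    by (simp add: matrix_scale_def vec_eq_iff distrib_right)
  have "\<epsilon> [:a * b:] = \<epsilon> [:a:] * \<epsilon> [:b:]"
    using \<gamma>_mult[of "[:a:]" "[:b:]"] by (simp add: mult.commute)
  then show "matrix_scale \<epsilon> a (matrix_scale \<epsilon> b x) = matrix_scale \<epsilon> (a * b) x"
    by (simp add: matrix_scale_def vec_eq_iff mult.assoc)
  show "matrix_scale \<epsilon> a (x + y) = matrix_scale \<epsilon> a x + matrix_scale \<epsilon> a y"
    by (simp add: matrix_scale_def vec_eq_iff distrib_left)
  show "matrix_scale \<epsilon> 1 x = x"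
    using \<gamma>_1 by (simp add: matrix_scale_def vec_eq_iff one_pCons)
qed

end

locale torsion_coordinates = A_characteristic \<gamma> q \<pp> + R: residue_field \<epsilon> q f
  for \<gamma> :: "'q::{field,finite} poly \<Rightarrow> 'k::alg_closed_field" and q and \<pp>
    and \<epsilon> :: "'q poly \<Rightarrow> 'l::{field,finite}" and f :: "'q poly"
begin

text \<open>Two representatives of a residue class differ by a multiple of \<open>f\<close>, which
  annihilates the torsion.\<close>

lemma torsion_scale_eq:
  assumes dm: "drinfeld_module \<gamma> r \<phi>" and \<alpha>: "\<alpha> \<in> torsion \<phi> f"
  shows "torsion_scale \<phi> \<epsilon> (\<epsilon> a) \<alpha> = twisted_eval q (\<phi> a) \<alpha>"
proof -
  let ?a = "inv_into UNIV \<epsilon> (\<epsilon> a)"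
  have "\<epsilon> ?a = \<epsilon> a"
    by (rule f_inv_into_f) simp
  then obtain c where c: "?a = c * f + a"
    unfolding R.eq_iff by (metis diff_eq_eq dvd_def mult.commute)
  have "twisted_eval q (\<phi> ?a) \<alpha> = twisted_eval q (\<phi> c) (twisted_eval q (\<phi> f) \<alpha>) + twisted_eval q (\<phi> a) \<alpha>"
    unfolding c using dm by (simp add: drinfeld_module_def twisted_eval_add twisted_eval_twisted_mult flip: q_card)
  then show ?thesis
    using \<alpha> by (simp add: torsion_scale_def torsion_def twisted_eval_0_right flip: q_card)
qed

lemma torsion_eval:
  assumes dm: "drinfeld_module \<gamma> r \<phi>" and \<alpha>: "\<alpha> \<in> torsion \<phi> f"
  shows "twisted_eval q (\<phi> a) \<alpha> \<in> torsion \<phi> f"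
proof -
  have "twisted_eval q (\<phi> f) (twisted_eval q (\<phi> a) \<alpha>) = twisted_eval q (\<phi> (f * a)) \<alpha>"
    using dm by (simp add: drinfeld_module_def twisted_eval_twisted_mult flip: q_card)
  also have "\<dots> = twisted_eval q (\<phi> a) (twisted_eval q (\<phi> f) \<alpha>)"
    using dm by (simp add: drinfeld_module_def twisted_eval_twisted_mult mult.commute[of f] flip: q_card)
  finally show ?thesis
    using \<alpha> by (simp add: torsion_def twisted_eval_0_right flip: q_card)
qed

lemma torsion_scale_add:
  assumes dm: "drinfeld_module \<gamma> r \<phi>" and \<alpha>: "\<alpha> \<in> torsion \<phi> f"
  shows "torsion_scale \<phi> \<epsilon> (x + y) \<alpha> = torsion_scale \<phi> \<epsilon> x \<alpha> + torsion_scale \<phi> \<epsilon> y \<alpha>"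
proof -
  obtain a b where ab: "x = \<epsilon> a" "y = \<epsilon> b"
    using R.surj by (metis surjD)
  show ?thesis
    unfolding ab R.\<gamma>_add[symmetric] torsion_scale_eq[OF dm \<alpha>]
    using dm by (simp add: drinfeld_module_def twisted_eval_add)
qed

lemma torsion_scale_mult:
  assumes dm: "drinfeld_module \<gamma> r \<phi>" and \<alpha>: "\<alpha> \<in> torsion \<phi> f"
  shows "torsion_scale \<phi> \<epsilon> (x * y) \<alpha> = torsion_scale \<phi> \<epsilon> x (torsion_scale \<phi> \<epsilon> y \<alpha>)"
proof -
  obtain a b where ab: "x = \<epsilon> a" "y = \<epsilon> b"
    using R.surj by (metis surjD)
  show ?thesis
    unfolding ab R.\<gamma>_mult[symmetric] torsion_scale_eq[OF dm \<alpha>] torsion_scale_eq[OF dm torsion_eval[OF dm \<alpha>]]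
    using dm by (simp add: drinfeld_module_def twisted_eval_twisted_mult flip: q_card)
qed

lemma torsion_scale_sum:
  "torsion_scale \<phi> \<epsilon> x (\<Sum>i\<in>A. \<alpha> i) = (\<Sum>i\<in>A. torsion_scale \<phi> \<epsilon> x (\<alpha> i))"
  for \<alpha> :: "_ \<Rightarrow> 'k"
  by (simp add: torsion_scale_def twisted_eval_sum_right flip: q_card)

lemma torsion_comb_add:
  assumes "drinfeld_module \<gamma> r \<phi>" "torsion_basis \<phi> f \<epsilon> b"
  shows "torsion_comb \<phi> \<epsilon> b (v + w) = torsion_comb \<phi> \<epsilon> b v + torsion_comb \<phi> \<epsilon> b w"
  using assms by (simp add: torsion_comb_def torsion_basis_def torsion_scale_add sum.distrib)

lemma torsion_comb_0:
  assumes "drinfeld_module \<gamma> r \<phi>" "torsion_basis \<phi> f \<epsilon> b"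
  shows "torsion_comb \<phi> \<epsilon> b 0 = 0"
  using torsion_comb_add[OF assms, of 0 0] by (metis add_cancel_right_right add_0)

lemma torsion_comb_sum:
  assumes "drinfeld_module \<gamma> r \<phi>" "torsion_basis \<phi> f \<epsilon> b"
  shows "torsion_comb \<phi> \<epsilon> b (\<Sum>i\<in>A. v i) = (\<Sum>i\<in>A. torsion_comb \<phi> \<epsilon> b (v i))"
  by (induction A rule: infinite_finite_induct)
    (simp_all add: torsion_comb_0[OF assms] torsion_comb_add[OF assms])

lemma torsion_comb_scale:
  assumes "drinfeld_module \<gamma> r \<phi>" "torsion_basis \<phi> f \<epsilon> b"
  shows "torsion_comb \<phi> \<epsilon> b (x *s v) = torsion_scale \<phi> \<epsilon> x (torsion_comb \<phi> \<epsilon> b v)"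
  using assms by (simp add: torsion_comb_def torsion_basis_def torsion_scale_mult torsion_scale_sum)

end

section \<open>Matrices of morphisms and the code they form\<close>

locale torsion_matrices = torsion_coordinates \<gamma> q \<pp> \<epsilon> f
  for \<gamma> :: "'q::{field,finite} poly \<Rightarrow> 'k::alg_closed_field" and q and \<pp>
    and \<epsilon> :: "'q poly \<Rightarrow> 'l::{field,finite}" and f +
  fixes r :: nat and \<phi> \<psi> :: "'q poly \<Rightarrow> 'k poly" and b b' :: "'n::finite \<Rightarrow> 'k"
  assumes dm: "drinfeld_module \<gamma> r \<phi>" "drinfeld_module \<gamma> r \<psi>"
    and basis: "torsion_basis \<phi> f \<epsilon> b" "torsion_basis \<psi> f \<epsilon> b'"
begin

abbreviation mat_of :: "'k poly \<Rightarrow> 'l ^ 'n ^ 'n" where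
  "mat_of \<equiv> torsion_matrix \<psi> \<epsilon> b b'"

lemma comb_inj: "torsion_comb \<psi> \<epsilon> b' v = torsion_comb \<psi> \<epsilon> b' w \<longleftrightarrow> v = w"
  using basis(2) by (auto simp: torsion_basis_def bij_betw_def inj_on_def)

lemma Hom_eval:
  assumes u: "u \<in> drinfeld_Hom \<phi> \<psi>"
  shows "twisted_eval q u (twisted_eval q (\<phi> a) \<alpha>) = twisted_eval q (\<psi> a) (twisted_eval q u \<alpha>)"
  using u by (simp add: drinfeld_Hom_def flip: twisted_eval_twisted_mult q_card)

lemma Hom_torsion:
  assumes u: "u \<in> drinfeld_Hom \<phi> \<psi>" and \<alpha>: "\<alpha> \<in> torsion \<phi> f"
  shows "twisted_eval q u \<alpha> \<in> torsion \<psi> f"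
  using Hom_eval[OF u, of f \<alpha>] \<alpha> by (simp add: torsion_def twisted_eval_0_right flip: q_card)

lemma mat_of_unique:
  assumes "\<And>j. twisted_eval q u (b j) = torsion_comb \<psi> \<epsilon> b' (column j M)"
  shows "mat_of u = M"
  unfolding torsion_matrix_def
proof (rule the_equality)
  fix X assume "\<forall>j. twisted_eval CARD('q) u (b j) = torsion_comb \<psi> \<epsilon> b' (column j X)"
  then have "column j X = column j M" for j
    using assms comb_inj by (simp flip: q_card)
  then show "X = M"
    by (simp add: vec_eq_iff column_def)
qed (use assms in \<open>simp flip: q_card\<close>)

lemma mat_of_column:
  assumes u: "u \<in> drinfeld_Hom \<phi> \<psi>"
  shows "twisted_eval q u (b j) = torsion_comb \<psi> \<epsilon> b' (column j (mat_of u))"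
proof -
  have "twisted_eval q u (b j) \<in> range (torsion_comb \<psi> \<epsilon> b')" for j
    using Hom_torsion[OF u, of "b j"] basis by (auto simp: torsion_basis_def bij_betw_def)
  then have "\<forall>j. \<exists>w. twisted_eval q u (b j) = torsion_comb \<psi> \<epsilon> b' w"
    by (auto simp: image_iff)
  then obtain w where w: "\<And>j. twisted_eval q u (b j) = torsion_comb \<psi> \<epsilon> b' (w j)"
    by metis
  have "column j (\<chi> i j. w j $ i) = w j" for j
    by (simp add: column_def vec_eq_iff)
  then have "mat_of u = (\<chi> i j. w j $ i)" "column j (\<chi> i j. w j $ i) = w j"
    using w by (auto intro!: mat_of_unique)
  then show ?thesis
    using w by simp
qed

lemma mat_of_add:
  assumes "u \<in> drinfeld_Hom \<phi> \<psi>" "w \<in> drinfeld_Hom \<phi> \<psi>"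
  shows "mat_of (u + w) = mat_of u + mat_of w"
proof (rule mat_of_unique)
  fix j
  have "column j (mat_of u + mat_of w) = column j (mat_of u) + column j (mat_of w)"
    by (simp add: column_def vec_eq_iff)
  then show "twisted_eval q (u + w) (b j) = torsion_comb \<psi> \<epsilon> b' (column j (mat_of u + mat_of w))"
    by (simp only: twisted_eval_add torsion_comb_add[OF dm(2) basis(2)] mat_of_column[OF assms(1)]
        mat_of_column[OF assms(2)])
qed

lemma mat_of_scale:
  assumes u: "u \<in> drinfeld_Hom \<phi> \<psi>"
  shows "mat_of (smult (\<gamma> [:c:]) u) = matrix_scale \<epsilon> c (mat_of u)"
proof (rule mat_of_unique)
  fix j
  have tor: "twisted_eval q u (b j) \<in> torsion \<psi> f"
    using Hom_torsion[OF u] basis by (simp add: torsion_basis_def)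
  have "column j (matrix_scale \<epsilon> c (mat_of u)) = \<epsilon> [:c:] *s column j (mat_of u)"
    by (simp add: column_def matrix_scale_def vec_eq_iff)
  then have "torsion_comb \<psi> \<epsilon> b' (column j (matrix_scale \<epsilon> c (mat_of u)))
      = torsion_scale \<psi> \<epsilon> (\<epsilon> [:c:]) (twisted_eval q u (b j))"
    by (simp only: torsion_comb_scale[OF dm(2) basis(2)] mat_of_column[OF u])
  also have "\<dots> = twisted_eval q [:\<gamma> [:c:]:] (twisted_eval q u (b j))"
    using dm(2) unfolding torsion_scale_eq[OF dm(2) tor] by (simp add: drinfeld_module_def)
  also have "\<dots> = twisted_eval q (smult (\<gamma> [:c:]) u) (b j)"
    by (simp add: twisted_eval_smult) (simp add: twisted_eval_def)
  finally show "twisted_eval q (smult (\<gamma> [:c:]) u) (b j)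
      = torsion_comb \<psi> \<epsilon> b' (column j (matrix_scale \<epsilon> c (mat_of u)))"
    by simp
qed

lemma mat_of_apply:
  assumes u: "u \<in> drinfeld_Hom \<phi> \<psi>"
  shows "twisted_eval q u (torsion_comb \<phi> \<epsilon> b v) = torsion_comb \<psi> \<epsilon> b' (mat_of u *v v)"
proof -
  have "twisted_eval q u (torsion_comb \<phi> \<epsilon> b v)
      = (\<Sum>j\<in>UNIV. torsion_scale \<psi> \<epsilon> (v $ j) (twisted_eval q u (b j)))"
    by (simp add: torsion_comb_def twisted_eval_sum_right torsion_scale_def Hom_eval[OF u] flip: q_card)
  also have "\<dots> = torsion_comb \<psi> \<epsilon> b' (\<Sum>j\<in>UNIV. v $ j *s column j (mat_of u))"
    by (simp add: torsion_comb_sum[OF dm(2) basis(2)] torsion_comb_scale[OF dm(2) basis(2)] mat_of_column[OF u])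
  finally show ?thesis
    by (simp add: matrix_mult_sum)
qed

text \<open>The basis \<open>b\<close> embeds the kernel of the matrix into the zeros of
  \<open>u\<close>, of which there are at most \<open>q ^ degree u\<close>. Combined with
  \<open>card_kernel_rank\<close>, this is an inequality of powers of \<open>q\<close>.\<close>

lemma rank_mat_of:
  assumes u: "u \<in> drinfeld_Hom \<phi> \<psi>" "u \<noteq> 0"
  shows "degree f * CARD('n) \<le> degree u + degree f * rank (mat_of u)"
proof -
  let ?K = "{x. mat_of u *v x = 0}"
  have "card ?K \<le> card {x. twisted_eval q u x = 0}"
  proof (rule card_inj_on_le[where f = "torsion_comb \<phi> \<epsilon> b"])
    show "inj_on (torsion_comb \<phi> \<epsilon> b) ?K"
      using basis(1) by (auto simp: torsion_basis_def bij_betw_def inj_on_def)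
    show "torsion_comb \<phi> \<epsilon> b ` ?K \<subseteq> {x. twisted_eval q u x = 0}"
      by (auto simp: mat_of_apply[OF u(1)] torsion_comb_0[OF dm(2) basis(2)])
    show "finite {x. twisted_eval q u x = 0}"
      using card_twisted_eval_roots[OF u(2)] by simp
  qed
  also have "\<dots> \<le> q ^ degree u"
    using card_twisted_eval_roots[OF u(2)] by simp
  finally have "card ?K * CARD('l) ^ rank (mat_of u) \<le> q ^ degree u * CARD('l) ^ rank (mat_of u)"
    by simp
  then have "CARD('l) ^ CARD('n) \<le> q ^ degree u * CARD('l) ^ rank (mat_of u)"
    using card_kernel_rank[of "mat_of u"] by linarith
  then have "q ^ (degree f * CARD('n)) \<le> q ^ (degree u + degree f * rank (mat_of u))"
    by (simp add: R.card_residue_field power_mult power_add)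
  then show ?thesis
    using q by (simp add: power_increasing_iff)
qed

lemma rank_bounded_Hom:
  assumes "u \<in> bounded_Hom \<phi> \<psi> (t * degree f - 1)" "u \<noteq> 0" "1 \<le> t" "t \<le> CARD('n)"
  shows "CARD('n) - t < rank (mat_of u)"
proof -
  have u: "u \<in> drinfeld_Hom \<phi> \<psi>" and "degree u \<le> t * degree f - 1"
    using assms(1,2) by (auto simp: bounded_Hom_def)
  moreover have "t * degree f > 0"
    using R.deg_pos assms(3) by simp
  ultimately have "degree u < t * degree f"
    by linarith
  then have "degree u < degree f * t"
    by (simp add: mult.commute)
  then have "degree f * CARD('n) < degree f * (t + rank (mat_of u))"
    using rank_mat_of[OF u assms(2)] by (simp add: distrib_left)
  then have "CARD('n) < t + rank (mat_of u)"
    by simp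
  then show ?thesis
    using assms(4) by linarith
qed

lemma bounded_Hom_closed:
  assumes "u \<in> bounded_Hom \<phi> \<psi> s" "w \<in> bounded_Hom \<phi> \<psi> s"
  shows "u + w \<in> bounded_Hom \<phi> \<psi> s" "smult (\<gamma> [:c:]) u \<in> bounded_Hom \<phi> \<psi> s"
proof -
  have "twisted_mult q u (smult (\<gamma> [:c:]) w) = smult (\<gamma> [:c:]) (twisted_mult q u w)" for u w
    using twisted_mult_const_right[OF \<gamma>_const_pow, of u c] twisted_mult_const[of "\<gamma> [:c:]" w]
      klinear_smult[OF klinear_twisted_mult, of "\<gamma> [:c:]" u w] by (metis twisted_mult_assoc)
  then show "u + w \<in> bounded_Hom \<phi> \<psi> s" "smult (\<gamma> [:c:]) u \<in> bounded_Hom \<phi> \<psi> s"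
    using assms unfolding bounded_Hom_eq[OF dm] drinfeld_Hom_iff[OF dm]
    by (auto simp: twisted_mult_add_right klinear_add[OF klinear_twisted_mult]
        klinear_smult[OF klinear_twisted_mult] intro: HI_add HI_smult)
qed

lemma bounded_Hom_subset: "bounded_Hom \<phi> \<psi> s \<subseteq> drinfeld_Hom \<phi> \<psi>"
  unfolding bounded_Hom_eq[OF dm] by auto

lemma mat_of_0: "mat_of 0 = 0"
  using mat_of_add[of 0 0] bounded_Hom_subset by (auto simp: bounded_Hom_def)

lemma code_closed:
  assumes "A \<in> mat_of ` bounded_Hom \<phi> \<psi> s" "B \<in> mat_of ` bounded_Hom \<phi> \<psi> s"
  shows "A + B \<in> mat_of ` bounded_Hom \<phi> \<psi> s" "matrix_scale \<epsilon> c A \<in> mat_of ` bounded_Hom \<phi> \<psi> s"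
proof -
  obtain u w where u: "A = mat_of u" "u \<in> bounded_Hom \<phi> \<psi> s" and w: "B = mat_of w" "w \<in> bounded_Hom \<phi> \<psi> s"
    using assms by blast
  have h: "u \<in> drinfeld_Hom \<phi> \<psi>" "w \<in> drinfeld_Hom \<phi> \<psi>"
    using u w bounded_Hom_subset by auto
  show "A + B \<in> mat_of ` bounded_Hom \<phi> \<psi> s"
    unfolding u w mat_of_add[OF h, symmetric] by (intro imageI bounded_Hom_closed u w)
  show "matrix_scale \<epsilon> c A \<in> mat_of ` bounded_Hom \<phi> \<psi> s"
    unfolding u mat_of_scale[OF h(1), symmetric] by (intro imageI bounded_Hom_closed[OF u(2) u(2)])
qed

text \<open>Over the finite field F_q the cardinality of a subspace fixes its dimension, which links
  the code to the count of morphisms.\<close>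

lemma card_eq_dim:
  "card (mat_of ` bounded_Hom \<phi> \<psi> s) = q ^ code_dim \<epsilon> (mat_of ` bounded_Hom \<phi> \<psi> s)"
proof -
  interpret vector_space "matrix_scale \<epsilon> :: 'q \<Rightarrow> 'l ^ 'n ^ 'n \<Rightarrow> _"
    by (rule R.vector_space_matrix_scale)
  have "0 \<in> bounded_Hom \<phi> \<psi> s"
    by (simp add: bounded_Hom_def)
  then have "subspace (mat_of ` bounded_Hom \<phi> \<psi> s)"
    unfolding subspace_def using code_closed by (auto intro: rev_image_eqI mat_of_0[symmetric])
  then show ?thesis
    using card_subspace unfolding code_dim_def q_card by (metis finite)
qed

lemma code_diff:
  assumes "A \<in> mat_of ` bounded_Hom \<phi> \<psi> s" "B \<in> mat_of ` bounded_Hom \<phi> \<psi> s"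
  shows "A - B \<in> mat_of ` bounded_Hom \<phi> \<psi> s"
proof -
  have "A - B = A + matrix_scale \<epsilon> (- 1) B"
    by (simp add: matrix_scale_def vec_eq_iff R.\<gamma>_minus_1)
  then show ?thesis
    using code_closed assms by metis
qed

lemma inj_on_mat_of:
  assumes "1 \<le> t" "t < CARD('n)"
  shows "inj_on mat_of (bounded_Hom \<phi> \<psi> (t * degree f - 1))"
proof (rule inj_onI)
  let ?M = "bounded_Hom \<phi> \<psi> (t * degree f - 1)"
  fix u w assume uw: "u \<in> ?M" "w \<in> ?M" "mat_of u = mat_of w"
  have "smult (\<gamma> [:- 1:]) w \<in> ?M"
    by (rule bounded_Hom_closed(2)[OF uw(2) uw(2)])
  then have "u - w \<in> ?M"
    using bounded_Hom_closed(1)[OF uw(1), of "- w"] by (simp add: \<gamma>_minus_1)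
  have "mat_of (u - w) + mat_of w = mat_of (u - w + w)"
    using \<open>u - w \<in> ?M\<close> uw(2) bounded_Hom_subset by (intro mat_of_add[symmetric]) auto
  then have "mat_of (u - w) = 0"
    using uw(3) by simp
  moreover have "rank (0 :: 'l ^ 'n ^ 'n) = 0"
    using rank_le_nonzero_rows[of UNIV "0 :: 'l ^ 'n ^ 'n"] by (simp add: row_def vec_eq_iff)
  ultimately have "u - w = 0"
    using rank_bounded_Hom[OF \<open>u - w \<in> ?M\<close> _ assms(1)] assms(2) by fastforce
  then show "u = w"
    by simp
qed

end

section \<open>Dimension and minimum rank distance of the code\<close>

theorem proposition3p7:
  fixes \<pp> f :: "'q::{field,finite} poly"
    and \<gamma> :: "'q poly \<Rightarrow> 'k::alg_closed_field"
    and \<epsilon> :: "'q poly \<Rightarrow> 'l::{field,finite}"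
    and \<phi> \<psi> :: "'q poly \<Rightarrow> 'k poly"
    and b b' :: "'n::finite \<Rightarrow> 'k"
    and C :: "('l ^ 'n ^ 'n) set"
    and r d m c t s :: nat
  assumes "prime_elem \<pp>" and "lead_coeff \<pp> = 1" and "d = degree \<pp>"
    and "residue_closure_map \<pp> \<gamma>"
    and "r = CARD('n)" and "r \<ge> 2"
    and "supersingular \<gamma> \<pp> r \<phi>"
    and "supersingular \<gamma> \<pp> r \<psi>"
    and "irreducible f" and "lead_coeff f = 1" and "m = degree f" and "f \<noteq> \<pp>"
    and "residue_field_map f \<epsilon>"
    and "torsion_basis \<phi> f \<epsilon> b" and "torsion_basis \<psi> f \<epsilon> b'"
    and "c = r * (r - 1) * (d - 1) div 2"
    and "1 \<le> t" and "t < r" and "s = t * m - 1" and "t * m - 1 \<ge> r * c"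
    and "C = torsion_matrix \<psi> \<epsilon> b b' ` bounded_Hom \<phi> \<psi> s"
  shows "int (code_dim \<epsilon> C) = int (m * r * t) - int c
    \<and> int (min_rank_dist C) = int r - int t + 1
    \<and> int (m * r) * (int r - int (min_rank_dist C) + 1) - int (code_dim \<epsilon> C) = int c"
proof -
  have A: "A_field_map \<gamma>" "\<And>a. \<gamma> a = 0 \<longleftrightarrow> \<pp> dvd a"
    using assms(4) by (auto simp: residue_closure_map_def)
  have deg_p: "degree \<pp> > 0"
    using assms(1) by (auto simp: prime_elem_def is_unit_iff_degree)
  have deg_f: "degree f > 0"
    using assms(9) by (auto simp: irreducible_def is_unit_iff_degree)
  have E: "A_field_map \<epsilon>" "\<And>a. \<epsilon> a = 0 \<longleftrightarrow> f dvd a" "surj \<epsilon>"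
    using assms(13) by (auto simp: residue_field_map_def)
  have dm: "drinfeld_module \<gamma> r \<phi>" "drinfeld_module \<gamma> r \<psi>"
    using assms(7,8) by (auto simp: supersingular_def)
  interpret torsion_matrices \<gamma> "CARD('q)" \<pp> \<epsilon> f r \<phi> \<psi> b b'
    by unfold_locales (use A deg_p E deg_f dm assms(14,15) in auto)
  define h where "h = r * (r - 1) div 2"
  have "even (r * (r - 1))"
    by (cases "r = 0") auto
  then have h: "2 * h = r * (r - 1)"
    by (simp add: h_def)
  have "c = (2 * h * (d - 1)) div 2"
    using assms(16) h by simp
  then have c: "c = h * (d - 1)"
    by simp
  have "2 * 1 \<le> r * (r - 1)"
    using assms(6) by (intro mult_le_mono) auto
  then have "h \<ge> 1"
    using h by linarith
  \<comment> \<open>With \<open>r * c \<le> s\<close> this supplies the bound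
    \<open>r * (d - 1) \<le> s\<close> under which morphisms were counted.\<close>
  then have dc: "d - 1 \<le> c"
    unfolding c by simp
  have "r * (degree \<pp> - 1) \<le> r * c"
    unfolding assms(3)[symmetric] by (rule mult_le_mono2[OF dc])
  then have "r * (degree \<pp> - 1) \<le> s"
    using assms(19,20) by linarith
  then obtain e where e: "card (bounded_Hom \<phi> \<psi> s) = CARD('q) ^ e"
    "e + degree \<pp> * (r * (r - 1) div 2) = (\<Sum>j<r. Suc (s + j))"
    using card_bounded_Hom[OF assms(7,8)] by blast
  have tm: "Suc s = t * m"
    using assms(11,17,19) deg_f by simp
  have "(\<Sum>j<r. Suc (s + j)) = r * (t * m) + h"
    by (simp add: sum.distrib tm[symmetric] h_def Sum_Ico_nat atLeast0LessThan[symmetric]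
        flip: add_Suc)
  \<comment> \<open>The surplus \<open>h\<close> occurs both in the number of conditions and in the
    sum of the degrees, and cancels.\<close>
  moreover have "d * h = c + h"
  proof -
    have "c + h = (d - 1 + 1) * h"
      unfolding c by (simp only: distrib_left mult_1_right mult.commute[of _ h])
    also have "d - 1 + 1 = d"
      using deg_p assms(3) by simp
    finally show ?thesis
      by simp
  qed
  moreover have "e + d * h = (\<Sum>j<r. Suc (s + j))"
    using e(2) unfolding h_def assms(3) .
  ultimately have "e + c = r * (t * m)"
    by linarith
  then have ec: "e + c = m * r * t"
    by (simp add: mult_ac)
  have C: "C = mat_of ` bounded_Hom \<phi> \<psi> (t * degree f - 1)"
    using assms(11,19,21) by simp
  have "inj_on mat_of (bounded_Hom \<phi> \<psi> (t * degree f - 1))"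
    using assms(5,17,18) by (intro inj_on_mat_of) auto
  then have card_C: "card C = CARD('q) ^ e"
    using e(1) C assms(11,19) by (simp add: card_image)
  then have "CARD('q) ^ code_dim \<epsilon> C = CARD('q) ^ e"
    using card_eq_dim[of "t * degree f - 1"] C by simp
  then have dim: "code_dim \<epsilon> C = e"
    using card_field_gt_1[where 'q = 'q] by (simp add: power_inject_exp)
  have low: "r - t < rank X" if "X \<in> C" "X \<noteq> 0" for X
    using that rank_bounded_Hom[OF _ _ assms(17)] mat_of_0 assms(18) unfolding C assms(5) by fastforce
  \<comment> \<open>If all ranks were larger, the Singleton bound for \<open>t - 1\<close> rows
    would give \<open>m * r \<le> c\<close>, whereas \<open>r * c \<le> t * m - 1 < r * m\<close>
    gives \<open>c < m\<close>.\<close>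
  have "\<exists>X\<in>C - {0}. rank X \<le> r - (t - 1)"
  proof (rule ccontr)
    assume "\<not> ?thesis"
    then have "r - (t - 1) < rank X" if "X \<in> C" "X \<noteq> 0" for X
      using that by (auto simp: not_le)
    then have "card C \<le> CARD('l) ^ (CARD('n) * (t - 1))"
      using code_diff assms(5,18) unfolding C by (intro singleton_bound) auto
    then have "CARD('q) ^ e \<le> CARD('q) ^ (m * (r * (t - 1)))"
      using card_C R.card_residue_field assms(5,11) by (simp add: power_mult)
    then have "e \<le> m * (r * (t - 1))"
      using card_field_gt_1[where 'q = 'q] by (simp add: power_increasing_iff)
    moreover have "m * r * t = m * (r * (t - 1)) + m * r"
      using assms(17) by (cases t) (auto simp: algebra_simps)
    ultimately have "m * r \<le> c"
      using ec by linarith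
    moreover have "t * m < r * m"
      using assms(18) deg_f assms(11) by simp
    ultimately have "r * c < r * m"
      using assms(20) tm by linarith
    then have "c < m"
      by simp
    then show False
      using \<open>m * r \<le> c\<close> assms(6) by (metis le_trans mult_le_mono2 nat_mult_1_right not_le one_le_numeral)
  qed
  then obtain X where X: "X \<in> C" "X \<noteq> 0" "rank X \<le> r - (t - 1)"
    by auto
  have rk: "rank X = r - t + 1"
    using low[OF X(1,2)] X(3) assms(17,18) by linarith
  have "Min (rank ` (C - {0})) = rank X"
  proof (rule Min_eqI)
    show "rank X \<le> y" if "y \<in> rank ` (C - {0})" for y
      using that low by (auto simp: rk Suc_le_eq)
  qed (use X in auto)
  then have min: "int (min_rank_dist C) = int r - int t + 1"
    using assms(18) by (simp add: min_rank_dist_def rk)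
  have "int (code_dim \<epsilon> C) = int (m * r * t) - int c"
    unfolding ec[symmetric] dim by simp
  moreover have "int (m * r) * (int r - int (min_rank_dist C) + 1) = int (m * r * t)"
    unfolding min by simp
  ultimately show ?thesis
    using min by simp
qed

end
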